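(* Let $\beta:\mathbb{R}^+\to[-1,1]$ be a Borel function and let $B^\beta$ be a weak solution of $$B^\beta_t = x + W_t + \int_0^t \beta(s)\,dL^0_s(B^\beta),\qquad t\ge 0.$$ Then, under $\mathbb{P}^0$ (i.e. for starting point $x=0$), for all $t>0$ and $y\in\mathbb{R}$, $$\mathbb{P}^0(B^\beta_t\in dy)=p^\beta(0,t;0,y)\,dy,\qquad p^{\beta}(0,t;0,y)=\frac{|y|}{\pi}\int_0^t\frac{1+\mathrm{sgn}(y)\beta(s)}{2}\,\frac{1}{\sqrt{s}\,(t-s)^{3/2}}\exp\left(-\frac{y^2}{2(t-s)}\right)ds.$$
   Context: $W$ denotes a standard Brownian motion. For a continuous semimartingale $X$, $L^0_\cdot(X)$ denotes its symmetric local time at $0$: $L^0_t(X)=\lim_{\varepsilon\to0}\frac1{2\varepsilon}\int_0^t\mathbf 1_{(-\varepsilon,\varepsilon)}(X_s)\,d\langle X\rangle_s$. A weak solution is a continuous semimartingale $B^\beta$ on some filtered probability space carrying a Brownian motion $W$ such that the equation holds. $\mathrm{sgn}$ is the symmetric sign function, $\mathrm{sgn}(0)=0$. *)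

theory Defs
  imports "HOL-Probability.Probability"
begin

text \<open>
  Processes are functions \<open>X :: real \<Rightarrow> 'a \<Rightarrow> real\<close> of time and sample point. Only times \<open>t \<ge> 0\<close>
  matter; the values of processes and \<open>\<sigma>\<close>-algebras at negative times carry no information.
  No usual conditions are imposed on filtrations. Path properties are required almost surely.
\<close>

locale filtered_prob_space = prob_space M + filtration "space M" F
  for M :: "'a measure" and F :: "real \<Rightarrow> 'a measure" +
  assumes sets_F_subset: "\<And>t. sets (F t) \<subseteq> sets M"

definition adapted :: "(real \<Rightarrow> 'a measure) \<Rightarrow> (real \<Rightarrow> 'a \<Rightarrow> real) \<Rightarrow> bool" where
  "adapted F X \<longleftrightarrow> (\<forall>t\<ge>0. X t \<in> borel_measurable (F t))"

definition continuous_process :: "'a measure \<Rightarrow> (real \<Rightarrow> 'a \<Rightarrow> real) \<Rightarrow> bool" where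
  "continuous_process M X \<longleftrightarrow> (AE \<omega> in M. continuous_on {0..} (\<lambda>t. X t \<omega>))"

definition brownian_motion ::
  "'a measure \<Rightarrow> (real \<Rightarrow> 'a measure) \<Rightarrow> (real \<Rightarrow> 'a \<Rightarrow> real) \<Rightarrow> bool" where
  "brownian_motion M F W \<longleftrightarrow>
     adapted F W \<and> continuous_process M W \<and> (AE \<omega> in M. W 0 \<omega> = 0) \<and>
     (\<forall>s t. 0 \<le> s \<and> s < t \<longrightarrow>
        distributed M lborel (\<lambda>\<omega>. W t \<omega> - W s \<omega>) (normal_density 0 (sqrt (t - s))) \<and>
        prob_space.indep_set M (sets (F s))
          {(\<lambda>\<omega>. W t \<omega> - W s \<omega>) -` A \<inter> space M | A. A \<in> sets borel})"

definition martingale ::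
  "'a measure \<Rightarrow> (real \<Rightarrow> 'a measure) \<Rightarrow> (real \<Rightarrow> 'a \<Rightarrow> real) \<Rightarrow> bool" where
  "martingale M F X \<longleftrightarrow>
     adapted F X \<and> (\<forall>t\<ge>0. integrable M (X t)) \<and>
     (\<forall>s t. 0 \<le> s \<and> s \<le> t \<longrightarrow> (AE \<omega> in M. real_cond_exp M (F s) (X t) \<omega> = X s \<omega>))"

text \<open>
  The localizing times are real-valued; this is no restriction, since \<open>[0,\<infinity>]\<close>-valued times
  \<open>\<tau> n\<close> can be replaced by \<open>min (\<tau> n) n\<close>.
\<close>

definition local_martingale ::
  "'a measure \<Rightarrow> (real \<Rightarrow> 'a measure) \<Rightarrow> (real \<Rightarrow> 'a \<Rightarrow> real) \<Rightarrow> bool" where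
  "local_martingale M F X \<longleftrightarrow>
     adapted F X \<and>
     (\<exists>\<tau> :: nat \<Rightarrow> 'a \<Rightarrow> real.
        (\<forall>n. stopping_time F (\<tau> n) \<and> (\<forall>\<omega>\<in>space M. 0 \<le> \<tau> n \<omega>)) \<and>
        (AE \<omega> in M. incseq (\<lambda>n. \<tau> n \<omega>) \<and> filterlim (\<lambda>n. \<tau> n \<omega>) at_top sequentially) \<and>
        (\<forall>n. martingale M F (\<lambda>t \<omega>. X (min t (\<tau> n \<omega>)) \<omega> - X 0 \<omega>)))"

definition is_subdivision :: "real \<Rightarrow> nat \<Rightarrow> (nat \<Rightarrow> real) \<Rightarrow> bool" where
  "is_subdivision t k p \<longleftrightarrow> p 0 = 0 \<and> p k = t \<and> (\<forall>i<k. p i \<le> p (Suc i))"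

definition finite_variation_on :: "real \<Rightarrow> (real \<Rightarrow> real) \<Rightarrow> bool" where
  "finite_variation_on t f \<longleftrightarrow>
     (\<exists>B. \<forall>k p. is_subdivision t k p \<longrightarrow> (\<Sum>i<k. \<bar>f (p (Suc i)) - f (p i)\<bar>) \<le> B)"

definition continuous_semimartingale ::
  "'a measure \<Rightarrow> (real \<Rightarrow> 'a measure) \<Rightarrow> (real \<Rightarrow> 'a \<Rightarrow> real) \<Rightarrow> bool" where
  "continuous_semimartingale M F X \<longleftrightarrow>
     adapted F X \<and> continuous_process M X \<and>
     (\<exists>N A. local_martingale M F N \<and> continuous_process M N \<and>
            adapted F A \<and> continuous_process M A \<and>
            (AE \<omega> in M. \<forall>t\<ge>0. finite_variation_on t (\<lambda>s. A s \<omega>)) \<and>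
            (AE \<omega> in M. \<forall>t\<ge>0. X t \<omega> = N t \<omega> + A t \<omega>))"

text \<open>
  \<open>Q\<close> is a version of the bracket \<open>\<langle>X\<rangle>\<close>: for every \<open>t\<close> and every sequence of subdivisions of
  \<open>[0,t]\<close> with mesh tending to \<open>0\<close>, the sums of squared increments converge to \<open>Q t\<close> in
  probability. This determines \<open>Q\<close> up to indistinguishability.
\<close>

definition quadratic_variation ::
  "'a measure \<Rightarrow> (real \<Rightarrow> 'a \<Rightarrow> real) \<Rightarrow> (real \<Rightarrow> 'a \<Rightarrow> real) \<Rightarrow> bool" where
  "quadratic_variation M X Q \<longleftrightarrow>
     (\<forall>t\<ge>0. Q t \<in> borel_measurable M) \<and> continuous_process M Q \<and>
     (AE \<omega> in M. Q 0 \<omega> = 0 \<and> mono_on {0..} (\<lambda>t. Q t \<omega>)) \<and>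
     (\<forall>t\<ge>0. \<forall>(k :: nat \<Rightarrow> nat) (p :: nat \<Rightarrow> nat \<Rightarrow> real).
        (\<forall>n. is_subdivision t (k n) (p n)) \<and>
        (\<forall>\<delta>>0. \<forall>\<^sub>F n in sequentially. \<forall>i<k n. p n (Suc i) - p n i < \<delta>) \<longrightarrow>
        (\<forall>\<epsilon>>0. (\<lambda>n. measure M {\<omega> \<in> space M.
             \<bar>(\<Sum>i<k n. (X (p n (Suc i)) \<omega> - X (p n i) \<omega>)\<^sup>2) - Q t \<omega>\<bar> > \<epsilon>}) \<longlonglongrightarrow> 0))"

text \<open>
  The measure \<open>dg\<close> on \<open>[0,\<infinity>)\<close> of a continuous nondecreasing \<open>g\<close>, which is extended to the
  negative half-line by the constant \<open>g 0\<close>.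
\<close>

definition stieltjes_measure :: "(real \<Rightarrow> real) \<Rightarrow> real measure" where
  "stieltjes_measure g = interval_measure (\<lambda>s. g (max 0 s))"

text \<open>
  \<open>L\<close> is a version of the symmetric local time of \<open>X\<close> at \<open>0\<close>. For a continuous semimartingale,
  the limit exists for all \<open>t\<close> simultaneously, almost surely, and is continuous in \<open>t\<close>, so
  such an \<open>L\<close> exists; it is unique up to indistinguishability.
\<close>

definition symmetric_local_time ::
  "'a measure \<Rightarrow> (real \<Rightarrow> 'a \<Rightarrow> real) \<Rightarrow> (real \<Rightarrow> 'a \<Rightarrow> real) \<Rightarrow> bool" where
  "symmetric_local_time M X L \<longleftrightarrow>
     (\<forall>t\<ge>0. L t \<in> borel_measurable M) \<and> continuous_process M L \<and>
     (\<exists>Q. quadratic_variation M X Q \<and>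
        (AE \<omega> in M. \<forall>t\<ge>0.
           ((\<lambda>\<epsilon>. 1 / (2 * \<epsilon>) *
               (LINT s:{0..t}|stieltjes_measure (\<lambda>r. Q r \<omega>). indicator {-\<epsilon><..<\<epsilon>} (X s \<omega>)))
            \<longlongrightarrow> L t \<omega>) (at_right 0)))"

text \<open>\<open>(M, F, W, X)\<close> is a weak solution of \<open>X\<^sub>t = x + W\<^sub>t + \<integral>\<^sub>0\<^sup>t \<beta>(s) dL\<^sub>s\<^sup>0(X)\<close>.\<close>

definition weak_solution ::
  "(real \<Rightarrow> real) \<Rightarrow> real \<Rightarrow> 'a measure \<Rightarrow> (real \<Rightarrow> 'a measure) \<Rightarrow>
   (real \<Rightarrow> 'a \<Rightarrow> real) \<Rightarrow> (real \<Rightarrow> 'a \<Rightarrow> real) \<Rightarrow> bool" where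
  "weak_solution \<beta> x M F W X \<longleftrightarrow>
     filtered_prob_space M F \<and> brownian_motion M F W \<and> continuous_semimartingale M F X \<and>
     (\<exists>L. symmetric_local_time M X L \<and>
        (AE \<omega> in M. \<forall>t\<ge>0.
           X t \<omega> = x + W t \<omega> + (LINT s:{0..t}|stieltjes_measure (\<lambda>r. L r \<omega>). \<beta> s)))"

text \<open>\<open>p\<^sup>\<beta>(0,t;0,y)\<close>\<close>

definition skew_density :: "(real \<Rightarrow> real) \<Rightarrow> real \<Rightarrow> real \<Rightarrow> real" where
  "skew_density \<beta> t y =
     \<bar>y\<bar> / pi *
     (LINT s:{0<..<t}|lborel.
        (1 + sgn y * \<beta> s) / 2 * (1 / (sqrt s * (t - s) powr (3/2))) *
        exp (- (y\<^sup>2 / (2 * (t - s)))))"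

end

(* Write X = W + V, where V is the integral of beta against the local time L; dV is carried by the
   zero set of X. Cutting [r, t] into small steps, the independence of the increments of W shows
   that exp (l^2 t / 2) cos (l X_t) has constant mean, also conditionally on F_r: the correction on a
   step is at most |dV| (|X| + |dV|), and X is small on a step on which L increases. Hence |X_t| has
   the law of |N(0, t)|, the conditional probability that |X_s| < e is at most 2 e / sqrt (s - r),
   the occupation averages defining L_t are bounded in L^2, and E L_t = sqrt (2 t / pi). The sine
   analogue of the discretisation then gives
     E exp (i l X_t) = exp (-l^2 t / 2)
       + i l (integral over s in (0, t) of exp (-l^2 (t - s) / 2) beta s / sqrt (2 pi s)),
   which is the Fourier transform of the claimed density. *)

theory Submission
  imports Defs
begin

text \<open>Cosines are even: their slope at 0 vanishes, so a drift that acts only while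
  \<open>X\<close> is at 0 leaves them unchanged to first order, whatever \<beta> is. Hence all
  facts about the modulus of \<open>X\<close>, and the mean of \<open>L\<close> with them, are blind
  to \<beta>, which enters only through the sines, whose slope at 0 is \<open>l\<close>. The
  obstacle is integrability. Nothing in the hypotheses bounds the mean of \<open>L t\<close>, so the
  cosine identity has to be obtained with the drift cut off at a level \<open>k\<close> that is
  later sent to infinity. Only the resulting moment bounds make \<open>L t\<close> integrable, and
  only then can \<open>L t\<close> dominate the sums that arise for the sines. Since \<beta> is
  deterministic but merely Borel, the mean of its integral against \<open>dL\<close> is found by
  identifying the mean of the random measure \<open>dL\<close> on half-lines and extending to all
  Borel functions. The bracket in the definition of the local time is a limit in probability, so it
  too must first be recognised as time.\<close>

section \<open>Gaussian integrals and characteristic functions\<close>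

lemma gaussian_half_line:
  fixes c :: real assumes "c > 0"
  shows "set_integrable lborel {0<..} (\<lambda>u. exp (- (c * u)\<^sup>2))"
    and "(LINT u:{0<..}|lborel. exp (- (c * u)\<^sup>2)) = sqrt pi / (2 * c)"
proof -
  have 1: "has_bochner_integral lborel (\<lambda>x. indicator {0..} x *\<^sub>R exp (- (x::real)\<^sup>2)) (sqrt pi / 2)"
    by (rule gaussian_moment_0)
  have 2: "has_bochner_integral lborel (\<lambda>x. indicator {0..} (0 + c * x) *\<^sub>R exp (- (0 + c * x)\<^sup>2))
      ((sqrt pi / 2) /\<^sub>R \<bar>c\<bar>)"
    by (rule lborel_has_bochner_integral_real_affine_iff[THEN iffD1, OF _ 1]) (use assms in simp)
  have 3: "AE x in lborel. indicator {0..} (0 + c * x) *\<^sub>R exp (- (0 + c * x)\<^sup>2) =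
     indicator {0<..} x *\<^sub>R exp (- (c * x)\<^sup>2)"
    using AE_lborel_singleton[of 0]
    by eventually_elim (use assms in \<open>simp add: indicator_def zero_le_mult_iff\<close>)
  have "has_bochner_integral lborel (\<lambda>x. indicator {0<..} x *\<^sub>R exp (- (c * x)\<^sup>2)) ((sqrt pi / 2) /\<^sub>R \<bar>c\<bar>)"
    by (rule iffD1[OF has_bochner_integral_cong_AE[OF _ _ 3] 2]) measurable
  then show "set_integrable lborel {0<..} (\<lambda>u. exp (- (c * u)\<^sup>2))"
    and "(LINT u:{0<..}|lborel. exp (- (c * u)\<^sup>2)) = sqrt pi / (2 * c)"
    using assms unfolding set_integrable_def set_lebesgue_integral_def
    by (auto simp: has_bochner_integral_iff field_simps)
qed

text \<open>With \<open>s = t * u\<^sup>2 / (1 + u\<^sup>2)\<close> the remaining time is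
  \<open>t - s = t / (1 + u\<^sup>2)\<close>, so \<open>y\<^sup>2 / (2 * (t - s))\<close> splits
  into \<open>y\<^sup>2 / (2 * t)\<close> plus a square in \<open>u\<close>. The factor
  \<open>2 * t * u / (1 + u\<^sup>2)\<^sup>2\<close> is the derivative of \<open>s\<close>; it
  cancels the algebraic singularities down to the constant \<open>2 / t\<close>.\<close>

lemma gaussian_time_substitution:
  fixes t u y :: real assumes t: "t > 0" and u: "u > 0"
  shows "1 / (sqrt (t * u\<^sup>2 / (1 + u\<^sup>2)) * (t - t * u\<^sup>2 / (1 + u\<^sup>2)) powr (3/2)) *
      exp (- (y\<^sup>2 / (2 * (t - t * u\<^sup>2 / (1 + u\<^sup>2))))) * (2 * t * u / (1 + u\<^sup>2)\<^sup>2) =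
    2 / t * exp (- (y\<^sup>2 / (2 * t))) * exp (- (\<bar>y\<bar> / sqrt (2 * t) * u)\<^sup>2)"
proof -
  define d where "d = 1 + u\<^sup>2"
  have d: "d > 0" unfolding d_def by (simp add: add_pos_nonneg)
  define e where "e = t / d"
  have e: "e > 0" unfolding e_def using t d by simp
  have td: "t * u\<^sup>2 / d = e * u\<^sup>2" unfolding e_def by simp
  have "t = e * (1 + u\<^sup>2)" unfolding e_def d_def[symmetric] using d by simp
  then have te: "t - e * u\<^sup>2 = e" by (simp add: distrib_left)
  have p: "e powr (3/2) = e * sqrt e"
    using powr_add[of e 1 "1/2"] e by (simp add: powr_half_sqrt)
  have s: "sqrt (e * u\<^sup>2) = u * sqrt e" using u by (simp add: real_sqrt_mult)
  have ss: "u * sqrt e * (e * sqrt e) = u * e\<^sup>2"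
  proof -
    have "u * sqrt e * (e * sqrt e) = u * e * (sqrt e * sqrt e)" by (simp only: mult_ac)
    also have "\<dots> = u * e\<^sup>2" using e by (simp add: power2_eq_square)
    finally show ?thesis .
  qed
  have j: "1 / (u * e\<^sup>2) * (2 * t * u / d\<^sup>2) = 2 / t"
    unfolding e_def using u t d by (simp add: power2_eq_square)
  have "y\<^sup>2 / (2 * e) = y\<^sup>2 / (2 * t) * d" unfolding e_def by simp
  also have "\<dots> = y\<^sup>2 / (2 * t) + (\<bar>y\<bar> / sqrt (2 * t) * u)\<^sup>2"
    unfolding d_def using t by (simp add: distrib_left power_mult_distrib power_divide)
  finally have x: "exp (- (y\<^sup>2 / (2 * e))) = exp (- (y\<^sup>2 / (2 * t))) * exp (- (\<bar>y\<bar> / sqrt (2 * t) * u)\<^sup>2)"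
    by (simp add: exp_add[symmetric])
  have "a * (b * c) * g = a * g * b * c" for a b c g :: real by simp
  then show ?thesis
    unfolding d_def[symmetric] td te p s ss x j[symmetric] by this
qed
text \<open>The substitution \<open>s = t u\<^sup>2 / (1 + u\<^sup>2)\<close> turns the integrand into a Gaussian in \<open>u\<close>.\<close>

lemma normal_density_as_time_integral:
  fixes t y :: real assumes t: "t > 0" and y: "y \<noteq> 0"
  defines "f \<equiv> \<lambda>s. 1 / (sqrt s * (t - s) powr (3/2)) * exp (- (y\<^sup>2 / (2 * (t - s))))"
  shows "set_integrable lborel {0<..<t} f"
    and "\<bar>y\<bar> / (2 * pi) * (LINT s:{0<..<t}|lborel. f s) = normal_density 0 (sqrt t) y"
proof -
  let ?g = "\<lambda>u::real. t * u\<^sup>2 / (1 + u\<^sup>2)" and ?g' = "\<lambda>u::real. 2 * t * u / (1 + u\<^sup>2)\<^sup>2"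
  have pos: "1 + u\<^sup>2 > 0" for u :: real by (simp add: add_pos_nonneg)
  have nz: "1 + u\<^sup>2 \<noteq> 0" for u :: real using pos[of u] by simp
  have "t - t * a / (1 + a) = t / (1 + a)" if "1 + a \<noteq> 0" for a
    using that by (simp add: field_simps)
  then have tg: "t - ?g u = t / (1 + u\<^sup>2)" for u using nz by this
  have fg: "f (?g u) * ?g' u = 2 / t * exp (- (y\<^sup>2 / (2 * t))) * exp (- (\<bar>y\<bar> / sqrt (2 * t) * u)\<^sup>2)" if u: "u > 0" for u
    using gaussian_time_substitution[OF t u, of y] unfolding f_def by this
  have c: "\<bar>y\<bar> / sqrt (2 * t) > 0" using t y by simp
  have einf: "einterval 0 \<infinity> = {0::real<..}" unfolding einterval_def by auto
  have et: "einterval 0 (ereal t) = {0<..<t}" unfolding einterval_def by auto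
  have int: "set_integrable lborel (einterval 0 \<infinity>) (\<lambda>u. f (?g u) * ?g' u)"
  proof -
    have "set_integrable lborel {0<..} (\<lambda>u. 2 / t * exp (- (y\<^sup>2 / (2 * t))) * exp (- (\<bar>y\<bar> / sqrt (2 * t) * u)\<^sup>2))"
      using gaussian_half_line(1)[OF c] by (rule set_integrable_mult_right)
    then show ?thesis unfolding einf
      by (rule set_integrable_cong[OF refl refl fg, THEN iffD2, rotated]) (simp only: greaterThan_iff)
  qed
  have gpos: "0 < ?g u \<and> ?g u < t" if "u > 0" for u
  proof 
    show "0 < ?g u" using that t pos[of u] by simp
    show "?g u < t" using divide_pos_pos[OF t pos[of u]] unfolding tg[symmetric] by simp
  qed
  have contf: "isCont f (?g u)" if "u > 0" for u
    unfolding f_def using gpos[OF that] by (intro continuous_intros) auto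
  have D: "DERIV ?g u :> ?g' u" for u
  proof -
    have "DERIV ?g u :> (t * (2 * u) * (1 + u\<^sup>2) - t * u\<^sup>2 * (2 * u)) / ((1 + u\<^sup>2) * (1 + u\<^sup>2))"
      by (rule DERIV_divide) (auto intro!: derivative_eq_intros nz)
    moreover have "t * (2 * u) * (1 + u\<^sup>2) - t * u\<^sup>2 * (2 * u) = 2 * t * u" by (simp add: algebra_simps)
    ultimately show ?thesis by (simp add: power2_eq_square)
  qed
  have contg': "isCont ?g' u" for u
    using nz[of u] by (intro continuous_intros) auto
  have A: "((ereal \<circ> ?g \<circ> real_of_ereal) \<longlongrightarrow> ereal 0) (at_right 0)"
  proof -
    have "(?g \<longlongrightarrow> ?g 0) (at_right 0)" by (intro tendsto_intros) auto
    then show ?thesis unfolding zero_ereal_def ereal_tendsto_simps by (simp add: o_def)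
  qed
  have B: "((ereal \<circ> ?g \<circ> real_of_ereal) \<longlongrightarrow> ereal t) (at_left \<infinity>)"
  proof -
    have "(\<lambda>u::real. u\<^sup>2) = (\<lambda>u. u ^ 2)" ..
    have "filterlim (\<lambda>u::real. 1 + u\<^sup>2) at_top at_top"
      by (intro filterlim_tendsto_add_at_top[OF tendsto_const] filterlim_pow_at_top filterlim_ident) auto
    then have "((\<lambda>u::real. t - t / (1 + u\<^sup>2)) \<longlongrightarrow> t - 0) at_top"
      by (intro tendsto_diff tendsto_const real_tendsto_divide_at_top[OF tendsto_const])
    moreover have "(\<lambda>u. t - t / (1 + u\<^sup>2)) = ?g" using tg by (auto simp: algebra_simps fun_eq_iff)
    ultimately have "(?g \<longlongrightarrow> t) at_top" by simp
    then show ?thesis unfolding ereal_tendsto_simps by (simp add: o_def)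
  qed
  have fnn: "0 \<le> f (?g u)" if "u > 0" for u
    unfolding f_def using gpos[OF that] by (auto intro!: mult_nonneg_nonneg)
  have g'nn: "0 \<le> ?g' u" if "u \<ge> 0" for u using t that by simp
  have pe: "0 < ereal x \<Longrightarrow> x > 0" "0 \<le> ereal x \<Longrightarrow> x \<ge> 0" for x by simp_all
  \<comment> \<open>The rule for nonnegative integrands gives integrability of \<open>f\<close> from
    that of the transformed Gaussian; \<open>A\<close> and \<open>B\<close> are the limits of the
    substitution at \<open>u = 0\<close> and at infinity.\<close>
  note sub = interval_integral_substitution_nonneg[where a=0 and b=\<infinity> and g="?g" and g'="?g'" and f=f, OF _ D contf[OF pe(1)] contg' fnn[OF pe(1)] g'nn[OF pe(2)] A B int]
  have S1: "set_integrable lborel (einterval (ereal 0) (ereal t)) f"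
    by (rule sub(1)) simp_all
  have S2: "(LBINT x=ereal 0..ereal t. f x) = (LBINT x=0..\<infinity>. (f (?g x) * ?g' x))"
    by (rule sub(2)) simp_all
  show "set_integrable lborel {0<..<t} f" using S1 by simp
  have "(LINT s:{0<..<t}|lborel. f s) = (LBINT x=ereal 0..ereal t. f x)"
    using t by (simp add: interval_integral_Ioo)
  also have "\<dots> = (LBINT x=0..\<infinity>. (f (?g x) * ?g' x))" by (rule S2)
  also have "\<dots> = (LINT x:{0<..}|lborel. f (?g x) * ?g' x)"
    unfolding interval_lebesgue_integral_def by (simp add: einf)
  also have "\<dots> = (LINT x:{0<..}|lborel. 2 / t * exp (- (y\<^sup>2 / (2 * t))) * exp (- (\<bar>y\<bar> / sqrt (2 * t) * x)\<^sup>2))"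
    by (rule set_lebesgue_integral_cong[OF _ allI[OF impI[OF fg]]]) auto
  also have "\<dots> = 2 / t * exp (- (y\<^sup>2 / (2 * t))) * (sqrt pi / (2 * (\<bar>y\<bar> / sqrt (2 * t))))"
    using gaussian_half_line(2)[OF c] by simp
  finally have I: "(LINT s:{0<..<t}|lborel. f s) = 2 / t * exp (- (y\<^sup>2 / (2 * t))) * (sqrt pi / (2 * (\<bar>y\<bar> / sqrt (2 * t))))" .
  have "a / (2 * pi) * (2 / t * e * (r / (2 * (a / q)))) = e * (r / pi * (q / (2 * t)))" if "a > 0" for a e r q :: real
    using that by simp
  from this[of "\<bar>y\<bar>"] y have "\<bar>y\<bar> / (2 * pi) * (LINT s:{0<..<t}|lborel. f s) = exp (- (y\<^sup>2 / (2 * t))) * (sqrt pi / pi * (sqrt (2 * t) / (2 * t)))"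
    unfolding I by (simp only: zero_less_abs_iff simp_thms)
  also have "sqrt pi / pi * (sqrt (2 * t) / (2 * t)) = 1 / sqrt (2 * pi * t)"
  proof -
    have "sqrt x / x = 1 / sqrt x" if "x > 0" for x
      using that real_div_sqrt[of x] by (simp add: divide_simps)
    from this[of pi] this[of "2 * t"] t show ?thesis by (simp only: real_sqrt_mult mult_pos_pos zero_less_numeral pi_gt_zero) simp
  qed
  finally show "\<bar>y\<bar> / (2 * pi) * (LINT s:{0<..<t}|lborel. f s) = normal_density 0 (sqrt t) y"
    using t unfolding normal_density_def by (simp only: real_sqrt_pow2 less_imp_le diff_0_right minus_divide_left mult.commute)
qed

lemma integral_normal_cos:
  fixes \<sigma> l :: real assumes "\<sigma> > 0"
  shows "integrable lborel (\<lambda>x. normal_density 0 \<sigma> x * cos (l * x))"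
    "integrable lborel (\<lambda>x. normal_density 0 \<sigma> x * sin (l * x))"
    "(LINT x|lborel. normal_density 0 \<sigma> x * cos (l * x)) = exp (- (l\<^sup>2 * \<sigma>\<^sup>2 / 2))"
    "(LINT x|lborel. normal_density 0 \<sigma> x * sin (l * x)) = 0"
proof -
  have n: "integrable lborel (normal_density 0 \<sigma>)" using assms by (rule integrable_normal_density)
  show ic: "integrable lborel (\<lambda>x. normal_density 0 \<sigma> x * cos (l * x))"
    by (rule Bochner_Integration.integrable_bound[OF n]) (auto simp: abs_mult normal_density_nonneg intro!: mult_left_le)
  show isn: "integrable lborel (\<lambda>x. normal_density 0 \<sigma> x * sin (l * x))"
    by (rule Bochner_Integration.integrable_bound[OF n]) (auto simp: abs_mult normal_density_nonneg intro!: mult_left_le)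
  interpret S: prob_space std_normal_distribution
    using real_dist_normal_dist by (simp add: real_distribution_def)
  have ii: "integrable std_normal_distribution (\<lambda>x. iexp (l * \<sigma> * x))"
    by (rule S.integrable_const_bound[of _ 1]) auto
  have "Re (char std_normal_distribution (l * \<sigma>)) = exp (- ((l * \<sigma>)\<^sup>2) / 2)"
    unfolding char_std_normal_distribution by simp
  then have 1: "(LINT x|std_normal_distribution. cos (l * \<sigma> * x)) = exp (- (l\<^sup>2 * \<sigma>\<^sup>2 / 2))"
    unfolding char_def using integral_Re[OF ii] by (simp add: Re_exp power_mult_distrib)
  have 2: "(LINT x|lborel. normal_density 0 \<sigma> x * h x) = (LINT x|std_normal_distribution. h (\<sigma> * x))"
    if [measurable]: "h \<in> borel_measurable borel" for h :: "real \<Rightarrow> real"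
  proof -
    have "(LINT x|lborel. normal_density 0 \<sigma> x * h x) = \<sigma> * (LINT x|lborel. normal_density 0 \<sigma> (0 + \<sigma> * x) * h (0 + \<sigma> * x))"
      using lborel_integral_real_affine[of \<sigma> "\<lambda>x. normal_density 0 \<sigma> x * h x" 0] assms by simp
    also have "\<dots> = (LINT x|lborel. std_normal_density x * h (\<sigma> * x))"
      unfolding integral_mult_right_zero[symmetric] using assms
      by (intro Bochner_Integration.integral_cong) (auto simp: normal_density_def field_simps real_sqrt_mult)
    also have "\<dots> = (LINT x|std_normal_distribution. h (\<sigma> * x))"
      by (subst integral_density) (auto simp: normal_density_nonneg)
    finally show ?thesis .
  qed
  show "(LINT x|lborel. normal_density 0 \<sigma> x * cos (l * x)) = exp (- (l\<^sup>2 * \<sigma>\<^sup>2 / 2))"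
    using 1 2[of "\<lambda>x. cos (l * x)"] by (simp add: mult_ac)
  have "Im (char std_normal_distribution (l * \<sigma>)) = 0"
    unfolding char_std_normal_distribution by simp
  then show "(LINT x|lborel. normal_density 0 \<sigma> x * sin (l * x)) = 0"
    using integral_Im[OF ii] 2[of "\<lambda>x. sin (l * x)"] unfolding char_def by (simp add: Im_exp mult_ac)
qed

text \<open>Integration by parts: \<open>y\<close> times the Gaussian is \<open>- v\<close> times
  its derivative, so the primitive \<open>- v * n y * sin (l * y)\<close>, which vanishes at both
  infinities, reduces the integral to the cosine transform.\<close>

lemma integral_gaussian_mult_sin:
  fixes v l :: real assumes v: "v > 0"
  shows "(LINT y|lborel. y * exp (- (y\<^sup>2 / (2 * v))) * sin (l * y)) =
    l * v * sqrt (2 * pi * v) * exp (- (l\<^sup>2 * v / 2))"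
proof -
  define n where "n = (\<lambda>y. normal_density 0 (sqrt v) y)"
  have ne: "exp (- (y\<^sup>2 / (2 * v))) = sqrt (2 * pi * v) * n y" for y
    using v by (simp add: n_def normal_density_def)
  have v': "sqrt v > 0" using v by simp
  have i1: "integrable lborel (\<lambda>y. n y * y)"
    using integrable_normal_moment[OF v', of 0 1] by (simp add: n_def)
  have i2: "integrable lborel (\<lambda>y. n y * y * sin (l * y))"
    by (rule Bochner_Integration.integrable_bound[OF i1]) (auto simp: abs_mult n_def intro!: mult_left_le)
  note i3 = integral_normal_cos(1,3)[OF v', of l, folded n_def]
  have i4: "integrable lborel (\<lambda>y. n y * y * sin (l * y) - v * l * (n y * cos (l * y)))"
    using i2 i3 by auto
  have n': "(n has_real_derivative (- y / v * n y)) (at y)" for y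
    unfolding n_def normal_density_def using v by (auto intro!: derivative_eq_intros simp: field_simps)
  have lim: "((\<lambda>y. - v * n y * sin (l * y)) \<longlongrightarrow> 0) F" if "F = at_top \<or> F = at_bot" for F
  proof (rule Lim_null_comparison)
    have "((\<lambda>y::real. exp (- (y\<^sup>2 / (2 * v)))) \<longlongrightarrow> 0) F"
    proof -
      have "filterlim (\<lambda>y::real. y\<^sup>2) at_top F"
        using that filterlim_pow_at_bot_even[OF _ filterlim_ident, of 2] filterlim_pow_at_top[OF _ filterlim_ident, of 2] by auto
      then have "filterlim (\<lambda>y::real. y\<^sup>2 * (1 / (2 * v))) at_top F"
        using filterlim_at_top_mult_tendsto_pos[OF tendsto_const, of "1 / (2 * v)" "\<lambda>y. y\<^sup>2" F] v by simp
      then have "filterlim (\<lambda>y::real. - (y\<^sup>2 / (2 * v))) at_bot F"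
        by (simp add: filterlim_uminus_at_bot)
      then show ?thesis by (rule filterlim_compose[OF exp_at_bot])
    qed
    then have "((\<lambda>y. v * (1 / sqrt (2 * pi * v) * exp (- (y\<^sup>2 / (2 * v))))) \<longlongrightarrow> v * (1 / sqrt (2 * pi * v) * 0)) F"
      by (intro tendsto_intros)
    then show "((\<lambda>y. v * (1 / sqrt (2 * pi * v) * exp (- (y\<^sup>2 / (2 * v))))) \<longlongrightarrow> 0) F" by simp
    have "norm (- v * n y * sin (l * y)) \<le> v * (1 / sqrt (2 * pi * v) * exp (- (y\<^sup>2 / (2 * v))))" for y
      using v by (auto simp: abs_mult n_def normal_density_def intro!: mult_left_le divide_right_mono)
    then show "\<forall>\<^sub>F y in F. norm (- v * n y * sin (l * y)) \<le> v * (1 / sqrt (2 * pi * v) * exp (- (y\<^sup>2 / (2 * v))))"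
      by simp
  qed
  have "(LBINT y=-\<infinity>..\<infinity>. n y * y * sin (l * y) - v * l * (n y * cos (l * y))) = 0 - 0"
  proof (rule interval_integral_FTC_integrable[where F="\<lambda>y. - v * n y * sin (l * y)"])
    show "((\<lambda>y. - v * n y * sin (l * y)) has_vector_derivative
           n x * x * sin (l * x) - v * l * (n x * cos (l * x))) (at x)" for x
      unfolding has_real_derivative_iff_has_vector_derivative[symmetric]
      using v by (auto intro!: derivative_eq_intros n' simp: field_simps)
    show "isCont (\<lambda>y. n y * y * sin (l * y) - v * l * (n y * cos (l * y))) x" for x
      using DERIV_isCont[OF n'] by (intro continuous_intros) auto
    show "set_integrable lborel (einterval (- \<infinity>) \<infinity>) (\<lambda>y. n y * y * sin (l * y) - v * l * (n y * cos (l * y)))"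
      using i4 by (simp add: set_integrable_def)
    show "(((\<lambda>y. - v * n y * sin (l * y)) \<circ> real_of_ereal) \<longlongrightarrow> 0) (at_left \<infinity>)"
      unfolding ereal_tendsto_simps by (rule lim) simp
    show "(((\<lambda>y. - v * n y * sin (l * y)) \<circ> real_of_ereal) \<longlongrightarrow> 0) (at_right (-\<infinity>))"
      unfolding ereal_tendsto_simps by (rule lim) simp
  qed simp
  then have "(LINT y|lborel. n y * y * sin (l * y) - v * l * (n y * cos (l * y))) = 0"
    by (simp add: interval_lebesgue_integral_def set_lebesgue_integral_def)
  then have 3: "(LINT y|lborel. n y * y * sin (l * y)) = v * l * exp (- (l\<^sup>2 * v / 2))"
    using i2 i3 v by simp
  have "(LINT y|lborel. y * exp (- (y\<^sup>2 / (2 * v))) * sin (l * y)) = (LINT y|lborel. sqrt (2 * pi * v) * (n y * y * sin (l * y)))"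
    unfolding ne by (simp add: mult_ac)
  also have "\<dots> = sqrt (2 * pi * v) * (v * l * exp (- (l\<^sup>2 * v / 2)))" using 3 by simp
  finally show ?thesis by (simp add: mult_ac)
qed

text \<open>Levy uniqueness with the characteristic function split into real and imaginary part, so
  that only real expectations have to be computed.\<close>

lemma real_distribution_eqI_cos_sin:
  assumes M: "real_distribution M" and N: "real_distribution N"
    and c: "\<And>l. (LINT x|M. cos (l * x)) = (LINT x|N. cos (l * x))"
    and s: "\<And>l. (LINT x|M. sin (l * x)) = (LINT x|N. sin (l * x))"
  shows "M = N"
proof (rule Levy_uniqueness[OF M N])
  have "char P l = Complex (LINT x|P. cos (l * x)) (LINT x|P. sin (l * x))" if "real_distribution P" for P l
  proof -
    interpret P: real_distribution P by fact
    have "integrable P (\<lambda>x. iexp (l * x))"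
      by (rule P.integrable_const_bound[of _ 1]) auto
    from integral_Re[OF this] integral_Im[OF this] show ?thesis
      by (simp add: char_def complex_eq_iff Re_exp Im_exp)
  qed
  then show "char M = char N" using M N c s by (auto simp: fun_eq_iff)
qed

section \<open>The candidate density and its Fourier transform\<close>

context
  fixes t :: real and b :: "real \<Rightarrow> real"
  assumes t: "t > 0" and bm[measurable]: "b \<in> borel_measurable borel" and b1: "\<And>s. \<bar>b s\<bar> \<le> 1"
begin

text \<open>\<open>\<bar>y\<bar> * kernel y s\<close> is the heat kernel at 0 at time
  \<open>s\<close> times the first passage density to level \<open>\<bar>y\<bar>\<close> at time
  \<open>t - s\<close>; integrating over \<open>s\<close> gives back the normal density by a first
  passage decomposition. The constant \<open>1 / (2 * pi)\<close> is the product of two factors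
  \<open>1 / sqrt (2 * pi)\<close>.\<close>

definition kernel :: "real \<Rightarrow> real \<Rightarrow> real" where
  "kernel y s = 1 / (2 * pi) * (indicator {0<..<t} s *
     (1 / (sqrt s * (t - s) powr (3/2)) * exp (- (y\<^sup>2 / (2 * (t - s))))))"

lemma measurable_kernel[measurable]: "case_prod kernel \<in> borel_measurable (borel \<Otimes>\<^sub>M borel)"
  unfolding kernel_def by measurable

lemma kernel_nonneg: "kernel y s \<ge> 0"
  unfolding kernel_def by (auto simp: indicator_def)

lemma kernel_integral:
  assumes "y \<noteq> 0"
  shows "integrable lborel (kernel y)" "(LINT s|lborel. \<bar>y\<bar> * kernel y s) = normal_density 0 (sqrt t) y"
proof -
  note n = normal_density_as_time_integral[OF t assms]
  show "integrable lborel (kernel y)"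
    unfolding kernel_def
    using integrable_mult_right[OF n(1)[unfolded set_integrable_def real_scaleR_def], of "1 / (2 * pi)"] .
  have "(LINT s|lborel. \<bar>y\<bar> * kernel y s) = \<bar>y\<bar> * (1 / (2 * pi) * (LINT s:{0<..<t}|lborel. 1 / (sqrt s * (t - s) powr (3/2)) * exp (- (y\<^sup>2 / (2 * (t - s))))))"
    unfolding kernel_def set_lebesgue_integral_def real_scaleR_def
    by (simp only: integral_mult_right_zero)
  then show "(LINT s|lborel. \<bar>y\<bar> * kernel y s) = normal_density 0 (sqrt t) y" using n(2) by simp
qed

text \<open>Integrating the nonnegative kernel in \<open>s\<close> first leaves a normal density in
  \<open>y\<close>, which makes the later exchange of integrals legitimate. At \<open>y = 0\<close>
  the kernel alone has a singularity of order \<open>3/2\<close> at \<open>s = t\<close>, so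
  \<open>kernel_integral\<close> does not apply and this null point is left out.\<close>

lemma kernel_joint_integrable:
  "integrable (lborel \<Otimes>\<^sub>M lborel) (\<lambda>(y, s). \<bar>y\<bar> * kernel y s)"
proof (rule lborel_pair.Fubini_integrable)
  have 1: "integrable lborel (normal_density 0 (sqrt t))" using t by simp
  have 2: "AE y in lborel. normal_density 0 (sqrt t) y = (LINT s|lborel. norm (case (y, s) of (y, s) \<Rightarrow> \<bar>y\<bar> * kernel y s))"
    using AE_lborel_singleton[of 0] by eventually_elim (simp add: kernel_nonneg abs_mult kernel_integral(2)[symmetric])
  show "integrable lborel (\<lambda>y. LINT s|lborel. norm (case (y, s) of (y, s) \<Rightarrow> \<bar>y\<bar> * kernel y s))"
    by (rule integrable_cong_AE_imp[OF 1 _ 2]) measurable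
  show "AE y in lborel. integrable lborel (\<lambda>s. case (y, s) of (y, s) \<Rightarrow> \<bar>y\<bar> * kernel y s)"
    using AE_lborel_singleton[of 0] by eventually_elim (auto simp: kernel_integral)
qed measurable

lemma skew_density_eq_kernel:
  "skew_density b t y = (LINT s|lborel. (1 + sgn y * b s) * (\<bar>y\<bar> * kernel y s))"
proof -
  have "a / pi * (i *\<^sub>R (c / 2 * g * e)) = c * (a * (1 / (2 * pi) * (i * (g * e))))" for a i c g e :: real
    by (simp add: field_simps)
  then show ?thesis
    unfolding skew_density_def set_lebesgue_integral_def integral_mult_right_zero[symmetric] kernel_def
    by (intro Bochner_Integration.integral_cong refl)
qed

lemma measurable_skew_density[measurable]: "skew_density b t \<in> borel_measurable borel"
  unfolding skew_density_eq_kernel[abs_def] by measurable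

lemma skew_density_nonneg: "skew_density b t y \<ge> 0"
proof -
  have "1 + sgn y * b s \<ge> 0" for s using b1[of s] by (auto simp: sgn_real_def)
  then show ?thesis
    unfolding skew_density_eq_kernel by (intro Bochner_Integration.integral_nonneg) (simp add: kernel_nonneg)
qed

text \<open>Because \<open>sgn y * \<bar>y\<bar> = y\<close>, the density is a part free of
  \<open>b\<close>, which integrates in \<open>s\<close> to the normal density, plus a part linear
  in \<open>b\<close> and built from the odd function \<open>y * kernel y s\<close>. Fubini moves
  the \<open>y\<close> integral of the second part inside and leaves \<open>b\<close> as a weight in
  \<open>s\<close>.\<close>

lemma integral_skew_density:
  fixes h :: "real \<Rightarrow> real"
  assumes [measurable]: "h \<in> borel_measurable borel" and h: "\<And>y. \<bar>h y\<bar> \<le> 1"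
  shows "integrable lborel (\<lambda>y. h y * skew_density b t y)"
    and "(LINT y|lborel. h y * skew_density b t y) = (LINT y|lborel. normal_density 0 (sqrt t) y * h y)
       + (LINT s|lborel. b s * (LINT y|lborel. h y * (y * kernel y s)))"
proof -
  have i1: "integrable (lborel \<Otimes>\<^sub>M lborel) (\<lambda>(y, s). h y * (\<bar>y\<bar> * kernel y s))"
    by (rule Bochner_Integration.integrable_bound[OF kernel_joint_integrable])
      (use h in \<open>auto simp: split_beta' abs_mult kernel_nonneg intro!: mult_left_le_one_le\<close>)
  have i2: "integrable (lborel \<Otimes>\<^sub>M lborel) (\<lambda>(y, s). b s * (h y * (y * kernel y s)))"
    by (rule Bochner_Integration.integrable_bound[OF i1])
      (use b1 in \<open>auto simp: split_beta' abs_mult kernel_nonneg intro!: mult_left_le_one_le\<close>)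
  have e: "AE y in lborel. h y * skew_density b t y =
      (LINT s|lborel. h y * (\<bar>y\<bar> * kernel y s)) + (LINT s|lborel. b s * (h y * (y * kernel y s)))"
    using AE_lborel_singleton[of 0]
  proof eventually_elim
    case (elim y)
    then have y: "integrable lborel (kernel y)" by (rule kernel_integral)
    have yb: "integrable lborel (\<lambda>s. b s * (h y * (y * kernel y s)))"
      by (rule Bochner_Integration.integrable_bound[of _ "\<lambda>s. h y * (y * kernel y s)"])
        (use b1 y in \<open>auto simp: abs_mult kernel_nonneg intro!: mult_left_le_one_le\<close>)
    have "h y * skew_density b t y = (LINT s|lborel. h y * (\<bar>y\<bar> * kernel y s) + b s * (h y * (y * kernel y s)))"
      unfolding skew_density_eq_kernel integral_mult_right_zero[symmetric]
      by (intro Bochner_Integration.integral_cong) (auto simp: algebra_simps abs_mult_sgn sgn_real_def)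
    also have "\<dots> = (LINT s|lborel. h y * (\<bar>y\<bar> * kernel y s)) + (LINT s|lborel. b s * (h y * (y * kernel y s)))"
      by (rule Bochner_Integration.integral_add) (use y yb in auto)
    finally show ?case .
  qed
  note f1 = lborel_pair.integrable_fst'[OF i1] and f2 = lborel_pair.integrable_fst'[OF i2]
  have f: "integrable lborel (\<lambda>y. (LINT s|lborel. h y * (\<bar>y\<bar> * kernel y s)) + (LINT s|lborel. b s * (h y * (y * kernel y s))))"
    using f1 f2 by (simp del: integral_mult_right_zero integral_mult_left_zero)
  then show "integrable lborel (\<lambda>y. h y * skew_density b t y)"
    by (rule integrable_cong_AE_imp) (use e in \<open>auto elim!: eventually_mono\<close>)
  have "(LINT y|lborel. h y * skew_density b t y) = (LINT y|lborel. (LINT s|lborel. h y * (\<bar>y\<bar> * kernel y s)) + (LINT s|lborel. b s * (h y * (y * kernel y s))))"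
    by (rule integral_cong_AE) (use e in auto)
  also have "\<dots> = (LINT y|lborel. (LINT s|lborel. h y * (\<bar>y\<bar> * kernel y s))) + (LINT y|lborel. (LINT s|lborel. b s * (h y * (y * kernel y s))))"
    by (rule Bochner_Integration.integral_add) (use f1 f2 in simp_all)
  also have "(LINT y|lborel. (LINT s|lborel. h y * (\<bar>y\<bar> * kernel y s))) = (LINT y|lborel. normal_density 0 (sqrt t) y * h y)"
  proof (rule integral_cong_AE)
    show "AE y in lborel. (LINT s|lborel. h y * (\<bar>y\<bar> * kernel y s)) = normal_density 0 (sqrt t) y * h y"
      using AE_lborel_singleton[of 0]
    proof eventually_elim
      case (elim y)
      have "(LINT s|lborel. h y * (\<bar>y\<bar> * kernel y s)) = h y * (LINT s|lborel. \<bar>y\<bar> * kernel y s)"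
        by (rule integral_mult_right_zero)
      then show ?case using kernel_integral(2)[OF elim] by (simp only: mult.commute)
    qed
  qed measurable
  also have "(LINT y|lborel. (LINT s|lborel. b s * (h y * (y * kernel y s)))) = (LINT s|lborel. (LINT y|lborel. b s * (h y * (y * kernel y s))))"
    using lborel_pair.Fubini_integral[of "\<lambda>y s. b s * (h y * (y * kernel y s))"] i2 by (simp add: case_prod_beta')
  also have "\<dots> = (LINT s|lborel. b s * (LINT y|lborel. h y * (y * kernel y s)))"
    by (simp only: integral_mult_right_zero)
  finally show "(LINT y|lborel. h y * skew_density b t y) = (LINT y|lborel. normal_density 0 (sqrt t) y * h y)
       + (LINT s|lborel. b s * (LINT y|lborel. h y * (y * kernel y s)))" .
qed

text \<open>The kernel depends on \<open>y\<close> through its square, so reflection changes the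
  sign of the integrand. This is why the cosine transform of the density does not see
  \<open>b\<close>.\<close>

lemma integral_even_kernel:
  fixes h :: "real \<Rightarrow> real"
  assumes "\<And>y. h (- y) = h y"
  shows "(LINT y|lborel. h y * (y * kernel y s)) = 0"
proof -
  have "(LINT y|lborel. h y * (y * kernel y s)) = (LINT y|lborel. - (h y * (y * kernel y s)))"
    using lborel_integral_real_affine[of "-1" "\<lambda>y. h y * (y * kernel y s)" 0] assms by (simp add: kernel_def)
  then show ?thesis by simp
qed

text \<open>The sine moment of the Gaussian supplies \<open>v * sqrt v\<close> with
  \<open>v = t - s\<close>, exactly the power in the denominator of the kernel. The prefactor that
  survives is \<open>1 / sqrt (2 * pi * s)\<close>, the density of the mean local time.\<close>

lemma integral_sin_kernel:
  "(LINT y|lborel. sin (l * y) * (y * kernel y s)) =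
     indicator {0<..<t} s * (l / sqrt (2 * pi * s) * exp (- (l\<^sup>2 * (t - s) / 2)))"
proof (cases "s \<in> {0<..<t}")
  case True
  define v where "v = t - s"
  have v: "v > 0" and s: "s > 0" using True by (auto simp: v_def)
  have p: "v powr (3/2) = v * sqrt v"
    using powr_add[of v 1 "1/2"] v by (simp add: powr_half_sqrt)
  have "(LINT y|lborel. sin (l * y) * (y * kernel y s)) =
      (LINT y|lborel. 1 / (2 * pi) * (1 / (sqrt s * (v * sqrt v))) * (y * exp (- (y\<^sup>2 / (2 * v))) * sin (l * y)))"
    unfolding kernel_def v_def[symmetric] p using True by (simp add: mult_ac)
  also have "\<dots> = 1 / (2 * pi) * (1 / (sqrt s * (v * sqrt v))) * (l * v * sqrt (2 * pi * v) * exp (- (l\<^sup>2 * v / 2)))"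
    by (simp only: integral_mult_right_zero integral_gaussian_mult_sin[OF v])
  also have "\<dots> = (sqrt (2 * pi) / (2 * pi)) * (l / sqrt s * exp (- (l\<^sup>2 * v / 2)))"
    using v s by (simp add: real_sqrt_mult field_simps)
  also have "sqrt (2 * pi) / (2 * pi) = 1 / sqrt (2 * pi)"
    using real_div_sqrt[of "2 * pi"] by (simp add: divide_simps)
  finally show ?thesis using True by (simp add: v_def real_sqrt_mult mult_ac)
qed (simp add: kernel_def)

lemma skew_density_fourier:
  "(LINT y|lborel. cos (l * y) * skew_density b t y) = exp (- (l\<^sup>2 * t / 2))"
  "(LINT y|lborel. sin (l * y) * skew_density b t y) =
     l * (LINT s:{0<..<t}|lborel. b s * exp (- (l\<^sup>2 * (t - s) / 2)) / sqrt (2 * pi * s))"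
proof -
  have st: "sqrt t > 0" using t by simp
  note n = integral_normal_cos[OF st, of l]
  show "(LINT y|lborel. cos (l * y) * skew_density b t y) = exp (- (l\<^sup>2 * t / 2))"
    using integral_skew_density(2)[of "\<lambda>y. cos (l * y)"] n t integral_even_kernel[of "\<lambda>y. cos (l * y)"] by simp
  have "(LINT y|lborel. sin (l * y) * skew_density b t y) =
     (LINT s|lborel. b s * (indicator {0<..<t} s * (l / sqrt (2 * pi * s) * exp (- (l\<^sup>2 * (t - s) / 2)))))"
    using integral_skew_density(2)[of "\<lambda>y. sin (l * y)"] n integral_sin_kernel by simp
  also have "\<dots> = l * (LINT s:{0<..<t}|lborel. b s * exp (- (l\<^sup>2 * (t - s) / 2)) / sqrt (2 * pi * s))"
    unfolding set_lebesgue_integral_def integral_mult_right_zero[symmetric]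
    by (intro Bochner_Integration.integral_cong) (auto simp: mult_ac)
  finally show "(LINT y|lborel. sin (l * y) * skew_density b t y) =
     l * (LINT s:{0<..<t}|lborel. b s * exp (- (l\<^sup>2 * (t - s) / 2)) / sqrt (2 * pi * s))" .
qed

lemma real_distribution_skew_density:
  "real_distribution (density lborel (\<lambda>y. ennreal (skew_density b t y)))"
proof -
  \<comment> \<open>The total mass is the cosine transform at frequency 0.\<close>
  have "integrable lborel (skew_density b t)" "(LINT y|lborel. skew_density b t y) = 1"
    using integral_skew_density(1)[of "\<lambda>_. 1"] skew_density_fourier(1)[of 0] t
    by simp_all
  then show ?thesis
    unfolding real_distribution_def real_distribution_axioms_def
    by (auto intro!: prob_spaceI simp: emeasure_density nn_integral_eq_integral skew_density_nonneg)
qed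
end

text \<open>The two transforms are the form in which the discretisation delivers the law: the decay
  of a cosine martingale, and the drift accumulated by the sines with weight
  \<open>1 / sqrt (2 * pi * s)\<close>.\<close>

theorem distributed_skew_densityI:
  fixes b :: "real \<Rightarrow> real"
  assumes "prob_space M" and X[measurable]: "X \<in> borel_measurable M" and t: "t > 0"
    and b[measurable]: "b \<in> borel_measurable borel" and b1: "\<And>s. \<bar>b s\<bar> \<le> 1"
    and c: "\<And>l. (LINT \<omega>|M. cos (l * X \<omega>)) = exp (- (l\<^sup>2 * t / 2))"
    and s: "\<And>l. (LINT \<omega>|M. sin (l * X \<omega>)) =
      l * (LINT s:{0<..<t}|lborel. b s * exp (- (l\<^sup>2 * (t - s) / 2)) / sqrt (2 * pi * s))"
  shows "distributed M lborel X (\<lambda>y. ennreal (skew_density b t y))"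
proof -
  interpret prob_space M by fact
  note [measurable] = measurable_skew_density[OF t b b1] and nn = skew_density_nonneg[OF t b b1]
  have "distr M borel X = density lborel (\<lambda>y. ennreal (skew_density b t y))"
  proof (rule real_distribution_eqI_cos_sin)
    show "real_distribution (density lborel (\<lambda>y. ennreal (skew_density b t y)))"
      by (rule real_distribution_skew_density[OF t b b1])
  qed (auto simp: integral_distr integral_density c s nn skew_density_fourier[OF t b b1, unfolded mult.commute[of _ "skew_density _ _ _"]])
  then show ?thesis
    unfolding distributed_def by (simp add: distr_cong[of M M lborel borel])
qed

section \<open>Stieltjes measures and occupation limits along one path\<close>

lemma sets_stieltjes_measure[simp, measurable_cong]: "sets (stieltjes_measure g) = sets borel"
  by (simp add: stieltjes_measure_def)

context
  fixes g :: "real \<Rightarrow> real"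
  assumes cont: "continuous_on {0..} g" and mono: "mono_on {0..} g"
begin

lemma stieltjes_extension:
  "a \<le> c \<Longrightarrow> g (max 0 a) \<le> g (max 0 c)" "isCont (\<lambda>s. g (max 0 s)) a"
proof -
  show "a \<le> c \<Longrightarrow> g (max 0 a) \<le> g (max 0 c)"
    by (rule mono_onD[OF mono]) auto
  have "continuous_on UNIV (\<lambda>s. g (max 0 s))"
    by (rule continuous_on_compose2[OF cont]) (auto intro!: continuous_intros)
  then show "isCont (\<lambda>s. g (max 0 s)) a" by (simp add: continuous_on_eq_continuous_at)
qed

lemma emeasure_stieltjes:
  assumes "0 \<le> a" "a \<le> c"
  shows "emeasure (stieltjes_measure g) {a<..c} = ennreal (g c - g a)"
    and "emeasure (stieltjes_measure g) {a..c} = ennreal (g c - g a)"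
proof -
  show "emeasure (stieltjes_measure g) {a<..c} = ennreal (g c - g a)"
    using emeasure_interval_measure_Ioc[of a c "\<lambda>s. g (max 0 s)"] stieltjes_extension assms
    unfolding stieltjes_measure_def by (auto simp: continuous_at_imp_continuous_at_within max_def)
  show "emeasure (stieltjes_measure g) {a..c} = ennreal (g c - g a)"
    using emeasure_interval_measure_Icc[of a c "\<lambda>s. g (max 0 s)"] stieltjes_extension assms
    unfolding stieltjes_measure_def
    by (auto simp: continuous_at_imp_continuous_on max_def)
qed

lemma measure_stieltjes:
  assumes "0 \<le> a" "a \<le> c"
  shows "measure (stieltjes_measure g) {a<..c} = g c - g a"
    and "measure (stieltjes_measure g) {a..c} = g c - g a"
  using emeasure_stieltjes[OF assms] mono_onD[OF mono, of a c] assms by (auto simp: measure_def)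

lemma occupation_integral:
  assumes x: "continuous_on {0..} (x :: real \<Rightarrow> real)"
  shows "{s\<in>{0..t}. x s \<in> {-e<..<e}} \<in> sets borel" (is "?A t \<in> _")
    and "(LINT s:{0..t}|stieltjes_measure g. indicator {-e<..<e} (x s)) =
      measure (stieltjes_measure g) {s\<in>{0..t}. x s \<in> {-e<..<e}}"
proof -
  \<comment> \<open>The path is continuous on \<open>{0..}\<close> only; frozen at negative times it
    becomes Borel on the whole line without changing the set in question.\<close>
  have "(\<lambda>s. x (max 0 s)) \<in> borel_measurable borel"
    by (intro borel_measurable_continuous_onI continuous_on_compose2[OF x]) (auto intro!: continuous_intros)
  then have "{s\<in>space borel. x (max 0 s) \<in> {-e<..<e}} \<inter> {0..t} \<in> sets borel" by measurable
  moreover have "{s\<in>space borel. x (max 0 s) \<in> {-e<..<e}} \<inter> {0..t} = ?A t" by auto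
  ultimately show A: "?A t \<in> sets borel" by simp
  have "(LINT s:{0..t}|stieltjes_measure g. indicator {-e<..<e} (x s)) =
     (LINT s|stieltjes_measure g. indicator (?A t) s)"
    unfolding set_lebesgue_integral_def by (intro Bochner_Integration.integral_cong) (auto simp: indicator_def)
  also have "\<dots> = measure (stieltjes_measure g) (?A t \<inter> space (stieltjes_measure g))"
    by (rule Bochner_Integration.integral_indicator)
  finally show "(LINT s:{0..t}|stieltjes_measure g. indicator {-e<..<e} (x s)) =
      measure (stieltjes_measure g) (?A t)"
    by (simp add: stieltjes_measure_def)
qed

text \<open>The occupation sets grow with \<open>t\<close>, which makes the limit monotone. On an
  interval free of zeros \<open>\<bar>x\<bar>\<close> has a positive minimum by compactness, so for
  smaller \<open>e\<close> the occupation sets up to \<open>r\<close> and up to \<open>t\<close>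
  coincide: the limit can increase only at zeros of \<open>x\<close>.\<close>

lemma occupation_limit:
  assumes x: "continuous_on {0..} (x :: real \<Rightarrow> real)"
    and l: "\<And>t. t \<ge> 0 \<Longrightarrow> ((\<lambda>e. 1 / (2 * e) * (LINT s:{0..t}|stieltjes_measure g. indicator {-e<..<e} (x s))) \<longlongrightarrow> l t) (at_right 0)"
  shows "l 0 = 0"
    and "mono_on {0..} l"
    and "\<And>r t. 0 \<le> r \<Longrightarrow> r \<le> t \<Longrightarrow> (\<And>s. r \<le> s \<Longrightarrow> s \<le> t \<Longrightarrow> x s \<noteq> 0) \<Longrightarrow> l t = l r"
proof -
  define A where "A t e = {s\<in>{0..t}. x s \<in> {-e<..<e}}" for t e
  note A = occupation_integral(1)[OF x, folded A_def]
  note L = l[unfolded occupation_integral(2)[OF x], folded A_def]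
  have fin: "emeasure (stieltjes_measure g) {0..t} \<noteq> \<infinity>" if "t \<ge> 0" for t
    using emeasure_stieltjes(2)[of 0 t] that by simp
  have fm: "B \<in> fmeasurable (stieltjes_measure g)" if "B \<in> sets borel" "B \<subseteq> {0..t}" "t \<ge> 0" for B t
    by (rule fmeasurableI2[of "{0..t}"]) (use that fin[of t] in \<open>auto simp: fmeasurable_def stieltjes_measure_def top.not_eq_extremum\<close>)
  have m: "measure (stieltjes_measure g) (A r e) \<le> measure (stieltjes_measure g) (A t e)" if "0 \<le> r" "r \<le> t" for r t e
    by (rule measure_mono_fmeasurable[OF _ _ fm[of _ t]])
      (use that A in \<open>auto simp: A_def stieltjes_measure_def\<close>)
  have z: "measure (stieltjes_measure g) (A 0 e) = 0" for e
  proof -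
    have sub: "A 0 e \<subseteq> {0..0}" by (auto simp: A_def)
    have "measure (stieltjes_measure g) (A 0 e) \<le> measure (stieltjes_measure g) {0..0}"
      by (rule measure_mono_fmeasurable[OF sub _ fm[of _ 0]])
        (simp_all only: A order_refl sets_stieltjes_measure borel_closed closed_atLeastAtMost)
    also have "\<dots> = 0" using measure_stieltjes(2)[of 0 0] by simp
    finally show ?thesis by (intro antisym measure_nonneg)
  qed
  show "l 0 = 0"
    by (rule tendsto_unique[OF _ L]) (auto simp: z)
  show "mono_on {0..} l"
  proof (rule mono_onI)
    fix r t :: real assume rt: "r \<in> {0..}" "t \<in> {0..}" "r \<le> t"
    show "l r \<le> l t"
    proof (rule tendsto_le[OF _ L[of t] L[of r]])
      show "\<forall>\<^sub>F e in at_right 0. 1 / (2 * e) * measure (stieltjes_measure g) (A r e) \<le> 1 / (2 * e) * measure (stieltjes_measure g) (A t e)"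
        using eventually_at_right_less[of "0::real"]
        by eventually_elim (use rt m[of r t] in \<open>auto intro!: divide_right_mono\<close>)
    qed (use rt in simp_all)
  qed
  show "l t = l r" if rt: "0 \<le> r" "r \<le> t" and nz: "\<And>s. r \<le> s \<Longrightarrow> s \<le> t \<Longrightarrow> x s \<noteq> 0" for r t
  proof -
    have "compact {r..t}" "{r..t} \<noteq> {}" using rt by auto
    moreover have "continuous_on {r..t} (\<lambda>s. \<bar>x s\<bar>)"
      using rt by (intro continuous_intros continuous_on_subset[OF x]) auto
    ultimately obtain q where q: "q \<in> {r..t}" "\<And>s. s \<in> {r..t} \<Longrightarrow> \<bar>x q\<bar> \<le> \<bar>x s\<bar>"
      using continuous_attains_inf by meson
    have "\<bar>x q\<bar> > 0" using nz[of q] q by auto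
    then have "\<forall>\<^sub>F e in at_right (0::real). e < \<bar>x q\<bar>"
      by (rule order_tendstoD(2)[OF tendsto_ident_at])
    then have ev: "\<forall>\<^sub>F e in at_right 0. 1 / (2 * e) * measure (stieltjes_measure g) (A r e) = 1 / (2 * e) * measure (stieltjes_measure g) (A t e)"
    proof eventually_elim
      case (elim e)
      have "A r e = A t e"
      proof -
        have n: "x s \<notin> {-e<..<e}" if "s \<in> {r..t}" for s using q(2)[OF that] elim by auto
        have "s \<in> A r e" if s: "s \<in> A t e" for s
        proof -
          have "s \<notin> {r..t}" using n s by (auto simp: A_def)
          then show ?thesis using s by (auto simp: A_def)
        qed
        moreover have "A r e \<subseteq> A t e" using rt by (auto simp: A_def)
        ultimately show ?thesis by blast
      qed
      then show ?case by simp
    qed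
    have "((\<lambda>e. 1 / (2 * e) * measure (stieltjes_measure g) (A t e)) \<longlongrightarrow> l r) (at_right 0)"
      using L[OF rt(1)] ev by (rule Lim_transform_eventually)
    moreover have "((\<lambda>e. 1 / (2 * e) * measure (stieltjes_measure g) (A t e)) \<longlongrightarrow> l t) (at_right 0)"
      by (rule L) (use rt in simp)
    ultimately show ?thesis by (intro tendsto_unique[OF trivial_limit_at_right_real])
  qed
qed

text \<open>Applied to a path of the local time, this is where the bound 1 on \<beta> turns into
  domination of the drift by the increments of \<open>L\<close>.\<close>

lemma stieltjes_integral_increment:
  assumes [measurable]: "b \<in> borel_measurable borel" and b1: "\<And>s. \<bar>b s\<bar> \<le> (1::real)" and rt: "0 \<le> r" "r \<le> t"
  shows "set_integrable (stieltjes_measure g) {0..t} b"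
    and "(LINT s:{0..t}|stieltjes_measure g. b s) - (LINT s:{0..r}|stieltjes_measure g. b s) = (LINT s:{r<..t}|stieltjes_measure g. b s)"
    and "\<bar>LINT s:{r<..t}|stieltjes_measure g. b s\<bar> \<le> g t - g r"
proof -
  have bm[measurable]: "b \<in> borel_measurable (stieltjes_measure g)" unfolding stieltjes_measure_def by simp
  have S: "sets (stieltjes_measure g) = sets borel" unfolding stieltjes_measure_def by simp
  have i: "set_integrable (stieltjes_measure g) B b"
    if "B \<in> sets borel" "emeasure (stieltjes_measure g) B < \<infinity>" for B
    unfolding set_integrable_def
    by (rule Bochner_Integration.integrable_bound[of _ "indicator B :: real \<Rightarrow> real"])
      (use that b1 S in \<open>auto simp: indicator_def\<close>)
  show i1: "set_integrable (stieltjes_measure g) {0..t} b"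
    using i emeasure_stieltjes(2)[of 0 t] rt by simp
  have i0: "set_integrable (stieltjes_measure g) {0..r} b"
    using i emeasure_stieltjes(2)[of 0 r] rt by simp
  have i2: "set_integrable (stieltjes_measure g) {r<..t} b"
    using i emeasure_stieltjes(1)[of r t] rt by simp
  have "{0..t} = {0..r} \<union> {r<..t}" using rt by auto
  then have "(LINT s:{0..t}|stieltjes_measure g. b s) = (LINT s:{0..r}|stieltjes_measure g. b s) + (LINT s:{r<..t}|stieltjes_measure g. b s)"
    using set_integral_Un[OF ivl_disj_int_two(8)[of 0 r t] i0 i2] by (simp only:)
  then show "(LINT s:{0..t}|stieltjes_measure g. b s) - (LINT s:{0..r}|stieltjes_measure g. b s) = (LINT s:{r<..t}|stieltjes_measure g. b s)"
    by simp
  have ii: "integrable (stieltjes_measure g) (indicator {r<..t} :: real \<Rightarrow> real)"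
    by (rule integrable_real_indicator) (simp_all only: S emeasure_stieltjes(1)[OF rt] ennreal_less_top infinity_ennreal_def greaterThanAtMost_borel)
  have "\<bar>LINT s:{r<..t}|stieltjes_measure g. b s\<bar> \<le> (LINT s|stieltjes_measure g. indicator {r<..t} s)"
    unfolding set_lebesgue_integral_def real_norm_def[symmetric]
    by (rule order_trans[OF integral_norm_bound integral_mono[OF integrable_norm[OF i2[unfolded set_integrable_def]] ii]])
      (simp add: indicator_def b1)
  also have "\<dots> = measure (stieltjes_measure g) ({r<..t} \<inter> space (stieltjes_measure g))"
    by (rule Bochner_Integration.integral_indicator)
  also have "\<dots> = g t - g r" using measure_stieltjes(1)[OF rt] by (simp add: stieltjes_measure_def)
  finally show "\<bar>LINT s:{r<..t}|stieltjes_measure g. b s\<bar> \<le> g t - g r" .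
qed

end

text \<open>Intended for \<open>g\<close> a path of the bracket: once that is known to be time,
  occupation integrals become Lebesgue integrals. Negative times carry no mass because the extension
  of \<open>g\<close> is constant there.\<close>

lemma stieltjes_measure_ident:
  assumes "\<And>s. s \<ge> 0 \<Longrightarrow> g s = s"
  shows "stieltjes_measure g = density lborel (indicator {0..})"
proof -
  have ge: "stieltjes_measure g = interval_measure (\<lambda>s. max 0 s)"
    unfolding stieltjes_measure_def using assms by simp
  have e: "emeasure (stieltjes_measure g) {a<..c} = emeasure (density lborel (indicator {0..})) {a<..c}" for a c
  proof (cases "a \<le> c")
    case True
    have "emeasure (stieltjes_measure g) {a<..c} = ennreal (max 0 c - max 0 a)"
      unfolding ge using True
      by (intro emeasure_interval_measure_Ioc) (auto intro!: continuous_intros)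
    also have "\<dots> = emeasure lborel ({0..} \<inter> {a<..c})"
    proof -
      consider "c < 0" | "a < 0" "c \<ge> 0" | "a \<ge> 0" by linarith
      then show ?thesis
      proof cases
        case 1
        then have "{0..} \<inter> {a<..c} = {}" by auto
        then show ?thesis using 1 True by simp
      next
        case 2
        then have "{0..} \<inter> {a<..c} = {0..c}" by auto
        then show ?thesis using 2 by simp
      next
        case 3
        then have "{0..} \<inter> {a<..c} = {a<..c}" by auto
        then show ?thesis using 3 True by simp
      qed
    qed
    also have "\<dots> = emeasure (density lborel (indicator {0..})) {a<..c}"
      by (subst emeasure_density) (simp_all add: indicator_inter_arith[symmetric])
    finally show ?thesis .
  qed simp
  show ?thesis
  proof (rule measure_eqI_generator_eq[where E="range (\<lambda>(i, j). {i<..j::real})" and \<Omega>=UNIV and A="\<lambda>n. {-real n<..real n}"])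
    show "Int_stable (range (\<lambda>(i, j). {i<..j::real}))"
      by (auto simp: Int_stable_def Int_greaterThanAtMost image_iff)
    show "sets (stieltjes_measure g) = sigma_sets UNIV (range (\<lambda>(i, j). {i<..j::real}))"
      "sets (density lborel (indicator {0..})) = sigma_sets UNIV (range (\<lambda>(i, j). {i<..j::real}))"
      by (auto simp: borel_sigma_sets_Ioc stieltjes_measure_def)
    show "(\<Union>n. {- real n<..real n}) = UNIV"
    proof (safe; simp)
      fix x :: real
      obtain n :: nat where "\<bar>x\<bar> < real n" using reals_Archimedean2 by blast
      then have "- real n < x \<and> x \<le> real n" by auto
      then show "\<exists>n. - real n < x \<and> x \<le> real n" ..
    qed
    show "emeasure (stieltjes_measure g) {- real n<..real n} \<noteq> \<infinity>" for n
      unfolding ge by (subst emeasure_interval_measure_Ioc) (auto intro!: continuous_intros)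
  qed (auto simp: e)
qed

lemma stieltjes_integral_ident:
  assumes "\<And>s. s \<ge> 0 \<Longrightarrow> g s = s" and [measurable]: "B \<in> sets borel" "f \<in> borel_measurable borel" and B: "B \<subseteq> {0..}"
  shows "(LINT s:B|stieltjes_measure g. f s) = (LINT s:B|lborel. f s :: real)"
proof -
  have "(LINT s:B|stieltjes_measure g. f s) = (LINT s|density lborel (\<lambda>x. ennreal (indicator {0..} x)). indicator B s *\<^sub>R f s)"
    using stieltjes_measure_ident[OF assms(1)] by (simp add: set_lebesgue_integral_def ennreal_indicator)
  also have "\<dots> = (LINT s:B|lborel. f s)"
    unfolding set_lebesgue_integral_def
    by (subst integral_density) (use B in \<open>auto intro!: Bochner_Integration.integral_cong simp: indicator_def\<close>)
  finally show ?thesis .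
qed

section \<open>Brownian increments and their independence of the past\<close>

lemma (in prob_space) indep_set_mono:
  "indep_set A B \<Longrightarrow> A' \<subseteq> A \<Longrightarrow> B' \<subseteq> B \<Longrightarrow> indep_set A' B'"
  unfolding indep_sets2_eq by blast

locale brownian_filtered = filtered_prob_space M F for M :: "'a measure" and F +
  fixes W :: "real \<Rightarrow> 'a \<Rightarrow> real"
  assumes bm: "brownian_motion M F W"
begin

lemma measurable_F_mono: "f \<in> borel_measurable (F s) \<Longrightarrow> s \<le> t \<Longrightarrow> f \<in> borel_measurable (F t)"
  using sets_F_mono[of s t] unfolding measurable_def by (auto simp: space_F)

lemma measurable_F_M: "f \<in> borel_measurable (F t) \<Longrightarrow> f \<in> borel_measurable M"
  using sets_F_subset[of t] unfolding measurable_def by (auto simp: space_F)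

lemma W_measurable_F: "0 \<le> t \<Longrightarrow> t \<le> u \<Longrightarrow> W t \<in> borel_measurable (F u)"
  using bm measurable_F_mono unfolding brownian_motion_def adapted_def by blast

lemma W_measurable[measurable]: "0 \<le> t \<Longrightarrow> W t \<in> borel_measurable M"
  using W_measurable_F[of t t] measurable_F_M by blast

context
  fixes r t :: real
  assumes r: "0 \<le> r" and rt: "r < t"
begin

lemma increment_integral:
  assumes [measurable]: "h \<in> borel_measurable borel"
  shows "integrable M (\<lambda>\<omega>. h (W t \<omega> - W r \<omega>) :: real) \<longleftrightarrow> integrable lborel (\<lambda>x. normal_density 0 (sqrt (t - r)) x * h x)"
    and "(LINT \<omega>|M. h (W t \<omega> - W r \<omega>)) = (LINT x|lborel. normal_density 0 (sqrt (t - r)) x * h x)"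
proof -
  have D: "distributed M lborel (\<lambda>\<omega>. W t \<omega> - W r \<omega>) (\<lambda>x. ennreal (normal_density 0 (sqrt (t - r)) x))"
    using bm r rt unfolding brownian_motion_def by blast
  show "integrable M (\<lambda>\<omega>. h (W t \<omega> - W r \<omega>)) \<longleftrightarrow> integrable lborel (\<lambda>x. normal_density 0 (sqrt (t - r)) x * h x)"
    by (rule distributed_integrable[OF D, symmetric]) auto
  show "(LINT \<omega>|M. h (W t \<omega> - W r \<omega>)) = (LINT x|lborel. normal_density 0 (sqrt (t - r)) x * h x)"
    by (rule distributed_integral[OF D, symmetric]) auto
qed

text \<open>The definition of Brownian motion states independence for preimages under the increment
  itself. These already form a sigma-algebra, which contains the preimages under \<open>h\<close> of
  the increment, while those under \<open>p\<close> lie in \<open>F r\<close>; so independence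
  passes to \<open>p\<close> and \<open>h\<close>.\<close>

lemma increment_indep:
  assumes p: "p \<in> borel_measurable (F r)" and ip: "integrable M p"
    and h[measurable]: "h \<in> borel_measurable borel" and ih: "integrable M (\<lambda>\<omega>. h (W t \<omega> - W r \<omega>) :: real)"
  shows "integrable M (\<lambda>\<omega>. p \<omega> * h (W t \<omega> - W r \<omega>))"
    and "(LINT \<omega>|M. p \<omega> * h (W t \<omega> - W r \<omega>)) = (LINT \<omega>|M. p \<omega>) * (LINT \<omega>|M. h (W t \<omega> - W r \<omega>))"
proof -
  have [measurable]: "p \<in> borel_measurable M" by (rule measurable_F_M[OF p])
  have [measurable]: "W t \<in> borel_measurable M" "W r \<in> borel_measurable M" using r rt by auto
  let ?D = "\<lambda>\<omega>. W t \<omega> - W r \<omega>" and ?H = "\<lambda>\<omega>. h (W t \<omega> - W r \<omega>)"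
  have ind: "indep_set (sets (F r)) {?D -` A \<inter> space M | A. A \<in> sets borel}"
    using bm r rt unfolding brownian_motion_def by blast
  have s1: "sigma_sets (space M) {p -` A \<inter> space M |A. A \<in> sets borel} \<subseteq> sets (F r)"
    using sets.sigma_sets_subset[of "{p -` A \<inter> space M |A. A \<in> sets borel}" "F r"] measurable_sets[OF p]
    by (auto simp: space_F)
  have s2: "sigma_sets (space M) {?H -` A \<inter> space M |A. A \<in> sets borel} \<subseteq> {?D -` A \<inter> space M | A. A \<in> sets borel}"
  proof -
    have "{?D -` A \<inter> space M | A. A \<in> sets borel} = sets (vimage_algebra (space M) ?D borel)"
      by (auto simp: sets_vimage_algebra2)
    moreover have "{?H -` A \<inter> space M |A. A \<in> sets borel} \<subseteq> {?D -` A \<inter> space M | A. A \<in> sets borel}"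
    proof (clarsimp)
      fix A :: "real set" assume A: "A \<in> sets borel"
      have "h -` A \<in> sets borel" using measurable_sets[OF h A] by simp
      moreover have "?H -` A \<inter> space M = ?D -` (h -` A) \<inter> space M" by auto
      ultimately show "\<exists>B. ?H -` A \<inter> space M = ?D -` B \<inter> space M \<and> B \<in> sets borel" by blast
    qed
    ultimately show ?thesis
      using sets.sigma_sets_subset[of "{?H -` A \<inter> space M |A. A \<in> sets borel}" "vimage_algebra (space M) ?D borel"]
      by simp
  qed
  have iv: "indep_var borel p borel ?H"
    unfolding indep_var_eq
  proof (intro conjI)
    show "indep_set (sigma_sets (space M) {p -` A \<inter> space M |A. A \<in> sets borel}) (sigma_sets (space M) {?H -` A \<inter> space M |A. A \<in> sets borel})"
      by (rule indep_set_mono[OF ind s1 s2])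
  qed measurable
  show "integrable M (\<lambda>\<omega>. p \<omega> * ?H \<omega>)" by (rule indep_var_integrable[OF iv ip ih])
  show "(LINT \<omega>|M. p \<omega> * ?H \<omega>) = (LINT \<omega>|M. p \<omega>) * (LINT \<omega>|M. ?H \<omega>)"
    by (rule indep_var_lebesgue_integral[OF iv ip ih])
qed

text \<open>With \<open>d = t - r\<close>, the second and fourth Gaussian moments \<open>d\<close>
  and \<open>3 * d\<^sup>2\<close> give mean 0 and variance
  \<open>3 * d\<^sup>2 - 2 * d\<^sup>2 + d\<^sup>2\<close>.\<close>

lemma increment_square:
  fixes h defines "h \<equiv> \<lambda>x::real. x\<^sup>2 - (t - r)"
  shows "integrable M (\<lambda>\<omega>. h (W t \<omega> - W r \<omega>))" "(LINT \<omega>|M. h (W t \<omega> - W r \<omega>)) = 0"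
    "integrable M (\<lambda>\<omega>. (h (W t \<omega> - W r \<omega>))\<^sup>2)" "(LINT \<omega>|M. (h (W t \<omega> - W r \<omega>))\<^sup>2) = 2 * (t - r)\<^sup>2"
proof -
  define d where "d = t - r"
  have d: "sqrt d > 0" "d > 0" using rt by (auto simp: d_def)
  note m = normal_moment_even[OF d(1), of 0]
  have 0: "has_bochner_integral lborel (normal_density 0 (sqrt d)) 1" using m[of 0] by simp
  have 1: "has_bochner_integral lborel (\<lambda>x. normal_density 0 (sqrt d) x * x\<^sup>2) d"
    using m[of 1] d by simp
  have "fact (2 * 2) / ((2 / (sqrt d)\<^sup>2)\<^sup>2 * fact 2) = 3 * d\<^sup>2"
    using d by (simp add: fact_numeral power_divide)
  then have 2: "has_bochner_integral lborel (\<lambda>x. normal_density 0 (sqrt d) x * x ^ 4) (3 * d\<^sup>2)"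
    using m[of 2] by simp
  have "has_bochner_integral lborel (\<lambda>x. normal_density 0 (sqrt d) x * x\<^sup>2 - d * normal_density 0 (sqrt d) x) (d - d * 1)"
    by (intro has_bochner_integral_diff has_bochner_integral_mult_right 0 1)
  moreover have "(\<lambda>x. normal_density 0 (sqrt d) x * x\<^sup>2 - d * normal_density 0 (sqrt d) x) = (\<lambda>x. normal_density 0 (sqrt d) x * h x)"
    by (auto simp: h_def d_def algebra_simps)
  ultimately have A: "has_bochner_integral lborel (\<lambda>x. normal_density 0 (sqrt (t - r)) x * h x) 0" by (simp add: d_def)
  have "has_bochner_integral lborel (\<lambda>x. normal_density 0 (sqrt d) x * x ^ 4 - 2 * d * (normal_density 0 (sqrt d) x * x\<^sup>2) + d\<^sup>2 * normal_density 0 (sqrt d) x) (3 * d\<^sup>2 - 2 * d * d + d\<^sup>2 * 1)"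
    by (intro has_bochner_integral_add has_bochner_integral_diff has_bochner_integral_mult_right 0 1 2)
  moreover have eq: "(\<lambda>x. normal_density 0 (sqrt d) x * x ^ 4 - 2 * d * (normal_density 0 (sqrt d) x * x\<^sup>2) + d\<^sup>2 * normal_density 0 (sqrt d) x) = (\<lambda>x. normal_density 0 (sqrt d) x * (h x)\<^sup>2)"
    by (auto simp: h_def d_def[symmetric] power2_eq_square power4_eq_xxxx algebra_simps)
  ultimately have B: "has_bochner_integral lborel (\<lambda>x. normal_density 0 (sqrt (t - r)) x * (h x)\<^sup>2) (2 * (t - r)\<^sup>2)"
  proof -
    have "3 * d\<^sup>2 - 2 * d * d + d\<^sup>2 * 1 = 2 * d\<^sup>2" by (simp add: power2_eq_square)
    with \<open>has_bochner_integral lborel (\<lambda>x. normal_density 0 (sqrt d) x * x ^ 4 - 2 * d * (normal_density 0 (sqrt d) x * x\<^sup>2) + d\<^sup>2 * normal_density 0 (sqrt d) x) (3 * d\<^sup>2 - 2 * d * d + d\<^sup>2 * 1)\<close> eq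
    show ?thesis by (simp only: d_def[symmetric])
  qed
  have [measurable]: "h \<in> borel_measurable borel" unfolding h_def by measurable
  show "integrable M (\<lambda>\<omega>. h (W t \<omega> - W r \<omega>))" "(LINT \<omega>|M. h (W t \<omega> - W r \<omega>)) = 0"
    using A increment_integral[of h] by (auto simp: has_bochner_integral_iff)
  show "integrable M (\<lambda>\<omega>. (h (W t \<omega> - W r \<omega>))\<^sup>2)" "(LINT \<omega>|M. (h (W t \<omega> - W r \<omega>))\<^sup>2) = 2 * (t - r)\<^sup>2"
    using B increment_integral[of "\<lambda>x. (h x)\<^sup>2"] by (auto simp: has_bochner_integral_iff)
qed

text \<open>The addition theorem splits the mean into two products that factor by independence; the
  sine of the centred increment has mean 0 and its cosine supplies the exponential. The phase
  \<open>\<theta>\<close> lets one statement serve cosines and, with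
  \<open>\<theta> = - (pi / 2)\<close>, sines.\<close>

lemma cos_one_step:
  assumes p: "p \<in> borel_measurable (F r)" and pb: "\<And>\<omega>. \<bar>p \<omega>\<bar> \<le> (c::real)" and Y: "Y \<in> borel_measurable (F r)"
  shows "(LINT \<omega>|M. p \<omega> * cos (l * (Y \<omega> + (W t \<omega> - W r \<omega>)) + \<theta>)) =
    exp (- (l\<^sup>2 * (t - r) / 2)) * (LINT \<omega>|M. p \<omega> * cos (l * Y \<omega> + \<theta>))"
proof -
  have d: "sqrt (t - r) > 0" using rt by simp
  note n = integral_normal_cos[OF d, of l]
  have c: "integrable M (\<lambda>\<omega>. cos (l * (W t \<omega> - W r \<omega>)))" "(LINT \<omega>|M. cos (l * (W t \<omega> - W r \<omega>))) = exp (- (l\<^sup>2 * (t - r) / 2))"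
    using increment_integral[of "\<lambda>x. cos (l * x)"] n rt by simp_all
  have s: "integrable M (\<lambda>\<omega>. sin (l * (W t \<omega> - W r \<omega>)))" "(LINT \<omega>|M. sin (l * (W t \<omega> - W r \<omega>))) = 0"
    using increment_integral[of "\<lambda>x. sin (l * x)"] n rt by simp_all
  have c0: "c \<ge> 0" using pb[of undefined] by linarith
  have pc: "(\<lambda>\<omega>. p \<omega> * cos (l * Y \<omega> + \<theta>)) \<in> borel_measurable (F r)"
    and ps: "(\<lambda>\<omega>. p \<omega> * sin (l * Y \<omega> + \<theta>)) \<in> borel_measurable (F r)"
    using p Y by measurable
  have pb1: "\<bar>p \<omega> * x\<bar> \<le> c" if "\<bar>x\<bar> \<le> 1" for \<omega> x
    using mult_mono[OF pb[of \<omega>] that] c0 by (simp add: abs_mult)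
  have pci: "integrable M (\<lambda>\<omega>. p \<omega> * cos (l * Y \<omega> + \<theta>))"
    by (rule integrable_const_bound[where B=c, OF AE_I2 measurable_F_M[OF pc]]) (simp add: pb1)
  have psi: "integrable M (\<lambda>\<omega>. p \<omega> * sin (l * Y \<omega> + \<theta>))"
    by (rule integrable_const_bound[where B=c, OF AE_I2 measurable_F_M[OF ps]]) (simp add: pb1)
  note ic = increment_indep[OF pc pci _ c(1)] and is' = increment_indep[OF ps psi _ s(1)]
  have "(LINT \<omega>|M. p \<omega> * cos (l * (Y \<omega> + (W t \<omega> - W r \<omega>)) + \<theta>)) =
     (LINT \<omega>|M. p \<omega> * cos (l * Y \<omega> + \<theta>) * cos (l * (W t \<omega> - W r \<omega>)) - p \<omega> * sin (l * Y \<omega> + \<theta>) * sin (l * (W t \<omega> - W r \<omega>)))"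
  proof (rule Bochner_Integration.integral_cong)
    fix \<omega>
    have "l * (Y \<omega> + (W t \<omega> - W r \<omega>)) + \<theta> = (l * Y \<omega> + \<theta>) + l * (W t \<omega> - W r \<omega>)" by (simp add: algebra_simps)
    moreover have "q * cos (a + b) = q * cos a * cos b - q * sin a * sin b" for q a b :: real
      by (simp add: cos_add algebra_simps)
    ultimately show "p \<omega> * cos (l * (Y \<omega> + (W t \<omega> - W r \<omega>)) + \<theta>) =
      p \<omega> * cos (l * Y \<omega> + \<theta>) * cos (l * (W t \<omega> - W r \<omega>)) - p \<omega> * sin (l * Y \<omega> + \<theta>) * sin (l * (W t \<omega> - W r \<omega>))"
      by (simp only:)
  qed simp
  also have "\<dots> = (LINT \<omega>|M. p \<omega> * cos (l * Y \<omega> + \<theta>) * cos (l * (W t \<omega> - W r \<omega>))) - (LINT \<omega>|M. p \<omega> * sin (l * Y \<omega> + \<theta>) * sin (l * (W t \<omega> - W r \<omega>)))"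
    by (rule Bochner_Integration.integral_diff) (rule ic(1) is'(1); simp)+
  also have "\<dots> = exp (- (l\<^sup>2 * (t - r) / 2)) * (LINT \<omega>|M. p \<omega> * cos (l * Y \<omega> + \<theta>))"
    using ic(2) is'(2) c(2) s(2) by simp
  finally show ?thesis .
qed

end

text \<open>The partial sum is measurable for the past of the next increment, whose centred square
  has mean 0. Hence the summands are orthogonal and their variances add.\<close>

lemma quadratic_sum_L2:
  assumes u0: "0 \<le> u 0" and u: "\<And>i. u i < u (Suc i)"
  defines "T \<equiv> \<lambda>m \<omega>. \<Sum>i<m. (W (u (Suc i)) \<omega> - W (u i) \<omega>)\<^sup>2 - (u (Suc i) - u i)"
  shows "integrable M (T m)" "integrable M (\<lambda>\<omega>. (T m \<omega>)\<^sup>2)"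
    "(LINT \<omega>|M. (T m \<omega>)\<^sup>2) = (\<Sum>i<m. 2 * (u (Suc i) - u i)\<^sup>2)"
proof -
  have um: "i \<le> j \<Longrightarrow> u i \<le> u j" for i j by (rule lift_Suc_mono_le[of u, OF less_imp_le[OF u]])
  have up: "0 \<le> u i" for i using order_trans[OF u0 um[of 0 i]] by simp
  have TF: "T m \<in> borel_measurable (F (u m))" for m
    unfolding T_def
    by (intro borel_measurable_sum borel_measurable_diff borel_measurable_power borel_measurable_const W_measurable_F up um) auto
  have "integrable M (T m) \<and> integrable M (\<lambda>\<omega>. (T m \<omega>)\<^sup>2) \<and> (LINT \<omega>|M. (T m \<omega>)\<^sup>2) = (\<Sum>i<m. 2 * (u (Suc i) - u i)\<^sup>2)"
  proof (induction m)
    case 0 show ?case by (simp add: T_def)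
  next
    case (Suc m)
    let ?Z = "\<lambda>\<omega>. (W (u (Suc m)) \<omega> - W (u m) \<omega>)\<^sup>2 - (u (Suc m) - u m)"
    note z = increment_square[OF up u, of m]
    have h: "(\<lambda>x::real. x\<^sup>2 - (u (Suc m) - u m)) \<in> borel_measurable borel" by measurable
    note x = increment_indep[OF up u TF _ h z(1)]
    have x1: "integrable M (\<lambda>\<omega>. T m \<omega> * ?Z \<omega>)" "(LINT \<omega>|M. T m \<omega> * ?Z \<omega>) = 0"
      using x Suc.IH z(2) by auto
    have TS: "T (Suc m) = (\<lambda>\<omega>. T m \<omega> + ?Z \<omega>)" by (simp add: T_def)
    have sq: "(\<lambda>\<omega>. (T (Suc m) \<omega>)\<^sup>2) = (\<lambda>\<omega>. (T m \<omega>)\<^sup>2 + 2 * (T m \<omega> * ?Z \<omega>) + (?Z \<omega>)\<^sup>2)"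
    proof -
      have "(a + b)\<^sup>2 = a\<^sup>2 + 2 * (a * b) + b\<^sup>2" for a b :: real by (simp add: power2_sum)
      then show ?thesis unfolding TS by (intro ext)
    qed
    have "(LINT \<omega>|M. (T (Suc m) \<omega>)\<^sup>2) = (LINT \<omega>|M. (T m \<omega>)\<^sup>2) + 2 * (LINT \<omega>|M. T m \<omega> * ?Z \<omega>) + (LINT \<omega>|M. (?Z \<omega>)\<^sup>2)"
      unfolding sq using x1(1) Suc.IH z(3) by simp
    moreover have "integrable M (T (Suc m))" unfolding TS using z(1) Suc.IH by simp
    moreover have "integrable M (\<lambda>\<omega>. (T (Suc m) \<omega>)\<^sup>2)" unfolding sq using x1(1) Suc.IH z(3) by simp
    ultimately show ?case using x1(2) z(4) Suc.IH by (simp only: sum.lessThan_Suc) simp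
  qed
  then show "integrable M (T m)" "integrable M (\<lambda>\<omega>. (T m \<omega>)\<^sup>2)"
    "(LINT \<omega>|M. (T m \<omega>)\<^sup>2) = (\<Sum>i<m. 2 * (u (Suc i) - u i)\<^sup>2)" by auto
qed

end

section \<open>Grids and deterministic path estimates\<close>

text \<open>There are \<open>Suc n\<close> cells, so the mesh never divides by 0. Indices beyond
  \<open>Suc n\<close> run on past \<open>t\<close>, which for \<open>r < t\<close> keeps the grid
  strictly increasing in all \<open>i\<close>, as \<open>quadratic_sum_L2\<close> asks.\<close>

definition grid :: "real \<Rightarrow> real \<Rightarrow> nat \<Rightarrow> nat \<Rightarrow> real" where
  "grid r t n i = r + (t - r) / real (Suc n) * real i"

lemma grid_0[simp]: "grid r t n 0 = r"
  by (simp add: grid_def)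

lemma grid_end[simp]: "grid r t n (Suc n) = t"
  by (simp add: grid_def)

lemma grid_diff: "grid r t n (Suc i) - grid r t n i = (t - r) / real (Suc n)"
  by (simp add: grid_def distrib_left)

lemma grid_less: "r < t \<Longrightarrow> grid r t n i < grid r t n (Suc i)"
  using grid_diff[of r t n i] by (smt (verit) divide_pos_pos of_nat_0_less_iff zero_less_Suc)

lemma grid_mono: "r < t \<Longrightarrow> i \<le> j \<Longrightarrow> grid r t n i \<le> grid r t n j"
  by (rule lift_Suc_mono_le[of "grid r t n", OF less_imp_le[OF grid_less]])

lemma grid_ge: "r < t \<Longrightarrow> r \<le> grid r t n i"
  using grid_mono[of r t 0 i n] by simp

lemma grid_le: "r < t \<Longrightarrow> i \<le> Suc n \<Longrightarrow> grid r t n i \<le> t"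
  using grid_mono[of r t i "Suc n" n] by simp

lemma grid_mesh: "e > 0 \<Longrightarrow> \<forall>\<^sub>F n in sequentially. (t - r) / real (Suc n) < e"
  by (rule order_tendstoD(2)[of _ 0])
    (rule real_tendsto_divide_at_top[OF tendsto_const filterlim_compose[OF filterlim_real_sequentially filterlim_Suc]])

lemma grid_uniformly_small:
  assumes f: "continuous_on {0..} (f :: real \<Rightarrow> real)" and r: "0 \<le> r" "r < t" and e: "e > 0"
  shows "\<forall>\<^sub>F n in sequentially. \<forall>i<Suc n. \<forall>s\<in>{grid r t n i..grid r t n (Suc i)}. \<forall>s'\<in>{grid r t n i..grid r t n (Suc i)}. \<bar>f s - f s'\<bar> < e"
proof -
  have "uniformly_continuous_on {0..t} f"
    by (rule compact_uniformly_continuous[OF continuous_on_subset[OF f]]) auto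
  then obtain d where d: "d > 0" "\<And>s s'. s \<in> {0..t} \<Longrightarrow> s' \<in> {0..t} \<Longrightarrow> dist s' s < d \<Longrightarrow> dist (f s') (f s) < e"
    using e unfolding uniformly_continuous_on_def by meson
  show ?thesis
    using grid_mesh[OF d(1), of t r]
  proof eventually_elim
    case (elim n)
    show ?case
    proof (intro allI impI ballI)
      fix i s s' assume i: "i < Suc n" and s: "s \<in> {grid r t n i..grid r t n (Suc i)}" "s' \<in> {grid r t n i..grid r t n (Suc i)}"
      have "\<bar>s - s'\<bar> < d" using s elim grid_diff[of r t n i] by auto
      moreover have "s \<in> {0..t}" "s' \<in> {0..t}"
        using s grid_ge[OF r(2), of n i] grid_le[OF r(2), of "Suc i" n] i r by auto
      ultimately show "\<bar>f s - f s'\<bar> < e"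
        using d(2)[of s' s] by (simp add: dist_real_def)
    qed
  qed
qed

text \<open>What almost every triple of paths satisfies. The bound on \<beta> survives as domination
  of the drift \<open>x - w\<close> by \<open>l\<close>, and the support of the local time as
  constancy of \<open>l\<close> off the zeros of \<open>x\<close>; the grid estimates below concern
  one such path.\<close>

definition skew_path :: "(real \<Rightarrow> real) \<Rightarrow> (real \<Rightarrow> real) \<Rightarrow> (real \<Rightarrow> real) \<Rightarrow> bool" where
  "skew_path w x l \<longleftrightarrow> continuous_on {0..} w \<and> continuous_on {0..} x \<and> continuous_on {0..} l \<and>
     mono_on {0..} l \<and> l 0 = 0 \<and> x 0 = 0 \<and> w 0 = 0 \<and>
     (\<forall>r t. 0 \<le> r \<longrightarrow> r \<le> t \<longrightarrow> \<bar>(x t - w t) - (x r - w r)\<bar> \<le> l t - l r) \<and>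
     (\<forall>r t. 0 \<le> r \<longrightarrow> r \<le> t \<longrightarrow> (\<forall>s. r \<le> s \<longrightarrow> s \<le> t \<longrightarrow> x s \<noteq> 0) \<longrightarrow> l t = l r)"

lemma skew_pathD:
  assumes "skew_path w x l"
  shows "continuous_on {0..} w" "continuous_on {0..} x" "continuous_on {0..} l" "mono_on {0..} l"
    "l 0 = 0" "x 0 = 0" "w 0 = 0"
    and "\<And>r t. 0 \<le> r \<Longrightarrow> r \<le> t \<Longrightarrow> \<bar>(x t - w t) - (x r - w r)\<bar> \<le> l t - l r"
    and "\<And>r t. 0 \<le> r \<Longrightarrow> r \<le> t \<Longrightarrow> (\<And>s. r \<le> s \<Longrightarrow> s \<le> t \<Longrightarrow> x s \<noteq> 0) \<Longrightarrow> l t = l r"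
    and "\<And>t. 0 \<le> t \<Longrightarrow> 0 \<le> l t"
proof -
  show c: "continuous_on {0..} w" "continuous_on {0..} x" "continuous_on {0..} l" "mono_on {0..} l"
    "l 0 = 0" "x 0 = 0" "w 0 = 0"
    using assms unfolding skew_path_def by - (elim conjE; assumption)+
  have A: "\<forall>r t. 0 \<le> r \<longrightarrow> r \<le> t \<longrightarrow> \<bar>(x t - w t) - (x r - w r)\<bar> \<le> l t - l r"
    and B: "\<forall>r t. 0 \<le> r \<longrightarrow> r \<le> t \<longrightarrow> (\<forall>s. r \<le> s \<longrightarrow> s \<le> t \<longrightarrow> x s \<noteq> 0) \<longrightarrow> l t = l r"
    using assms unfolding skew_path_def by - (elim conjE; assumption)+
  show "\<bar>(x t - w t) - (x r - w r)\<bar> \<le> l t - l r" if "0 \<le> r" "r \<le> t" for r t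
    by (rule A[rule_format, OF that])
  show "l t = l r" if "0 \<le> r" "r \<le> t" "\<And>s. r \<le> s \<Longrightarrow> s \<le> t \<Longrightarrow> x s \<noteq> 0" for r t
    by (rule B[rule_format, OF that])
  show "0 \<le> l t" if "0 \<le> t" for t
    using mono_onD[OF c(4), of 0 t] that c(5) by simp
qed

context
  fixes w x l :: "real \<Rightarrow> real" and r t :: real
  assumes sp: "skew_path w x l" and r: "0 \<le> r" and rt: "r < t"
begin

lemma skew_path_increment:
  shows "\<bar>(x (grid r t n (Suc i)) - w (grid r t n (Suc i))) - (x (grid r t n i) - w (grid r t n i))\<bar> \<le> l (grid r t n (Suc i)) - l (grid r t n i)"
    and "0 \<le> l (grid r t n (Suc i)) - l (grid r t n i)"
proof -
  have g: "0 \<le> grid r t n i" "grid r t n i \<le> grid r t n (Suc i)"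
    using grid_ge[OF rt, of n i] grid_less[OF rt, of n i] r by auto
  then show "\<bar>(x (grid r t n (Suc i)) - w (grid r t n (Suc i))) - (x (grid r t n i) - w (grid r t n i))\<bar> \<le> l (grid r t n (Suc i)) - l (grid r t n i)"
    by (rule skew_pathD(8)[OF sp])
  then show "0 \<le> l (grid r t n (Suc i)) - l (grid r t n i)" by linarith
qed

lemma skew_path_variation:
  "m \<le> Suc n \<Longrightarrow> (\<Sum>i<m. l (grid r t n (Suc i)) - l (grid r t n i)) \<le> l t"
proof -
  assume m: "m \<le> Suc n"
  have "(\<Sum>i<m. l (grid r t n (Suc i)) - l (grid r t n i)) = l (grid r t n m) - l r"
    using sum_lessThan_telescope[of "\<lambda>i. l (grid r t n i)" m] by simp
  moreover have "l (grid r t n m) \<le> l t" "0 \<le> l r"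
    using mono_onD[OF skew_pathD(4)[OF sp], of "grid r t n m" t] skew_pathD(10)[OF sp r] r rt grid_le[OF rt m] grid_ge[OF rt, of n m] by auto
  ultimately show ?thesis by linarith
qed

text \<open>An interval on which \<open>l\<close> increases contains a zero of \<open>x\<close>, so \<open>x\<close> is small at its right end.\<close>

lemma skew_path_small:
  assumes e: "e > 0"
  shows "\<forall>\<^sub>F n in sequentially. \<forall>i<Suc n. let u = grid r t n i; v = grid r t n (Suc i) in
    \<bar>x v - x u\<bar> \<le> e \<and> \<bar>w v - w u\<bar> \<le> e \<and> l v - l u \<le> e \<and> (l v - l u) * \<bar>x v\<bar> \<le> (l v - l u) * e"
proof -
  note c = skew_pathD(1-3)[OF sp]
  show ?thesis
    using grid_uniformly_small[OF c(1) r rt e] grid_uniformly_small[OF c(2) r rt e] grid_uniformly_small[OF c(3) r rt e]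
  proof eventually_elim
    case (elim n)
    show ?case
    proof (intro allI impI)
      fix i assume i: "i < Suc n"
      define u v where "u = grid r t n i" and "v = grid r t n (Suc i)"
      have uv: "u \<in> {u..v}" "v \<in> {u..v}" "0 \<le> u" "u \<le> v"
        using grid_less[OF rt, of n i] grid_ge[OF rt, of n i] r by (auto simp: u_def v_def)
      note E = elim[rule_format, OF i, folded u_def v_def]
      have "(l v - l u) * \<bar>x v\<bar> \<le> (l v - l u) * e"
      proof (cases "\<exists>s\<in>{u..v}. x s = 0")
        case True
        then obtain s where s: "s \<in> {u..v}" "x s = 0" by blast
        have "\<bar>x v\<bar> \<le> e" using E(2)[OF uv(2) s(1)] s(2) by simp
        then show ?thesis
          using skew_path_increment(2)[of n i] by (intro mult_left_mono) (auto simp: u_def v_def)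
      next
        case False
        then have "l v = l u" by (intro skew_pathD(9)[OF sp uv(3,4)]) (simp add: Bex_def)
        then show ?thesis by simp
      qed
      then show "let u = grid r t n i; v = grid r t n (Suc i) in
        \<bar>x v - x u\<bar> \<le> e \<and> \<bar>w v - w u\<bar> \<le> e \<and> l v - l u \<le> e \<and> (l v - l u) * \<bar>x v\<bar> \<le> (l v - l u) * e"
        using E(1)[OF uv(2,1)] E(2)[OF uv(2,1)] E(3)[OF uv(2,1)]
        unfolding Let_def u_def[symmetric] v_def[symmetric] by linarith
    qed
  qed
qed

text \<open>On a fine grid each of the four terms in the inner sum, multiplied by the increment of
  \<open>l\<close>, costs at most \<open>e\<close> times that increment, and the increments add up
  to at most \<open>l t\<close>. The hypothesis is shaped to cover both squared increments and the
  remainder in the expansion of a cosine.\<close>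

lemma skew_path_sum_small:
  assumes a: "\<And>n i. i < Suc n \<Longrightarrow> \<bar>a n i\<bar> \<le> c * ((l (grid r t n (Suc i)) - l (grid r t n i)) *
     (\<bar>x (grid r t n (Suc i)) - x (grid r t n i)\<bar> + \<bar>w (grid r t n (Suc i)) - w (grid r t n i)\<bar> +
      (l (grid r t n (Suc i)) - l (grid r t n i)) + \<bar>x (grid r t n (Suc i))\<bar>))" and c: "c \<ge> 0"
  shows "(\<lambda>n. \<Sum>i<Suc n. \<bar>a n i\<bar> :: real) \<longlonglongrightarrow> 0"
proof (rule LIMSEQ_I)
  fix q :: real assume q: "q > 0"
  have lt: "0 \<le> l t" by (rule skew_pathD(10)[OF sp]) (use r rt in simp)
  \<comment> \<open>The sum will be at most \<open>4 * c * l t * e\<close>; the added 1 keeps the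
    denominator positive when \<open>c\<close> or \<open>l t\<close> is 0 and makes the final
    inequality strict.\<close>
  define e where "e = q / (4 * c * l t + 1)"
  have den: "4 * c * l t + 1 > 0" using c lt by (simp add: add_nonneg_pos)
  have e: "e > 0" unfolding e_def using q den by simp
  have eq: "4 * c * l t * e < q"
  proof -
    have "4 * c * l t * e < (4 * c * l t + 1) * e" using e by simp
    also have "\<dots> = q" unfolding e_def using den by simp
    finally show ?thesis .
  qed
  from skew_path_small[OF e] obtain n0 where n0: "\<And>n. n \<ge> n0 \<Longrightarrow> \<forall>i<Suc n. let u = grid r t n i; v = grid r t n (Suc i) in
    \<bar>x v - x u\<bar> \<le> e \<and> \<bar>w v - w u\<bar> \<le> e \<and> l v - l u \<le> e \<and> (l v - l u) * \<bar>x v\<bar> \<le> (l v - l u) * e"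
    unfolding eventually_sequentially by blast
  have "norm ((\<Sum>i<Suc n. \<bar>a n i\<bar>) - 0) < q" if "n \<ge> n0" for n
  proof -
    have b: "\<bar>a n i\<bar> \<le> (l (grid r t n (Suc i)) - l (grid r t n i)) * (4 * c * e)" if i: "i < Suc n" for i
    proof -
      define u v where "u = grid r t n i" and "v = grid r t n (Suc i)"
      define D where "D = l v - l u"
      have D: "D \<ge> 0" unfolding D_def u_def v_def by (rule skew_path_increment(2))
      have s: "\<bar>x v - x u\<bar> \<le> e" "\<bar>w v - w u\<bar> \<le> e" "D \<le> e" "D * \<bar>x v\<bar> \<le> D * e"
        using n0[OF \<open>n \<ge> n0\<close>, rule_format, OF i] unfolding Let_def u_def v_def D_def
        by - (elim conjE; assumption)+
      have "\<bar>a n i\<bar> \<le> c * (D * (\<bar>x v - x u\<bar> + \<bar>w v - w u\<bar> + D + \<bar>x v\<bar>))"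
        using a[OF i] unfolding D_def u_def v_def .
      also have "D * (\<bar>x v - x u\<bar> + \<bar>w v - w u\<bar> + D + \<bar>x v\<bar>) = D * (\<bar>x v - x u\<bar> + \<bar>w v - w u\<bar> + D) + D * \<bar>x v\<bar>"
        by (simp add: distrib_left)
      also have "\<dots> \<le> D * (3 * e) + D * e"
        by (rule add_mono[OF mult_left_mono s(4)]) (use s D in auto)
      finally have "\<bar>a n i\<bar> \<le> c * (D * (3 * e) + D * e)" using c by (simp add: mult_left_mono)
      also have "\<dots> = D * (4 * c * e)" by (simp add: algebra_simps)
      finally show ?thesis unfolding D_def u_def v_def .
    qed
    have "(\<Sum>i<Suc n. \<bar>a n i\<bar>) \<le> (\<Sum>i<Suc n. (l (grid r t n (Suc i)) - l (grid r t n i)) * (4 * c * e))"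
      by (rule sum_mono) (use b in simp)
    also have "\<dots> = (\<Sum>i<Suc n. l (grid r t n (Suc i)) - l (grid r t n i)) * (4 * c * e)"
      by (simp only: sum_distrib_right)
    also have "\<dots> \<le> l t * (4 * c * e)"
      by (rule mult_right_mono[OF skew_path_variation]) (use c e in auto)
    also have "\<dots> < q" using eq by (simp add: mult_ac)
    finally show ?thesis by (simp add: sum_nonneg)
  qed
  then show "\<exists>n0. \<forall>n\<ge>n0. norm ((\<Sum>i<Suc n. \<bar>a n i\<bar>) - 0) < q" by blast
qed

end

text \<open>Approximates a time by values in a countable set; used to pass from countably many times
  to all times and to obtain joint measurability.\<close>

lemma scaled_floor_tendsto:
  fixes t :: real shows "(\<lambda>n. real_of_int \<lfloor>t * real (Suc n)\<rfloor> / real (Suc n)) \<longlonglongrightarrow> t"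
proof (rule real_tendsto_sandwich)
  show "\<forall>\<^sub>F n in sequentially. t - 1 / real (Suc n) \<le> real_of_int \<lfloor>t * real (Suc n)\<rfloor> / real (Suc n)"
  proof (intro always_eventually allI)
    fix n
    have "(t * real (Suc n) - 1) / real (Suc n) \<le> real_of_int \<lfloor>t * real (Suc n)\<rfloor> / real (Suc n)"
      by (intro divide_right_mono) linarith+
    then show "t - 1 / real (Suc n) \<le> real_of_int \<lfloor>t * real (Suc n)\<rfloor> / real (Suc n)" by (simp add: diff_divide_distrib)
  qed
  show "\<forall>\<^sub>F n in sequentially. real_of_int \<lfloor>t * real (Suc n)\<rfloor> / real (Suc n) \<le> t"
  proof (intro always_eventually allI)
    fix n
    have "real_of_int \<lfloor>t * real (Suc n)\<rfloor> / real (Suc n) \<le> (t * real (Suc n)) / real (Suc n)"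
      by (intro divide_right_mono) linarith+
    then show "real_of_int \<lfloor>t * real (Suc n)\<rfloor> / real (Suc n) \<le> t" by simp
  qed
  have "(\<lambda>n. t - 1 / real (Suc n)) \<longlonglongrightarrow> t - 0"
    by (intro tendsto_diff tendsto_const LIMSEQ_Suc lim_1_over_n)
  then show "(\<lambda>n. t - 1 / real (Suc n)) \<longlonglongrightarrow> t" by simp
qed (rule tendsto_const)

section \<open>The bracket of the solution is time\<close>

locale skew_paths = brownian_filtered M F W for M :: "'a measure" and F W +
  fixes X L :: "real \<Rightarrow> 'a \<Rightarrow> real"
  assumes X_adapted: "0 \<le> t \<Longrightarrow> X t \<in> borel_measurable (F t)"
    and L_measurable[measurable]: "0 \<le> t \<Longrightarrow> L t \<in> borel_measurable M"
    and paths: "AE \<omega> in M. skew_path (\<lambda>s. W s \<omega>) (\<lambda>s. X s \<omega>) (\<lambda>s. L s \<omega>)"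
begin

lemma X_measurable_F: "0 \<le> t \<Longrightarrow> t \<le> u \<Longrightarrow> X t \<in> borel_measurable (F u)"
  using X_adapted measurable_F_mono by blast

lemma X_measurable[measurable]: "0 \<le> t \<Longrightarrow> X t \<in> borel_measurable M"
  using X_adapted measurable_F_M by blast

text \<open>On each cell the squared increments of \<open>X\<close> and \<open>W\<close> differ by
  the product of their difference, which is the drift, and their sum; these products add up to
  something that vanishes pathwise. The squares of \<open>W\<close> converge to \<open>t\<close> in
  mean square, those of \<open>X\<close> to \<open>Q t\<close> in probability. The three limits are
  compared through means of \<open>min 1\<close>, which metrise convergence in probability.\<close>

lemma quadratic_variation_eq_time_single:
  assumes Q: "quadratic_variation M X Q" and t: "t > 0"
  shows "AE \<omega> in M. Q t \<omega> = t"
proof -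
  define S where "S n \<omega> = (\<Sum>i<Suc n. (X (grid 0 t n (Suc i)) \<omega> - X (grid 0 t n i) \<omega>)\<^sup>2)" for n \<omega>
  define B where "B n \<omega> = (\<Sum>i<Suc n. (W (grid 0 t n (Suc i)) \<omega> - W (grid 0 t n i) \<omega>)\<^sup>2 - (grid 0 t n (Suc i) - grid 0 t n i))" for n \<omega>
  have g0: "0 \<le> grid 0 t n i" for n i by (rule grid_ge[OF t])
  have [measurable]: "S n \<in> borel_measurable M" "B n \<in> borel_measurable M" for n
    unfolding S_def[abs_def] B_def[abs_def] using g0 by measurable
  have [measurable]: "Q t \<in> borel_measurable M" using Q[unfolded quadratic_variation_def, THEN conjunct1, rule_format, of t] t by simp
  have Bt: "B n \<omega> = (\<Sum>i<Suc n. (W (grid 0 t n (Suc i)) \<omega> - W (grid 0 t n i) \<omega>)\<^sup>2) - t" for n \<omega>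
  proof -
    have "(\<Sum>i<Suc n. grid 0 t n (Suc i) - grid 0 t n i) = t"
      using sum_lessThan_telescope[of "grid 0 t n" "Suc n"] by (simp only: grid_end grid_0 diff_0_right)
    then show ?thesis unfolding B_def by (subst sum_subtractf) (simp only:)
  qed
  have bi: "integrable M (\<lambda>\<omega>. min 1 \<bar>f \<omega>\<bar>)" if "f \<in> borel_measurable M" for f :: "'a \<Rightarrow> real"
    using that by (intro integrable_const_bound[of _ 1]) auto
  have 1: "(\<lambda>n. LINT \<omega>|M. min 1 \<bar>S n \<omega> - Q t \<omega>\<bar>) \<longlonglongrightarrow> 0"
  proof (rule LIMSEQ_I)
    fix e :: real assume e: "e > 0"
    have "(\<lambda>n. prob {\<omega>\<in>space M. \<bar>S n \<omega> - Q t \<omega>\<bar> > e / 2}) \<longlonglongrightarrow> 0"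
    proof -
      have "is_subdivision t (Suc n) (grid 0 t n)" for n
        unfolding is_subdivision_def using grid_less[OF t] by (auto intro: less_imp_le)
      moreover have "\<forall>d>0. \<forall>\<^sub>F n in sequentially. \<forall>i<Suc n. grid 0 t n (Suc i) - grid 0 t n i < d"
      proof (intro allI impI)
        fix d :: real assume "d > 0"
        from grid_mesh[OF this, of t 0] show "\<forall>\<^sub>F n in sequentially. \<forall>i<Suc n. grid 0 t n (Suc i) - grid 0 t n i < d"
          by eventually_elim (simp only: grid_diff simp_thms)
      qed
      ultimately show ?thesis
        using Q[unfolded quadratic_variation_def, THEN conjunct2, THEN conjunct2, THEN conjunct2, rule_format, of t Suc "grid 0 t" "e / 2"] t e
        unfolding S_def by simp
    qed
    from order_tendstoD(2)[OF this, of "e / 2"] e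
    have "\<forall>\<^sub>F n in sequentially. prob {\<omega>\<in>space M. \<bar>S n \<omega> - Q t \<omega>\<bar> > e / 2} < e / 2" by simp
    then obtain n0 where n0: "\<And>n. n \<ge> n0 \<Longrightarrow> prob {\<omega>\<in>space M. \<bar>S n \<omega> - Q t \<omega>\<bar> > e / 2} < e / 2"
      unfolding eventually_sequentially by blast
    have "norm ((LINT \<omega>|M. min 1 \<bar>S n \<omega> - Q t \<omega>\<bar>) - 0) < e" if "n \<ge> n0" for n
    proof -
      define A where "A = {\<omega>\<in>space M. \<bar>S n \<omega> - Q t \<omega>\<bar> > e / 2}"
      have A: "A \<in> events" unfolding A_def by measurable
      then have iA: "integrable M (indicator A :: 'a \<Rightarrow> real)" by (simp add: emeasure_eq_measure)
      have "(LINT \<omega>|M. min 1 \<bar>S n \<omega> - Q t \<omega>\<bar>) \<le> (LINT \<omega>|M. e / 2 + indicator A \<omega>)"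
      proof (intro integral_mono bi Bochner_Integration.integrable_add iA)
        fix \<omega> assume "\<omega> \<in> space M"
        then show "min 1 \<bar>S n \<omega> - Q t \<omega>\<bar> \<le> e / 2 + indicator A \<omega>"
          using e by (cases "\<omega> \<in> A") (auto simp: A_def min_def)
      qed auto
      also have "\<dots> = e / 2 + prob A"
        using iA A by (simp add: prob_space)
      also have "\<dots> < e" using n0[OF that] unfolding A_def by simp
      finally have "(LINT \<omega>|M. min 1 \<bar>S n \<omega> - Q t \<omega>\<bar>) < e" .
      moreover have "0 \<le> (LINT \<omega>|M. min 1 \<bar>S n \<omega> - Q t \<omega>\<bar>)" by (rule Bochner_Integration.integral_nonneg) simp
      ultimately show ?thesis by simp
    qed
    then show "\<exists>n0. \<forall>n\<ge>n0. norm ((LINT \<omega>|M. min 1 \<bar>S n \<omega> - Q t \<omega>\<bar>) - 0) < e" by blast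
  qed
  have 2: "(\<lambda>n. LINT \<omega>|M. min 1 \<bar>B n \<omega>\<bar>) \<longlonglongrightarrow> 0"
  proof (rule LIMSEQ_I)
    fix e :: real assume e: "e > 0"
    \<comment> \<open>The factor \<open>4 * t\<^sup>2 / e\<close> is \<open>2 / e\<close>, from the
      bound \<open>\<bar>y\<bar> \<le> e / 2 + 2 / e * y\<^sup>2\<close> below, times the
      \<open>2 * t\<^sup>2\<close> in the second moment of \<open>B n\<close>.\<close>
    have "(\<lambda>n. (4 * t\<^sup>2 / e) / real (Suc n)) \<longlonglongrightarrow> 0"
      by (rule real_tendsto_divide_at_top[OF tendsto_const filterlim_compose[OF filterlim_real_sequentially filterlim_Suc]])
    from order_tendstoD(2)[OF this, of "e / 2"] e
    have "\<forall>\<^sub>F n in sequentially. (4 * t\<^sup>2 / e) / real (Suc n) < e / 2" by simp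
    then obtain n0 where n0: "\<And>n. n \<ge> n0 \<Longrightarrow> (4 * t\<^sup>2 / e) / real (Suc n) < e / 2"
      unfolding eventually_sequentially by blast
    have "norm ((LINT \<omega>|M. min 1 \<bar>B n \<omega>\<bar>) - 0) < e" if "n \<ge> n0" for n
    proof -
      have q2: "integrable M (\<lambda>\<omega>. (B n \<omega>)\<^sup>2)"
        unfolding B_def by (rule quadratic_sum_L2(2)[of "grid 0 t n", OF g0 grid_less[OF t]])
      have "(LINT \<omega>|M. (B n \<omega>)\<^sup>2) = (\<Sum>i<Suc n. 2 * (grid 0 t n (Suc i) - grid 0 t n i)\<^sup>2)"
        unfolding B_def by (rule quadratic_sum_L2(3)[of "grid 0 t n", OF g0 grid_less[OF t]])
      also have "\<dots> = real (Suc n) * (2 * (t / real (Suc n))\<^sup>2)"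
        by (simp only: grid_diff sum_constant card_lessThan diff_0_right)
      also have "\<dots> = 2 * t\<^sup>2 / real (Suc n)"
      proof -
        have "k * (2 * (t / k)\<^sup>2) = 2 * t\<^sup>2 / k" if "k > 0" for k :: real
          using that by (simp add: power2_eq_square)
        then show ?thesis by (simp only: of_nat_0_less_iff zero_less_Suc)
      qed
      finally have "(LINT \<omega>|M. (B n \<omega>)\<^sup>2) = 2 * t\<^sup>2 / real (Suc n)" .
      moreover have "(LINT \<omega>|M. min 1 \<bar>B n \<omega>\<bar>) \<le> (LINT \<omega>|M. e / 2 + 2 / e * (B n \<omega>)\<^sup>2)"
      proof (intro integral_mono bi)
        show "integrable M (\<lambda>\<omega>. e / 2 + 2 / e * (B n \<omega>)\<^sup>2)" using q2 by simp
        fix \<omega>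
        have "\<bar>y\<bar> \<le> e / 2 + 2 / e * y\<^sup>2" for y :: real
        proof (cases "\<bar>y\<bar> \<le> e / 2")
          case True
          then show ?thesis using e by (simp add: add_increasing2)
        next
          case False
          then have "e / 2 * \<bar>y\<bar> \<le> \<bar>y\<bar> * \<bar>y\<bar>" by (intro mult_right_mono) auto
          then have "\<bar>y\<bar> \<le> 2 / e * y\<^sup>2" using e by (simp add: field_simps power2_eq_square)
          then show ?thesis using e by simp
        qed
        then show "min 1 \<bar>B n \<omega>\<bar> \<le> e / 2 + 2 / e * (B n \<omega>)\<^sup>2" by (simp add: min.coboundedI2)
      qed measurable
      moreover have "(LINT \<omega>|M. e / 2 + 2 / e * (B n \<omega>)\<^sup>2) = e / 2 + 2 / e * (LINT \<omega>|M. (B n \<omega>)\<^sup>2)"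
        using q2 by (simp add: prob_space)
      ultimately have "(LINT \<omega>|M. min 1 \<bar>B n \<omega>\<bar>) \<le> e / 2 + (4 * t\<^sup>2 / e) / real (Suc n)" by simp
      moreover have "0 \<le> (LINT \<omega>|M. min 1 \<bar>B n \<omega>\<bar>)" by (rule Bochner_Integration.integral_nonneg) simp
      ultimately show ?thesis using n0[OF that] by simp
    qed
    then show "\<exists>n0. \<forall>n\<ge>n0. norm ((LINT \<omega>|M. min 1 \<bar>B n \<omega>\<bar>) - 0) < e" by blast
  qed
  have 3: "(\<lambda>n. LINT \<omega>|M. min 1 \<bar>S n \<omega> - (B n \<omega> + t)\<bar>) \<longlonglongrightarrow> (LINT \<omega>|M. 0)"
  proof (rule integral_dominated_convergence[where w="\<lambda>_. 1"])
    show "AE \<omega> in M. (\<lambda>n. min 1 \<bar>S n \<omega> - (B n \<omega> + t)\<bar>) \<longlonglongrightarrow> 0"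
      using paths
    proof eventually_elim
      case (elim \<omega>)
      define a where "a n i = (X (grid 0 t n (Suc i)) \<omega> - X (grid 0 t n i) \<omega>)\<^sup>2 - (W (grid 0 t n (Suc i)) \<omega> - W (grid 0 t n i) \<omega>)\<^sup>2" for n i
      have "(\<lambda>n. \<Sum>i<Suc n. \<bar>a n i\<bar>) \<longlonglongrightarrow> 0"
      proof (rule skew_path_sum_small[OF elim order_refl t, of a 1])
        fix n i
        define dx dw dl where "dx = X (grid 0 t n (Suc i)) \<omega> - X (grid 0 t n i) \<omega>" and "dw = W (grid 0 t n (Suc i)) \<omega> - W (grid 0 t n i) \<omega>"
          and "dl = L (grid 0 t n (Suc i)) \<omega> - L (grid 0 t n i) \<omega>"
        have "\<bar>dx - dw\<bar> \<le> dl" "0 \<le> dl"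
          using skew_path_increment[OF elim order_refl t, of n i] by (auto simp: dx_def dw_def dl_def)
        have "a n i = (dx - dw) * (dx + dw)" by (simp add: a_def dx_def dw_def power2_eq_square algebra_simps)
        then have "\<bar>a n i\<bar> = \<bar>dx - dw\<bar> * \<bar>dx + dw\<bar>" by (simp add: abs_mult)
        also have "\<dots> \<le> dl * (\<bar>dx\<bar> + \<bar>dw\<bar> + dl + \<bar>X (grid 0 t n (Suc i)) \<omega>\<bar>)"
          using \<open>\<bar>dx - dw\<bar> \<le> dl\<close> \<open>0 \<le> dl\<close> by (intro mult_mono) auto
        finally show "\<bar>a n i\<bar> \<le> 1 * (dl * (\<bar>dx\<bar> + \<bar>dw\<bar> + dl + \<bar>X (grid 0 t n (Suc i)) \<omega>\<bar>))" by simp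
      qed simp
      then show ?case
      proof (rule Lim_null_comparison[rotated], intro always_eventually allI)
        fix n
        have "S n \<omega> - (B n \<omega> + t) = (\<Sum>i<Suc n. a n i)"
          unfolding Bt S_def a_def sum_subtractf by simp
        then show "norm (min 1 \<bar>S n \<omega> - (B n \<omega> + t)\<bar>) \<le> (\<Sum>i<Suc n. \<bar>a n i\<bar>)"
          using order_trans[OF _ sum_abs[of "a n" "{..<Suc n}"], of "norm (min 1 \<bar>\<Sum>i<Suc n. a n i\<bar>)"]
          by (simp del: sum.lessThan_Suc)
      qed
    qed
  qed auto
  have lim: "(\<lambda>n. (LINT \<omega>|M. min 1 \<bar>S n \<omega> - Q t \<omega>\<bar>) + (LINT \<omega>|M. min 1 \<bar>B n \<omega>\<bar>) + (LINT \<omega>|M. min 1 \<bar>S n \<omega> - (B n \<omega> + t)\<bar>)) \<longlonglongrightarrow> 0"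
    using tendsto_add[OF tendsto_add[OF 1 2] 3] by simp
  have le: "(LINT \<omega>|M. min 1 \<bar>Q t \<omega> - t\<bar>) \<le> (LINT \<omega>|M. min 1 \<bar>S n \<omega> - Q t \<omega>\<bar>) + (LINT \<omega>|M. min 1 \<bar>B n \<omega>\<bar>) + (LINT \<omega>|M. min 1 \<bar>S n \<omega> - (B n \<omega> + t)\<bar>)" for n
  proof -
    have "(LINT \<omega>|M. min 1 \<bar>Q t \<omega> - t\<bar>) \<le> (LINT \<omega>|M. min 1 \<bar>S n \<omega> - Q t \<omega>\<bar> + min 1 \<bar>B n \<omega>\<bar> + min 1 \<bar>S n \<omega> - (B n \<omega> + t)\<bar>)"
    proof (rule integral_mono)
      show "integrable M (\<lambda>\<omega>. min 1 \<bar>Q t \<omega> - t\<bar>)" by (rule bi) measurable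
      show "integrable M (\<lambda>\<omega>. min 1 \<bar>S n \<omega> - Q t \<omega>\<bar> + min 1 \<bar>B n \<omega>\<bar> + min 1 \<bar>S n \<omega> - (B n \<omega> + t)\<bar>)"
        by (intro Bochner_Integration.integrable_add bi) measurable
      fix \<omega>
      have "min 1 \<bar>q - t\<bar> \<le> min 1 \<bar>a - q\<bar> + min 1 \<bar>b\<bar> + min 1 \<bar>a - (b + t)\<bar>" for q a b :: real
      proof -
        have "min 1 x \<le> min 1 p + min 1 q + min 1 r" if "x \<le> p + q + r" "0 \<le> p" "0 \<le> q" "0 \<le> r" for x p q r :: real
          using that by (auto simp: min_def)
        moreover have "\<bar>q - t\<bar> \<le> \<bar>a - q\<bar> + \<bar>b\<bar> + \<bar>a - (b + t)\<bar>" by linarith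
        ultimately show ?thesis by simp
      qed
      then show "min 1 \<bar>Q t \<omega> - t\<bar> \<le> min 1 \<bar>S n \<omega> - Q t \<omega>\<bar> + min 1 \<bar>B n \<omega>\<bar> + min 1 \<bar>S n \<omega> - (B n \<omega> + t)\<bar>" .
    qed
    also have "\<dots> = (LINT \<omega>|M. min 1 \<bar>S n \<omega> - Q t \<omega>\<bar>) + (LINT \<omega>|M. min 1 \<bar>B n \<omega>\<bar>) + (LINT \<omega>|M. min 1 \<bar>S n \<omega> - (B n \<omega> + t)\<bar>)"
      by (simp add: bi)
    finally show ?thesis .
  qed
  have "(LINT \<omega>|M. min 1 \<bar>Q t \<omega> - t\<bar>) \<le> 0"
    by (rule tendsto_lowerbound[OF lim always_eventually[OF allI[OF le]] sequentially_bot])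
  moreover have nn: "0 \<le> (LINT \<omega>|M. min 1 \<bar>Q t \<omega> - t\<bar>)" by (rule Bochner_Integration.integral_nonneg) simp
  ultimately have "(LINT \<omega>|M. min 1 \<bar>Q t \<omega> - t\<bar>) = 0" by (rule order.antisym)
  then have "AE \<omega> in M. min 1 \<bar>Q t \<omega> - t\<bar> = 0"
    by (rule integral_nonneg_eq_0_iff_AE[THEN iffD1, rotated -1]) (simp_all add: bi)
  then show ?thesis by eventually_elim (simp add: min_def split: if_splits)
qed

text \<open>Exceptional null sets can be united only over countably many times, so the identity is
  first obtained at fractions and then extended by continuity of \<open>Q\<close>.\<close>

lemma quadratic_variation_eq_time:
  assumes Q: "quadratic_variation M X Q"
  shows "AE \<omega> in M. \<forall>t\<ge>0. Q t \<omega> = t"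
proof -
  have "AE \<omega> in M. \<forall>k n. Q (real (Suc k) / real (Suc n)) \<omega> = real (Suc k) / real (Suc n)"
    unfolding AE_all_countable by (intro allI quadratic_variation_eq_time_single[OF Q]) simp
  moreover have "AE \<omega> in M. continuous_on {0..} (\<lambda>t. Q t \<omega>)" "AE \<omega> in M. Q 0 \<omega> = 0 \<and> mono_on {0..} (\<lambda>t. Q t \<omega>)"
    using Q unfolding quadratic_variation_def continuous_process_def by - (elim conjE; assumption)+
  ultimately show ?thesis
  proof eventually_elim
    case (elim \<omega>)
    \<comment> \<open>Positive numerators come from the shifted index; for \<open>k = 0\<close> the
      value is the initial condition of the bracket.\<close>
    have q: "Q (real k / real (Suc n)) \<omega> = real k / real (Suc n)" for k n
      using elim(1)[rule_format, of "k - 1" n] elim(3) by (cases k) auto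
    show ?case
    proof (intro allI impI)
      fix t :: real assume t: "0 \<le> t"
      define u where "u n = real_of_int \<lfloor>t * real (Suc n)\<rfloor> / real (Suc n)" for n
      have u: "u n = real (nat \<lfloor>t * real (Suc n)\<rfloor>) / real (Suc n)" for n
        unfolding u_def using t by simp
      have ut: "u \<longlonglongrightarrow> t" unfolding u_def by (rule scaled_floor_tendsto)
      have nn: "u n \<in> {0..}" for n
        unfolding atLeast_iff u by (intro divide_nonneg_nonneg of_nat_0_le_iff)
      have "(\<lambda>n. Q (u n) \<omega>) \<longlonglongrightarrow> Q t \<omega>"
        by (rule continuous_on_tendsto_compose[OF elim(2) ut _ always_eventually[OF allI[OF nn]]]) (use t in simp)
      moreover have "(\<lambda>n. Q (u n) \<omega>) = u" by (intro ext) (simp only: u q)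
      ultimately have "u \<longlonglongrightarrow> Q t \<omega>" by (simp only:)
      then show "Q t \<omega> = t" using ut by (rule LIMSEQ_unique)
    qed
  qed
qed

end

section \<open>Discretised phases and the effect of the drift on one step\<close>

text \<open>\<open>P\<close> can only turn from true to false, so the sum telescopes up to the index
  where it stops and equals \<open>g k - g 0\<close> for some \<open>k\<close>. This bounds a
  stopped sum independently of the number of cells.\<close>

lemma truncated_telescope_bound:
  fixes g :: "nat \<Rightarrow> real"
  assumes P: "\<And>i. P (Suc i) \<Longrightarrow> P i" and g: "\<And>i. i \<le> n \<Longrightarrow> \<bar>g i\<bar> \<le> C"
  shows "\<bar>\<Sum>i<n. if P i then g (Suc i) - g i else 0\<bar> \<le> 2 * C"
proof -
  have "\<exists>k\<le>m. (\<Sum>i<m. if P i then g (Suc i) - g i else 0) = g k - g 0 \<and> (P m \<longrightarrow> k = m)" for m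
  proof (induction m)
    case (Suc m)
    then obtain k where k: "k \<le> m" "(\<Sum>i<m. if P i then g (Suc i) - g i else 0) = g k - g 0" "P m \<longrightarrow> k = m" by blast
    show ?case
    proof (cases "P m")
      case True
      then show ?thesis using k by (intro exI[of _ "Suc m"]) auto
    next
      case False
      then show ?thesis using k P[of m] by (intro exI[of _ k]) auto
    qed
  qed simp
  then obtain k where k: "k \<le> n" "(\<Sum>i<n. if P i then g (Suc i) - g i else 0) = g k - g 0" by blast
  then show ?thesis using g[of k] g[of 0] by simp
qed

lemma truncated_sum_bound:
  fixes a :: "nat \<Rightarrow> real"
  assumes a: "\<And>i. 0 \<le> a i" and k: "0 \<le> k"
  shows "(\<Sum>i<n. if (\<Sum>j<i. a j) \<le> k then min 1 (a i) else 0) \<le> k + 1"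
proof -
  have "(\<Sum>i<n. if (\<Sum>j<i. a j) \<le> k then min 1 (a i) else 0) \<le> k + 1 \<and>
     (\<Sum>i<n. if (\<Sum>j<i. a j) \<le> k then min 1 (a i) else 0) \<le> (\<Sum>j<n. a j)"
  proof (induction n)
    case (Suc n)
    then show ?case using a[of n] by (auto simp: min_def)
  qed (use k in auto)
  then show ?thesis ..
qed

text \<open>The function \<open>h\<close> has slope
  \<open>- l * (sin (l * z + \<theta>) - sin \<theta>)\<close>, of size at most
  \<open>l\<^sup>2 * \<bar>z\<bar>\<close>, and points between \<open>x - v\<close> and
  \<open>x\<close> have modulus at most \<open>\<bar>x\<bar> + \<bar>v\<bar>\<close>. Comparing
  slopes with the one at 0, rather than at \<open>x\<close>, produces the factor
  \<open>\<bar>x\<bar>\<close>, which is small whenever the drift moves.\<close>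

lemma cos_diff_bound:
  fixes l x v \<theta> :: real
  shows "\<bar>cos (l * x + \<theta>) - cos (l * (x - v) + \<theta>) + l * v * sin \<theta>\<bar> \<le> l\<^sup>2 * (\<bar>v\<bar> * (\<bar>x\<bar> + \<bar>v\<bar>))"
proof -
  define h where "h z = cos (l * z + \<theta>) + l * z * sin \<theta>" for z
  have d: "(h has_real_derivative (- l * (sin (l * z + \<theta>) - sin \<theta>))) (at z)" for z
    unfolding h_def by (auto intro!: derivative_eq_intros simp: algebra_simps)
  have sl: "\<bar>sin a - sin b\<bar> \<le> \<bar>a - b\<bar>" for a b :: real
  proof -
    have "norm (sin a - sin b) \<le> 1 * norm (a - b)"
      by (rule field_differentiable_bound[of UNIV sin cos 1]) (auto intro!: derivative_eq_intros)
    then show ?thesis by simp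
  qed
  have "norm (h x - h (x - v)) \<le> (l\<^sup>2 * (\<bar>x\<bar> + \<bar>v\<bar>)) * norm (x - (x - v))"
  proof (rule field_differentiable_bound[of "closed_segment (x - v) x" h "\<lambda>z. - l * (sin (l * z + \<theta>) - sin \<theta>)"])
    fix z assume z: "z \<in> closed_segment (x - v) x"
    show "(h has_field_derivative - l * (sin (l * z + \<theta>) - sin \<theta>)) (at z within closed_segment (x - v) x)"
      using d[of z] by (rule has_field_derivative_at_within)
    have "\<bar>z\<bar> \<le> \<bar>x\<bar> + \<bar>v\<bar>" using z by (auto simp: closed_segment_eq_real_ivl split: if_splits)
    have "\<bar>- l * (sin (l * z + \<theta>) - sin \<theta>)\<bar> = \<bar>l\<bar> * \<bar>sin (l * z + \<theta>) - sin \<theta>\<bar>" by (simp add: abs_mult)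
    also have "\<dots> \<le> \<bar>l\<bar> * \<bar>l * z\<bar>" using sl[of "l * z + \<theta>" \<theta>] by (intro mult_left_mono) auto
    also have "\<dots> = l\<^sup>2 * \<bar>z\<bar>" by (simp add: abs_mult power2_eq_square)
    also have "\<dots> \<le> l\<^sup>2 * (\<bar>x\<bar> + \<bar>v\<bar>)" using \<open>\<bar>z\<bar> \<le> \<bar>x\<bar> + \<bar>v\<bar>\<close> by (intro mult_left_mono) auto
    finally show "norm (- l * (sin (l * z + \<theta>) - sin \<theta>)) \<le> l\<^sup>2 * (\<bar>x\<bar> + \<bar>v\<bar>)" by simp
  qed auto
  moreover have "h x - h (x - v) = cos (l * x + \<theta>) - cos (l * (x - v) + \<theta>) + l * v * sin \<theta>"
    unfolding h_def by (simp add: algebra_simps)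
  ultimately show ?thesis by (simp add: mult_ac)
qed

lemma cos_diff_bound_linear:
  fixes l x v \<theta> :: real
  shows "\<bar>cos (l * x + \<theta>) - cos (l * (x - v) + \<theta>)\<bar> \<le> \<bar>l\<bar> * \<bar>v\<bar>"
proof -
  have "norm (cos (l * x + \<theta>) - cos (l * (x - v) + \<theta>)) \<le> 1 * norm ((l * x + \<theta>) - (l * (x - v) + \<theta>))"
    by (rule field_differentiable_bound[of UNIV cos "\<lambda>x. - sin x" 1]) (auto intro!: derivative_eq_intros)
  then show ?thesis by (simp add: abs_mult[symmetric] algebra_simps)
qed

context skew_paths
begin

definition V :: "real \<Rightarrow> 'a \<Rightarrow> real" where "V t \<omega> = X t \<omega> - W t \<omega>"

lemma V_measurable_F: "0 \<le> t \<Longrightarrow> t \<le> u \<Longrightarrow> V t \<in> borel_measurable (F u)"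
  unfolding V_def[abs_def] by (intro borel_measurable_diff X_measurable_F W_measurable_F)

context
  fixes r t l \<theta> :: real
  assumes r: "0 \<le> r" and rt: "r < t"
begin

definition dV :: "nat \<Rightarrow> nat \<Rightarrow> 'a \<Rightarrow> real" where
  "dV n i \<omega> = V (grid r t n (Suc i)) \<omega> - V (grid r t n i) \<omega>"

text \<open>The exponential factor compensates the decay of the mean cosine under a Brownian step,
  so a path moved by \<open>W\<close> alone would keep this mean constant.\<close>

definition phase :: "nat \<Rightarrow> nat \<Rightarrow> 'a \<Rightarrow> real" where
  "phase n i \<omega> = exp (l\<^sup>2 * grid r t n i / 2) * cos (l * X (grid r t n i) \<omega> + \<theta>)"

text \<open>\<open>X\<close> at the right end minus \<open>dV\<close> is the left position moved by
  the Brownian increment alone, so this is the part of the phase change that is due to the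
  drift.\<close>

definition jump :: "nat \<Rightarrow> nat \<Rightarrow> 'a \<Rightarrow> real" where
  "jump n i \<omega> = exp (l\<^sup>2 * grid r t n (Suc i) / 2) *
     (cos (l * X (grid r t n (Suc i)) \<omega> + \<theta>) - cos (l * (X (grid r t n (Suc i)) \<omega> - dV n i \<omega>) + \<theta>))"

definition bigC :: real where "bigC = exp (l\<^sup>2 * t / 2)"

lemma grid_nonneg: "0 \<le> grid r t n i"
  using grid_ge[OF rt, of n i] r by simp

lemma exp_grid_le: "i \<le> Suc n \<Longrightarrow> exp (l\<^sup>2 * grid r t n i / 2) \<le> bigC"
  unfolding bigC_def using grid_le[OF rt, of i n] by (simp add: mult_left_mono divide_right_mono)

lemma dV_measurable_F: "Suc i \<le> j \<Longrightarrow> dV n i \<in> borel_measurable (F (grid r t n j))"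
  unfolding dV_def[abs_def]
  by (intro borel_measurable_diff V_measurable_F grid_nonneg grid_mono[OF rt]) auto

lemma dV_measurable[measurable]: "dV n i \<in> borel_measurable M"
  by (rule measurable_F_M[OF dV_measurable_F[OF order_refl]])

lemma phase_measurable[measurable]: "phase n i \<in> borel_measurable M"
  unfolding phase_def[abs_def] using grid_nonneg by measurable

lemma jump_measurable[measurable]: "jump n i \<in> borel_measurable M"
  unfolding jump_def[abs_def] using grid_nonneg by measurable

lemma phase_bound: "i \<le> Suc n \<Longrightarrow> \<bar>phase n i \<omega>\<bar> \<le> bigC"
  unfolding phase_def using mult_mono[OF exp_grid_le abs_cos_le_one] by (simp add: abs_mult bigC_def)

lemma jump_bound: "i < Suc n \<Longrightarrow> \<bar>jump n i \<omega>\<bar> \<le> bigC * (\<bar>l\<bar> * \<bar>dV n i \<omega>\<bar>)" "i < Suc n \<Longrightarrow> \<bar>jump n i \<omega>\<bar> \<le> 2 * bigC"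
proof -
  assume "i < Suc n"
  then have i: "exp (l\<^sup>2 * grid r t n (Suc i) / 2) \<le> bigC" by (intro exp_grid_le) simp
  let ?d = "cos (l * X (grid r t n (Suc i)) \<omega> + \<theta>) - cos (l * (X (grid r t n (Suc i)) \<omega> - dV n i \<omega>) + \<theta>)"
  have "\<bar>?d\<bar> \<le> 2"
    using abs_cos_le_one[of "l * X (grid r t n (Suc i)) \<omega> + \<theta>"] abs_cos_le_one[of "l * (X (grid r t n (Suc i)) \<omega> - dV n i \<omega>) + \<theta>"] by linarith
  have j: "\<bar>jump n i \<omega>\<bar> = exp (l\<^sup>2 * grid r t n (Suc i) / 2) * \<bar>?d\<bar>" unfolding jump_def by (simp add: abs_mult)
  show "\<bar>jump n i \<omega>\<bar> \<le> bigC * (\<bar>l\<bar> * \<bar>dV n i \<omega>\<bar>)"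
    unfolding j by (rule mult_mono[OF i cos_diff_bound_linear]) (auto simp: bigC_def)
  have "\<bar>jump n i \<omega>\<bar> \<le> bigC * 2"
    unfolding j by (rule mult_mono[OF i \<open>\<bar>?d\<bar> \<le> 2\<close>]) (auto simp: bigC_def)
  then show "\<bar>jump n i \<omega>\<bar> \<le> 2 * bigC" by simp
qed

text \<open>Over one grid step, only the finite variation part moves the mean of the weighted phase.\<close>

lemma phase_step:
  assumes p: "p \<in> borel_measurable (F (grid r t n i))" and pb: "\<And>\<omega>. \<bar>p \<omega>\<bar> \<le> (c::real)" and i: "i < Suc n"
  shows "(LINT \<omega>|M. p \<omega> * (phase n (Suc i) \<omega> - phase n i \<omega>)) = (LINT \<omega>|M. p \<omega> * jump n i \<omega>)"
proof -
  define u v where "u = grid r t n i" and "v = grid r t n (Suc i)"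
  have u: "0 \<le> u" and uv: "u < v" using grid_nonneg grid_less[OF rt] by (auto simp: u_def v_def)
  have [measurable]: "p \<in> borel_measurable M" by (rule measurable_F_M[OF p])
  have c0: "c \<ge> 0" using pb[of undefined] by linarith
  have pi: "integrable M (\<lambda>\<omega>. p \<omega> * h \<omega>)" if [measurable]: "h \<in> borel_measurable M" and "\<And>\<omega>. \<bar>h \<omega>\<bar> \<le> b" for h b
    by (rule integrable_const_bound[where B="c * b", OF AE_I2]) (use that pb in \<open>auto simp: abs_mult intro!: mult_mono c0\<close>)
  have Xu: "X u \<in> borel_measurable (F u)" using X_adapted[OF u] .
  have [measurable]: "X u \<in> borel_measurable M" "W u \<in> borel_measurable M" "W v \<in> borel_measurable M" "X v \<in> borel_measurable M" using u uv by auto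
  \<comment> \<open>The phase that the Brownian increment alone would produce. By
    \<open>cos_one_step\<close> its weighted mean is that of the phase before the step, and
    \<open>jump\<close> is what remains.\<close>
  define f where "f \<omega> = exp (l\<^sup>2 * v / 2) * cos (l * (X u \<omega> + (W v \<omega> - W u \<omega>)) + \<theta>)" for \<omega>
  have [measurable]: "f \<in> borel_measurable M" unfolding f_def by measurable
  have fi: "integrable M (\<lambda>\<omega>. p \<omega> * f \<omega>)"
    by (rule pi[of _ "exp (l\<^sup>2 * v / 2)"]) (auto simp: f_def abs_mult)
  have "(LINT \<omega>|M. p \<omega> * f \<omega>) = exp (l\<^sup>2 * v / 2) * (LINT \<omega>|M. p \<omega> * cos (l * (X u \<omega> + (W v \<omega> - W u \<omega>)) + \<theta>))"
    unfolding f_def integral_mult_right_zero[symmetric] by (simp add: mult_ac)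
  also have "\<dots> = exp (l\<^sup>2 * v / 2) * exp (- (l\<^sup>2 * (v - u) / 2)) * (LINT \<omega>|M. p \<omega> * cos (l * X u \<omega> + \<theta>))"
    using cos_one_step[OF u uv p[folded u_def] pb Xu, of l \<theta>] by simp
  also have "exp (l\<^sup>2 * v / 2) * exp (- (l\<^sup>2 * (v - u) / 2)) = exp (l\<^sup>2 * u / 2)"
    unfolding exp_add[symmetric] by (simp add: field_simps)
  also have "exp (l\<^sup>2 * u / 2) * (LINT \<omega>|M. p \<omega> * cos (l * X u \<omega> + \<theta>)) = (LINT \<omega>|M. p \<omega> * phase n i \<omega>)"
    unfolding phase_def u_def[symmetric] integral_mult_right_zero[symmetric] by (simp add: mult_ac)
  finally have 1: "(LINT \<omega>|M. p \<omega> * f \<omega>) = (LINT \<omega>|M. p \<omega> * phase n i \<omega>)" .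
  have 2: "jump n i \<omega> = phase n (Suc i) \<omega> - f \<omega>" for \<omega>
  proof -
    have "X v \<omega> - dV n i \<omega> = X u \<omega> + (W v \<omega> - W u \<omega>)"
      by (simp add: dV_def V_def u_def v_def)
    then show ?thesis
      unfolding jump_def phase_def f_def u_def[symmetric] v_def[symmetric] by (simp add: right_diff_distrib)
  qed
  have i1: "integrable M (\<lambda>\<omega>. p \<omega> * phase n (Suc i) \<omega>)" "integrable M (\<lambda>\<omega>. p \<omega> * phase n i \<omega>)"
    using i by (auto intro!: pi[of _ bigC] phase_bound)
  then show ?thesis
    unfolding 2 using fi 1 by (simp add: right_diff_distrib)
qed

lemma dV_bound:
  assumes "skew_path (\<lambda>s. W s \<omega>) (\<lambda>s. X s \<omega>) (\<lambda>s. L s \<omega>)"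
  shows "\<bar>dV n i \<omega>\<bar> \<le> L (grid r t n (Suc i)) \<omega> - L (grid r t n i) \<omega>"
    and "m \<le> Suc n \<Longrightarrow> (\<Sum>i<m. \<bar>dV n i \<omega>\<bar>) \<le> L t \<omega>"
proof -
  show d: "\<bar>dV n i \<omega>\<bar> \<le> L (grid r t n (Suc i)) \<omega> - L (grid r t n i) \<omega>" for i
    unfolding dV_def V_def by (rule skew_path_increment(1)[OF assms r rt])
  show "m \<le> Suc n \<Longrightarrow> (\<Sum>i<m. \<bar>dV n i \<omega>\<bar>) \<le> L t \<omega>"
    using order_trans[OF sum_mono[OF d] skew_path_variation[OF assms r rt]] .
qed

text \<open>For \<open>\<theta> = 0\<close> the linear term disappears and the jumps themselves sum
  to 0 in the limit. For \<open>\<theta> = - (pi / 2)\<close> it is minus the exponential weight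
  times \<open>l * dV\<close>, so the jumps become a Riemann sum against the drift.\<close>

lemma jump_sum_tendsto:
  assumes sp: "skew_path (\<lambda>s. W s \<omega>) (\<lambda>s. X s \<omega>) (\<lambda>s. L s \<omega>)"
  shows "(\<lambda>n. \<Sum>i<Suc n. \<bar>jump n i \<omega> + exp (l\<^sup>2 * grid r t n (Suc i) / 2) * (l * dV n i \<omega> * sin \<theta>)\<bar>) \<longlonglongrightarrow> 0"
proof (rule skew_path_sum_small[OF sp r rt, of _ "bigC * l\<^sup>2"])
  fix n i assume i: "i < Suc n"
  let ?x = "X (grid r t n (Suc i)) \<omega>" and ?dl = "L (grid r t n (Suc i)) \<omega> - L (grid r t n i) \<omega>"
  have d: "\<bar>dV n i \<omega>\<bar> \<le> ?dl" by (rule dV_bound(1)[OF sp])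
  have "\<bar>jump n i \<omega> + exp (l\<^sup>2 * grid r t n (Suc i) / 2) * (l * dV n i \<omega> * sin \<theta>)\<bar> =
    exp (l\<^sup>2 * grid r t n (Suc i) / 2) * \<bar>cos (l * ?x + \<theta>) - cos (l * (?x - dV n i \<omega>) + \<theta>) + l * dV n i \<omega> * sin \<theta>\<bar>"
    unfolding jump_def distrib_left[symmetric] by (simp add: abs_mult)
  also have "\<dots> \<le> bigC * (l\<^sup>2 * (\<bar>dV n i \<omega>\<bar> * (\<bar>?x\<bar> + \<bar>dV n i \<omega>\<bar>)))"
    by (rule mult_mono[OF exp_grid_le cos_diff_bound]) (use i in \<open>auto simp: bigC_def\<close>)
  also have "\<dots> \<le> bigC * (l\<^sup>2 * (?dl * (\<bar>X (grid r t n (Suc i)) \<omega> - X (grid r t n i) \<omega>\<bar> + \<bar>W (grid r t n (Suc i)) \<omega> - W (grid r t n i) \<omega>\<bar> + ?dl + \<bar>?x\<bar>)))"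
    using d by (intro mult_left_mono mult_mono) (auto simp: bigC_def)
  finally show "\<bar>jump n i \<omega> + exp (l\<^sup>2 * grid r t n (Suc i) / 2) * (l * dV n i \<omega> * sin \<theta>)\<bar> \<le>
     bigC * l\<^sup>2 * (?dl * (\<bar>X (grid r t n (Suc i)) \<omega> - X (grid r t n i) \<omega>\<bar> + \<bar>W (grid r t n (Suc i)) \<omega> - W (grid r t n i) \<omega>\<bar> + ?dl + \<bar>?x\<bar>))"
    by (simp only: mult.assoc)
qed (simp add: bigC_def)

end
end

section \<open>The cosine martingale\<close>

context skew_paths
begin

context
  fixes r t l :: real
  assumes r: "0 \<le> r" and rt: "r < t"
begin

text \<open>Each weight is known at the left end of its cell, so the one-step identity applies cell
  by cell. Weights that switch to 0 realise stopping along the grid.\<close>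

lemma phase_telescope:
  assumes w: "\<And>i. w i \<in> borel_measurable (F (grid r t n i))" and wb: "\<And>i \<omega>. \<bar>w i \<omega>\<bar> \<le> (1::real)"
  shows "(LINT \<omega>|M. (\<Sum>i<Suc n. w i \<omega> * (phase r t l \<theta> n (Suc i) \<omega> - phase r t l \<theta> n i \<omega>))) =
    (LINT \<omega>|M. (\<Sum>i<Suc n. w i \<omega> * jump r t l \<theta> n i \<omega>))"
proof -
  note [measurable] = measurable_F_M[OF w] phase_measurable[OF r rt] jump_measurable[OF r rt]
  have b: "\<bar>w i \<omega> * y\<bar> \<le> c" if "\<bar>y\<bar> \<le> c" for i \<omega> y c
    using mult_mono[OF wb that] by (simp add: abs_mult)
  have i1: "integrable M (\<lambda>\<omega>. w i \<omega> * (phase r t l \<theta> n (Suc i) \<omega> - phase r t l \<theta> n i \<omega>))" if "i < Suc n" for i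
  proof (rule integrable_const_bound[where B="2 * bigC t l", OF AE_I2])
    fix \<omega>
    have "\<bar>phase r t l \<theta> n (Suc i) \<omega> - phase r t l \<theta> n i \<omega>\<bar> \<le> 2 * bigC t l"
      using phase_bound[OF r rt, of "Suc i" n l \<theta> \<omega>] phase_bound[OF r rt, of i n l \<theta> \<omega>] that by linarith
    then show "norm (w i \<omega> * (phase r t l \<theta> n (Suc i) \<omega> - phase r t l \<theta> n i \<omega>)) \<le> 2 * bigC t l"
      unfolding real_norm_def by (rule b)
  qed measurable
  have i2: "integrable M (\<lambda>\<omega>. w i \<omega> * jump r t l \<theta> n i \<omega>)" if "i < Suc n" for i
  proof (rule integrable_const_bound[where B="2 * bigC t l", OF AE_I2])
    fix \<omega> show "norm (w i \<omega> * jump r t l \<theta> n i \<omega>) \<le> 2 * bigC t l"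
      unfolding real_norm_def by (rule b[OF jump_bound(2)[OF r rt that]])
  qed measurable
  have "(LINT \<omega>|M. (\<Sum>i<Suc n. w i \<omega> * (phase r t l \<theta> n (Suc i) \<omega> - phase r t l \<theta> n i \<omega>))) =
      (\<Sum>i<Suc n. LINT \<omega>|M. w i \<omega> * (phase r t l \<theta> n (Suc i) \<omega> - phase r t l \<theta> n i \<omega>))"
    by (rule Bochner_Integration.integral_sum) (use i1 in simp)
  also have "\<dots> = (\<Sum>i<Suc n. LINT \<omega>|M. w i \<omega> * jump r t l \<theta> n i \<omega>)"
    by (rule sum.cong[OF refl]) (rule phase_step[OF r rt w wb], simp)
  also have "\<dots> = (LINT \<omega>|M. (\<Sum>i<Suc n. w i \<omega> * jump r t l \<theta> n i \<omega>))"
    by (rule Bochner_Integration.integral_sum[symmetric]) (use i2 in simp)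
  finally show ?thesis .
qed

text \<open>All that is known about \<open>L t\<close> at this point is that it is finite; that is
  enough to send the cutoff level to infinity.\<close>

lemma tail_tendsto: "(\<lambda>m. LINT \<omega>|M. indicator {\<omega>\<in>space M. L t \<omega> > real m} \<omega>) \<longlonglongrightarrow> (LINT \<omega>|M. (0::real))"
proof (rule integral_dominated_convergence[where w="\<lambda>_. 1"])
  have [measurable]: "L t \<in> borel_measurable M" using r rt by simp
  show "(indicator {\<omega>\<in>space M. L t \<omega> > real m} :: 'a \<Rightarrow> real) \<in> borel_measurable M" for m by measurable
  show "AE \<omega> in M. (\<lambda>m. indicator {\<omega>\<in>space M. L t \<omega> > real m} \<omega> :: real) \<longlonglongrightarrow> 0"
  proof (rule AE_I2)
    fix \<omega>
    obtain m0 :: nat where m0: "L t \<omega> \<le> real m0" using real_arch_simple by blast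
    have "indicator {\<omega>\<in>space M. L t \<omega> > real m} \<omega> = (0::real)" if "m \<ge> m0" for m
      using m0 that by (simp add: indicator_def not_less)
    then show "(\<lambda>m. indicator {\<omega>\<in>space M. L t \<omega> > real m} \<omega> :: real) \<longlonglongrightarrow> 0"
      by (intro tendsto_eventually) (auto simp: eventually_sequentially)
  qed
qed (auto simp: indicator_def)

text \<open>The finite variation part is integrable only after the fact, so the sums are cut off as
  soon as the variation exceeds \<open>k\<close>.\<close>

lemma cosine_defect_bound:
  assumes A: "A \<in> sets (F r)" and k: "0 \<le> k"
  shows "\<bar>LINT \<omega>|M. indicator A \<omega> * (phase r t l 0 n (Suc n) \<omega> - phase r t l 0 n 0 \<omega>)\<bar> \<le>
    4 * bigC t l * (LINT \<omega>|M. indicator {\<omega>\<in>space M. L t \<omega> > k} \<omega>)"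
    (is "\<bar>?D n\<bar> \<le> _")
proof -
  let ?d = "dV r t" and ?j = "jump r t l 0" and ?p = "phase r t l 0" and ?C = "bigC t l"
  note [measurable] = phase_measurable[OF r rt] jump_measurable[OF r rt] dV_measurable[OF r rt]
  have [measurable]: "A \<in> sets M" "L t \<in> borel_measurable M" using A sets_F_subset[of r] r rt by auto
  have C: "?C \<ge> 0" by (simp add: bigC_def[OF r rt])
  \<comment> \<open>The cutoff reads the variation of \<open>V\<close> over the cells before
    \<open>i\<close>, so it is known at the left end of cell \<open>i\<close>. A condition on
    \<open>L\<close> would not do, because \<open>L\<close> is only assumed measurable for
    \<open>M\<close>.\<close>
  define w where "w m i \<omega> = (if (\<Sum>j<i. \<bar>?d m j \<omega>\<bar>) \<le> k then indicator A \<omega> else (0::real))" for m i \<omega>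
  have wF: "w m i \<in> borel_measurable (F (grid r t m i))" for m i
  proof -
    have "A \<in> sets (F (grid r t m i))" using A sets_F_mono[of r "grid r t m i"] grid_ge[OF rt, of m i] by auto
    moreover have "(\<lambda>\<omega>. \<Sum>j<i. \<bar>?d m j \<omega>\<bar>) \<in> borel_measurable (F (grid r t m i))"
      by (intro borel_measurable_sum borel_measurable_abs dV_measurable_F[OF r rt]) auto
    ultimately show ?thesis unfolding w_def[abs_def] by measurable
  qed
  have wb: "\<bar>w m i \<omega>\<bar> \<le> 1" for m i \<omega> by (simp add: w_def indicator_def)
  note [measurable] = measurable_F_M[OF wF]
  define Z where "Z m \<omega> = (\<Sum>i<Suc m. w m i \<omega> * (?p m (Suc i) \<omega> - ?p m i \<omega>))" for m \<omega>
  define J where "J m \<omega> = (\<Sum>i<Suc m. w m i \<omega> * ?j m i \<omega>)" for m \<omega>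
  have [measurable]: "Z m \<in> borel_measurable M" "J m \<in> borel_measurable M" for m
    unfolding Z_def[abs_def] J_def[abs_def] by measurable
  have ZJ: "(LINT \<omega>|M. Z m \<omega>) = (LINT \<omega>|M. J m \<omega>)" for m
    unfolding Z_def J_def by (rule phase_telescope[OF wF wb])
  have pb: "\<bar>?p m i \<omega>\<bar> \<le> ?C" if "i \<le> Suc m" for m i \<omega> by (rule phase_bound[OF r rt that])
  have Zb: "\<bar>Z m \<omega>\<bar> \<le> 2 * ?C" for m \<omega>
  proof -
    have "Z m \<omega> = indicator A \<omega> * (\<Sum>i<Suc m. if (\<Sum>j<i. \<bar>?d m j \<omega>\<bar>) \<le> k then ?p m (Suc i) \<omega> - ?p m i \<omega> else 0)"
      unfolding Z_def w_def sum_distrib_left by (intro sum.cong) auto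
    moreover have "\<bar>\<Sum>i<Suc m. if (\<Sum>j<i. \<bar>?d m j \<omega>\<bar>) \<le> k then ?p m (Suc i) \<omega> - ?p m i \<omega> else 0\<bar> \<le> 2 * ?C"
    proof (rule truncated_telescope_bound)
      show "(\<Sum>j<i. \<bar>?d m j \<omega>\<bar>) \<le> k" if "(\<Sum>j<Suc i. \<bar>?d m j \<omega>\<bar>) \<le> k" for i using that by simp
    qed (rule pb)
    ultimately show ?thesis using C by (auto simp: indicator_def)
  qed
  \<comment> \<open>A bound free of the grid. A small increment is charged through the Lipschitz
    estimate for \<open>jump\<close>, a large one through \<open>2 * ?C\<close>; both are at most a
    constant times \<open>min 1 \<bar>dV\<bar>\<close>, and the cutoff bounds the sum of these
    minima by \<open>k + 1\<close>.\<close>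
  have Jb: "\<bar>J m \<omega>\<bar> \<le> ?C * (\<bar>l\<bar> + 2) * (k + 1)" for m \<omega>
  proof -
    have "\<bar>J m \<omega>\<bar> \<le> (\<Sum>i<Suc m. \<bar>w m i \<omega> * ?j m i \<omega>\<bar>)" unfolding J_def by (rule sum_abs)
    also have "\<dots> \<le> (\<Sum>i<Suc m. ?C * (\<bar>l\<bar> + 2) * (if (\<Sum>j<i. \<bar>?d m j \<omega>\<bar>) \<le> k then min 1 \<bar>?d m i \<omega>\<bar> else 0))"
    proof (rule sum_mono)
      fix i assume "i \<in> {..<Suc m}"
      then have i: "i < Suc m" by simp
      note jb = jump_bound[OF r rt i, of l 0 \<omega>]
      have "\<bar>?j m i \<omega>\<bar> \<le> ?C * (\<bar>l\<bar> + 2) * min 1 \<bar>?d m i \<omega>\<bar>"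
      proof (cases "\<bar>?d m i \<omega>\<bar> \<le> 1")
        case True
        have "?C * (\<bar>l\<bar> * \<bar>?d m i \<omega>\<bar>) \<le> ?C * ((\<bar>l\<bar> + 2) * \<bar>?d m i \<omega>\<bar>)" using C by (intro mult_left_mono mult_right_mono) auto
        then show ?thesis using jb(1) True by (simp add: mult.assoc)
      next
        case False
        have "?C * 2 \<le> ?C * (\<bar>l\<bar> + 2)" using C by (intro mult_left_mono) auto
        then show ?thesis using jb(2) False by simp
      qed
      then show "\<bar>w m i \<omega> * ?j m i \<omega>\<bar> \<le> ?C * (\<bar>l\<bar> + 2) * (if (\<Sum>j<i. \<bar>?d m j \<omega>\<bar>) \<le> k then min 1 \<bar>?d m i \<omega>\<bar> else 0)"
        using C by (auto simp: w_def indicator_def)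
    qed
    also have "\<dots> = ?C * (\<bar>l\<bar> + 2) * (\<Sum>i<Suc m. if (\<Sum>j<i. \<bar>?d m j \<omega>\<bar>) \<le> k then min 1 \<bar>?d m i \<omega>\<bar> else 0)"
      by (simp only: sum_distrib_left)
    also have "\<dots> \<le> ?C * (\<bar>l\<bar> + 2) * (k + 1)"
      using C by (intro mult_left_mono truncated_sum_bound k) auto
    finally show ?thesis .
  qed
  have "(\<lambda>m. LINT \<omega>|M. J m \<omega>) \<longlonglongrightarrow> (LINT \<omega>|M. 0)"
  proof (rule integral_dominated_convergence[where w="\<lambda>_. ?C * (\<bar>l\<bar> + 2) * (k + 1)"])
    show "AE \<omega> in M. (\<lambda>m. J m \<omega>) \<longlonglongrightarrow> 0"
      using paths
    proof eventually_elim
      case (elim \<omega>)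
      have "(\<lambda>m. \<Sum>i<Suc m. \<bar>?j m i \<omega>\<bar>) \<longlonglongrightarrow> 0"
        using jump_sum_tendsto[OF r rt elim, of l 0] by (simp only: sin_zero mult_zero_right add_0_right)
      then show ?case
      proof (rule Lim_null_comparison[rotated], intro always_eventually allI)
        fix m
        have "\<bar>J m \<omega>\<bar> \<le> (\<Sum>i<Suc m. \<bar>w m i \<omega> * ?j m i \<omega>\<bar>)" unfolding J_def by (rule sum_abs)
        also have "\<dots> \<le> (\<Sum>i<Suc m. \<bar>?j m i \<omega>\<bar>)"
          by (rule sum_mono) (simp add: w_def indicator_def)
        finally show "norm (J m \<omega>) \<le> (\<Sum>i<Suc m. \<bar>?j m i \<omega>\<bar>)" by simp
      qed
    qed
    show "AE \<omega> in M. norm (J m \<omega>) \<le> ?C * (\<bar>l\<bar> + 2) * (k + 1)" for m using Jb by simp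
  qed simp_all
  then have J0: "(\<lambda>m. \<bar>LINT \<omega>|M. J m \<omega>\<bar> + 4 * ?C * (LINT \<omega>|M. indicator {\<omega>\<in>space M. L t \<omega> > k} \<omega>)) \<longlonglongrightarrow> 0 + 4 * ?C * (LINT \<omega>|M. indicator {\<omega>\<in>space M. L t \<omega> > k} \<omega>)"
    by (intro tendsto_add tendsto_const tendsto_rabs_zero) simp
  \<comment> \<open>The two end phases do not depend on the number of cells, so the fixed
    \<open>n\<close> of the claim can be replaced by a running \<open>m\<close>.\<close>
  have ends: "?p m 0 \<omega> = ?p n 0 \<omega>" "?p m (Suc m) \<omega> = ?p n (Suc n) \<omega>" for m \<omega>
    by (simp_all add: phase_def[OF r rt])
  have iD: "integrable M (\<lambda>\<omega>. indicator A \<omega> * (?p m (Suc m) \<omega> - ?p m 0 \<omega>))" for m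
  proof (rule integrable_const_bound[where B="2 * ?C", OF AE_I2])
    fix \<omega> show "norm (indicator A \<omega> * (?p m (Suc m) \<omega> - ?p m 0 \<omega>)) \<le> 2 * ?C"
      using pb[of "Suc m" m \<omega>] pb[of 0 m \<omega>] C by (simp add: indicator_def abs_le_iff)
  qed measurable
  have iZ: "integrable M (Z m)" for m
    by (rule integrable_const_bound[where B="2 * ?C", OF AE_I2]) (use Zb in simp_all)
  have iI: "integrable M (\<lambda>\<omega>. 4 * ?C * indicator {\<omega>\<in>space M. L t \<omega> > k} \<omega>)"
    by (rule integrable_const_bound[where B="4 * ?C", OF AE_I2]) (use C in \<open>simp_all add: indicator_def\<close>)
  have "\<bar>?D n\<bar> \<le> \<bar>LINT \<omega>|M. J m \<omega>\<bar> + 4 * ?C * (LINT \<omega>|M. indicator {\<omega>\<in>space M. L t \<omega> > k} \<omega>)" for m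
  proof -
    have Dm: "?D n = ?D m" by (simp only: ends[of m])
    have "\<bar>?D m - (LINT \<omega>|M. Z m \<omega>)\<bar> = \<bar>LINT \<omega>|M. indicator A \<omega> * (?p m (Suc m) \<omega> - ?p m 0 \<omega>) - Z m \<omega>\<bar>"
      by (subst Bochner_Integration.integral_diff[OF iD iZ]) (rule refl)
    also have "\<dots> \<le> (LINT \<omega>|M. \<bar>indicator A \<omega> * (?p m (Suc m) \<omega> - ?p m 0 \<omega>) - Z m \<omega>\<bar>)"
      by (rule integral_abs_bound)
    also have "\<dots> \<le> (LINT \<omega>|M. 4 * ?C * indicator {\<omega>\<in>space M. L t \<omega> > k} \<omega>)"
    proof (rule integral_mono_AE)
      \<comment> \<open>While \<open>L t\<close> is at most \<open>k\<close> the variation never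
        triggers the cutoff and \<open>Z m\<close> telescopes to the full difference. Otherwise both
        terms are at most \<open>2 * ?C\<close>, which explains the constant
        \<open>4 * ?C\<close>.\<close>
      show "AE \<omega> in M. \<bar>indicator A \<omega> * (?p m (Suc m) \<omega> - ?p m 0 \<omega>) - Z m \<omega>\<bar> \<le> 4 * ?C * indicator {\<omega>\<in>space M. L t \<omega> > k} \<omega>"
        using paths AE_space
      proof eventually_elim
        case (elim \<omega>)
        show ?case
        proof (cases "L t \<omega> > k")
          case True
          have "\<bar>indicator A \<omega> * (?p m (Suc m) \<omega> - ?p m 0 \<omega>)\<bar> \<le> 2 * ?C"
            using pb[of "Suc m" m \<omega>] pb[of 0 m \<omega>] C by (simp add: indicator_def abs_le_iff)
          then show ?thesis using Zb[of m \<omega>] True elim(2) by (simp add: abs_le_iff)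
        next
          case False
          have "w m i \<omega> = indicator A \<omega>" if "i < Suc m" for i
            using dV_bound(2)[OF r rt elim(1), of i m] that False by (simp add: w_def)
          then have "Z m \<omega> = (\<Sum>i<Suc m. indicator A \<omega> * (?p m (Suc i) \<omega> - ?p m i \<omega>))"
            unfolding Z_def by (intro sum.cong) auto
          also have "\<dots> = indicator A \<omega> * (?p m (Suc m) \<omega> - ?p m 0 \<omega>)"
            by (simp only: sum_distrib_left[symmetric] sum_lessThan_telescope[of "\<lambda>i. ?p m i \<omega>"])
          finally show ?thesis using False by simp
        qed
      qed
      show "integrable M (\<lambda>\<omega>. \<bar>indicator A \<omega> * (?p m (Suc m) \<omega> - ?p m 0 \<omega>) - Z m \<omega>\<bar>)"
        by (rule integrable_abs[OF Bochner_Integration.integrable_diff[OF iD iZ]])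
    qed (rule iI)
    also have "\<dots> = 4 * ?C * (LINT \<omega>|M. indicator {\<omega>\<in>space M. L t \<omega> > k} \<omega>)"
      by (rule integral_mult_right_zero)
    finally show ?thesis unfolding Dm ZJ by linarith
  qed
  then have "\<bar>?D n\<bar> \<le> 0 + 4 * ?C * (LINT \<omega>|M. indicator {\<omega>\<in>space M. L t \<omega> > k} \<omega>)"
    by (rule tendsto_lowerbound[OF J0 always_eventually[OF allI] sequentially_bot])
  then show ?thesis by simp
qed

text \<open>The defect is at most a constant times the probability that \<open>L t\<close> exceeds
  \<open>k\<close>, for every \<open>k\<close>, hence 0. Allowing every \<open>A\<close> in
  \<open>F r\<close> makes this a conditional statement, which the estimate at two times
  requires.\<close>

lemma cosine_martingale:
  assumes A: "A \<in> sets (F r)"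
  shows "(LINT \<omega>|M. indicator A \<omega> * cos (l * X t \<omega>)) = exp (- (l\<^sup>2 * (t - r) / 2)) * (LINT \<omega>|M. indicator A \<omega> * cos (l * X r \<omega>))"
proof -
  have [measurable]: "A \<in> sets M" "X t \<in> borel_measurable M" "X r \<in> borel_measurable M"
    using A sets_F_subset[of r] r rt by auto
  \<comment> \<open>One cell is enough, since only the two end phases enter.\<close>
  let ?D = "LINT \<omega>|M. indicator A \<omega> * (phase r t l 0 0 (Suc 0) \<omega> - phase r t l 0 0 0 \<omega>)"
  have "\<bar>?D\<bar> \<le> 4 * bigC t l * (LINT \<omega>|M. 0::real)"
    by (rule tendsto_lowerbound[OF tendsto_mult[OF tendsto_const tail_tendsto] always_eventually[OF allI] sequentially_bot])
      (rule cosine_defect_bound[OF A], simp)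
  then have "?D = 0" by simp
  moreover have "?D = (LINT \<omega>|M. exp (l\<^sup>2 * t / 2) * (indicator A \<omega> * cos (l * X t \<omega>)) - exp (l\<^sup>2 * r / 2) * (indicator A \<omega> * cos (l * X r \<omega>)))"
    by (intro Bochner_Integration.integral_cong) (auto simp: phase_def[OF r rt] right_diff_distrib mult_ac)
  moreover have i: "integrable M (\<lambda>\<omega>. indicator A \<omega> * cos (l * X s \<omega>))" if "X s \<in> borel_measurable M" for s
    by (rule integrable_const_bound[where B=1, OF AE_I2]) (use that in \<open>simp_all add: indicator_def\<close>)
  ultimately have "exp (l\<^sup>2 * t / 2) * (LINT \<omega>|M. indicator A \<omega> * cos (l * X t \<omega>)) = exp (l\<^sup>2 * r / 2) * (LINT \<omega>|M. indicator A \<omega> * cos (l * X r \<omega>))"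
    by simp
  then have "exp (- (l\<^sup>2 * t / 2)) * (exp (l\<^sup>2 * t / 2) * (LINT \<omega>|M. indicator A \<omega> * cos (l * X t \<omega>))) = exp (- (l\<^sup>2 * t / 2)) * (exp (l\<^sup>2 * r / 2) * (LINT \<omega>|M. indicator A \<omega> * cos (l * X r \<omega>)))"
    by (simp only:)
  moreover have "exp (- (l\<^sup>2 * t / 2)) * exp (l\<^sup>2 * t / 2) = 1" "exp (- (l\<^sup>2 * t / 2)) * exp (l\<^sup>2 * r / 2) = exp (- (l\<^sup>2 * (t - r) / 2))"
    unfolding exp_add[symmetric] by (simp_all add: field_simps)
  ultimately show ?thesis by (simp only: mult.assoc[symmetric] mult_1_left)
qed

end

section \<open>The mean of the sine\<close>

text \<open>\<open>q\<close> is the density of the mean drift, and integrability of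
  \<open>L t\<close> now takes the place of the cutoff. The sine has slope \<open>l\<close> at 0, so
  the jumps amount to \<open>exp (l\<^sup>2 * s / 2) * l * dV\<close>, whose mean is computed cell
  by cell from \<open>q\<close>; dividing by the exponential at \<open>t\<close> leaves the factor
  \<open>exp (- (l\<^sup>2 * (t - s) / 2))\<close>.\<close>

lemma sine_formula:
  fixes t l :: real and q :: "real \<Rightarrow> real"
  assumes t: "0 < t" and Li: "integrable M (L t)" and qi: "set_integrable lborel {0<..t} q"
    and q: "\<And>u v. 0 \<le> u \<Longrightarrow> u \<le> v \<Longrightarrow> v \<le> t \<Longrightarrow> (LINT \<omega>|M. V v \<omega> - V u \<omega>) = (LINT s:{u<..v}|lborel. q s)"
  shows "(LINT \<omega>|M. sin (l * X t \<omega>)) = l * (LINT s:{0<..t}|lborel. exp (- (l\<^sup>2 * (t - s) / 2)) * q s)"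
proof -
  \<comment> \<open>A quarter turn makes the shifted cosine a sine and gives the linear term of
    \<open>cos_diff_bound\<close> the coefficient \<open>- l\<close>.\<close>
  define \<theta> where "\<theta> = - (pi / 2)"
  have th: "sin \<theta> = -1" "cos \<theta> = 0" "cos (y + \<theta>) = sin y" for y
    by (simp_all add: \<theta>_def cos_diff)
  let ?p = "phase 0 t l \<theta>" and ?j = "jump 0 t l \<theta>" and ?d = "dV 0 t" and ?C = "bigC t l" and ?g = "grid 0 t"
  define f where "f s = exp (l\<^sup>2 * s / 2)" for s
  note [measurable] = phase_measurable[OF order_refl t] jump_measurable[OF order_refl t] dV_measurable[OF order_refl t]
  have [measurable]: "X t \<in> borel_measurable M" "X 0 \<in> borel_measurable M" "L t \<in> borel_measurable M" using t by auto
  have C: "?C \<ge> 0" by (simp add: bigC_def[OF order_refl t])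
  define R where "R n \<omega> = (\<Sum>i<Suc n. f (?g n (Suc i)) * (l * ?d n i \<omega>))" for n \<omega>
  define J where "J n \<omega> = (\<Sum>i<Suc n. ?j n i \<omega>)" for n \<omega>
  have [measurable]: "R n \<in> borel_measurable M" "J n \<in> borel_measurable M" for n
    unfolding R_def[abs_def] J_def[abs_def] by measurable
  have X0: "AE \<omega> in M. X 0 \<omega> = 0" using paths by eventually_elim (rule skew_pathD(6))
  \<comment> \<open>The phases telescope, and the initial one vanishes because \<open>X 0\<close> is
    0 almost surely; the mean of \<open>J n\<close> is therefore the same for all
    \<open>n\<close>.\<close>
  have 1: "f t * (LINT \<omega>|M. sin (l * X t \<omega>)) = (LINT \<omega>|M. J n \<omega>)" for n
  proof -
    have "f t * (LINT \<omega>|M. sin (l * X t \<omega>)) = (LINT \<omega>|M. f t * sin (l * X t \<omega>))"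
      by (rule integral_mult_right_zero[symmetric])
    also have "\<dots> = (LINT \<omega>|M. ?p n (Suc n) \<omega> - ?p n 0 \<omega>)"
    proof (rule integral_cong_AE)
      show "AE \<omega> in M. f t * sin (l * X t \<omega>) = ?p n (Suc n) \<omega> - ?p n 0 \<omega>"
        using X0 by eventually_elim (simp add: phase_def[OF order_refl t] th f_def)
    qed measurable
    also have "\<dots> = (LINT \<omega>|M. J n \<omega>)"
    proof -
      have "(LINT \<omega>|M. (\<Sum>i<Suc n. 1 * (?p n (Suc i) \<omega> - ?p n i \<omega>))) = (LINT \<omega>|M. (\<Sum>i<Suc n. 1 * ?j n i \<omega>))"
        by (rule phase_telescope[OF order_refl t]) simp_all
      moreover have "(\<Sum>i<Suc n. ?p n (Suc i) \<omega> - ?p n i \<omega>) = ?p n (Suc n) \<omega> - ?p n 0 \<omega>" for \<omega>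
        by (rule sum_lessThan_telescope)
      ultimately show ?thesis unfolding J_def by (simp only: mult_1_left)
    qed
    finally show ?thesis .
  qed
  have fb: "f (?g n (Suc i)) \<le> ?C" "f (?g n (Suc i)) \<ge> 0" if "i < Suc n" for n i
    using exp_grid_le[OF order_refl t, of "Suc i" n l] that by (simp_all add: f_def)
  have db: "AE \<omega> in M. (\<Sum>i<Suc n. \<bar>?d n i \<omega>\<bar>) \<le> L t \<omega>" for n
    using paths by eventually_elim (rule dV_bound(2)[OF order_refl t _ order_refl])
  have Jb: "\<bar>J n \<omega>\<bar> \<le> ?C * \<bar>l\<bar> * (\<Sum>i<Suc n. \<bar>?d n i \<omega>\<bar>)" for n \<omega>
    unfolding J_def sum_distrib_left mult.assoc
    by (rule order_trans[OF sum_abs sum_mono]) (rule jump_bound(1)[OF order_refl t], simp)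
  have Rb: "\<bar>R n \<omega>\<bar> \<le> ?C * \<bar>l\<bar> * (\<Sum>i<Suc n. \<bar>?d n i \<omega>\<bar>)" for n \<omega>
    unfolding R_def sum_distrib_left mult.assoc
    by (rule order_trans[OF sum_abs sum_mono]) (simp add: abs_mult fb mult_right_mono)
  have Lb: "integrable M h" if [measurable]: "h \<in> borel_measurable M" and "\<And>\<omega>. \<bar>h \<omega>\<bar> \<le> ?C * \<bar>l\<bar> * (\<Sum>i<Suc n. \<bar>?d n i \<omega>\<bar>)" for h n
  proof (rule Bochner_Integration.integrable_bound[of _ "\<lambda>\<omega>. ?C * \<bar>l\<bar> * L t \<omega>"])
    show "AE \<omega> in M. norm (h \<omega>) \<le> norm (?C * \<bar>l\<bar> * L t \<omega>)"
      using db[of n]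
    proof eventually_elim
      case (elim \<omega>)
      have "\<bar>h \<omega>\<bar> \<le> ?C * \<bar>l\<bar> * (\<Sum>i<Suc n. \<bar>?d n i \<omega>\<bar>)" by (rule that(2))
      also have "\<dots> \<le> ?C * \<bar>l\<bar> * L t \<omega>" using elim C by (intro mult_left_mono) auto
      finally show ?case by simp
    qed
    show "integrable M (\<lambda>\<omega>. ?C * \<bar>l\<bar> * L t \<omega>)" by (rule integrable_mult_right[OF Li])
  qed (rule that(1))
  have iJ: "integrable M (J n)" and iR: "integrable M (R n)" for n
    by (rule Lb[OF _ Jb], measurable) (rule Lb[OF _ Rb], measurable)
  have "(\<lambda>n. LINT \<omega>|M. J n \<omega> - R n \<omega>) \<longlonglongrightarrow> (LINT \<omega>|M. 0)"
  proof (rule integral_dominated_convergence[where w="\<lambda>\<omega>. 2 * (?C * \<bar>l\<bar> * L t \<omega>)"])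
    show "AE \<omega> in M. (\<lambda>n. J n \<omega> - R n \<omega>) \<longlonglongrightarrow> 0"
      using paths
    proof eventually_elim
      case (elim \<omega>)
      have "?j n i \<omega> + exp (l\<^sup>2 * ?g n (Suc i) / 2) * (l * ?d n i \<omega> * sin \<theta>) = ?j n i \<omega> - f (?g n (Suc i)) * (l * ?d n i \<omega>)" for n i
        by (simp add: th f_def)
      then have "(\<lambda>n. \<Sum>i<Suc n. \<bar>?j n i \<omega> - f (?g n (Suc i)) * (l * ?d n i \<omega>)\<bar>) \<longlonglongrightarrow> 0"
        using jump_sum_tendsto[OF order_refl t elim, of l \<theta>] by (simp only:)
      then show ?case
      proof (rule Lim_null_comparison[rotated], intro always_eventually allI)
        fix n
        show "norm (J n \<omega> - R n \<omega>) \<le> (\<Sum>i<Suc n. \<bar>?j n i \<omega> - f (?g n (Suc i)) * (l * ?d n i \<omega>)\<bar>)"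
          unfolding J_def R_def sum_subtractf[symmetric] real_norm_def by (rule sum_abs)
      qed
    qed
    show "AE \<omega> in M. norm (J n \<omega> - R n \<omega>) \<le> 2 * (?C * \<bar>l\<bar> * L t \<omega>)" for n
      using db[of n]
    proof eventually_elim
      case (elim \<omega>)
      have "?C * \<bar>l\<bar> * (\<Sum>i<Suc n. \<bar>?d n i \<omega>\<bar>) \<le> ?C * \<bar>l\<bar> * L t \<omega>" using elim C by (intro mult_left_mono) auto
      then show ?case unfolding real_norm_def using Jb[of n \<omega>] Rb[of n \<omega>] by linarith
    qed
    show "integrable M (\<lambda>\<omega>. 2 * (?C * \<bar>l\<bar> * L t \<omega>))" by (intro integrable_mult_right Li)
  qed measurable
  then have 2: "(\<lambda>n. f t * (LINT \<omega>|M. sin (l * X t \<omega>)) - (LINT \<omega>|M. R n \<omega>)) \<longlonglongrightarrow> 0"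
    unfolding Bochner_Integration.integral_diff[OF iJ iR] 1[symmetric] by simp
  have fm[measurable]: "f \<in> borel_measurable borel" unfolding f_def[abs_def] by measurable
  have sub: "set_integrable lborel {u<..v} q" if "0 \<le> u" "v \<le> t" for u v
    by (rule set_integrable_subset[OF qi]) (use that in auto)
  \<comment> \<open>\<open>q\<close> is given as integrable on \<open>{0<..t}\<close> only, so its
    measurability is available after multiplication by an indicator.\<close>
  have qm: "(\<lambda>s. indicator {u<..v} s * q s) \<in> borel_measurable borel" if "0 \<le> u" "v \<le> t" for u v
    using sub[OF that] unfolding set_integrable_def by (auto dest!: borel_measurable_integrable)
  have fqi: "set_integrable lborel {u<..v} (\<lambda>s. f s * q s)" if "0 \<le> u" "v \<le> t" for u v
    unfolding set_integrable_def
  proof (rule Bochner_Integration.integrable_bound[of _ "\<lambda>s. f t * (indicator {u<..v} s * q s)"])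
    show "integrable lborel (\<lambda>s. f t * (indicator {u<..v} s * q s))" using sub[OF that] unfolding set_integrable_def by simp
    have "(\<lambda>s. f s * (indicator {u<..v} s * q s)) \<in> borel_measurable borel" using qm[OF that] by measurable
    then show "(\<lambda>s. indicator {u<..v} s *\<^sub>R (f s * q s)) \<in> borel_measurable lborel" by (simp add: mult_ac)
    have "f s \<le> f t" if "s \<le> v" for s unfolding f_def using that \<open>v \<le> t\<close> by (simp add: mult_left_mono)
    then show "AE s in lborel. norm (indicator {u<..v} s *\<^sub>R (f s * q s)) \<le> norm (f t * (indicator {u<..v} s * q s))"
      by (intro AE_I2) (auto simp: indicator_def abs_mult f_def intro!: mult_right_mono)
  qed
  define \<Phi> where "\<Phi> v = (LINT s:{0<..v}|lborel. f s * q s)" for v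
  define \<Psi> where "\<Psi> v = (LINT s:{0<..v}|lborel. \<bar>q s\<bar>)" for v
  have qabs: "set_integrable lborel {u<..v} (\<lambda>s. \<bar>q s\<bar>)" if "0 \<le> u" "v \<le> t" for u v
    using set_integrable_abs[OF sub[OF that]] .
  have split: "(LINT s:{0<..v}|lborel. h s) - (LINT s:{0<..u}|lborel. h s) = (LINT s:{u<..v}|lborel. h s)"
    if "0 \<le> u" "u \<le> v" "v \<le> t" "\<And>u v. 0 \<le> u \<Longrightarrow> v \<le> t \<Longrightarrow> set_integrable lborel {u<..v} h" for u v and h :: "real \<Rightarrow> real"
  proof -
    have eq: "{0<..v} = {0<..u} \<union> {u<..v}" using that(1,2) by auto
    have i1: "set_integrable lborel {0<..u} h" by (rule that(4)[OF order_refl order_trans[OF that(2,3)]])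
    have i2: "set_integrable lborel {u<..v} h" by (rule that(4)[OF that(1,3)])
    show ?thesis unfolding eq set_integral_Un[OF ivl_disj_int_two(6) i1 i2] by (rule add_diff_cancel_left')
  qed
  \<comment> \<open>Riemann sum against exact integral: on each cell \<open>f\<close> at the right
    end differs from \<open>f s\<close> by less than \<open>\<delta>\<close> on fine grids, at the
    cost of \<open>\<delta>\<close> times the mass of \<open>\<bar>q\<bar>\<close>.\<close>
  have 3: "(\<lambda>n. (LINT \<omega>|M. R n \<omega>) - l * \<Phi> t) \<longlonglongrightarrow> 0"
  proof (rule LIMSEQ_I)
    fix e :: real assume e: "e > 0"
    \<comment> \<open>Chosen so that \<open>\<bar>l\<bar> * \<delta> * \<Psi> t\<close> stays below
      \<open>e\<close>; the added 1 covers a vanishing \<open>l\<close> or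
      \<open>\<Psi> t\<close>.\<close>
    define \<delta> where "\<delta> = e / (\<bar>l\<bar> * \<Psi> t + 1)"
    have P0: "\<Psi> t \<ge> 0" unfolding \<Psi>_def set_lebesgue_integral_def by (rule Bochner_Integration.integral_nonneg) simp
    have den: "\<bar>l\<bar> * \<Psi> t + 1 > 0" using P0 by (simp add: add_nonneg_pos)
    have d: "\<delta> > 0" unfolding \<delta>_def using e den by simp
    have de: "\<bar>l\<bar> * (\<delta> * \<Psi> t) < e"
    proof -
      have "\<bar>l\<bar> * (\<delta> * \<Psi> t) = \<delta> * (\<bar>l\<bar> * \<Psi> t)" by simp
      also have "\<dots> < \<delta> * (\<bar>l\<bar> * \<Psi> t + 1)" using d by (intro mult_strict_left_mono) auto
      also have "\<dots> = e" unfolding \<delta>_def using den by simp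
      finally show ?thesis .
    qed
    have "continuous_on {0..} f" unfolding f_def by (intro continuous_intros) auto
    from grid_uniformly_small[OF this order_refl t d] obtain n0 where n0:
      "\<And>n. n \<ge> n0 \<Longrightarrow> \<forall>i<Suc n. \<forall>s\<in>{?g n i..?g n (Suc i)}. \<forall>s'\<in>{?g n i..?g n (Suc i)}. \<bar>f s - f s'\<bar> < \<delta>"
      unfolding eventually_sequentially by blast
    have "norm ((LINT \<omega>|M. R n \<omega>) - l * \<Phi> t - 0) < e" if n: "n \<ge> n0" for n
    proof -
      have g: "0 \<le> ?g n i" "?g n i \<le> ?g n (Suc i)" for i
        using grid_ge[OF t, of n i] grid_less[OF t, of n i] by auto
      have gt: "?g n (Suc i) \<le> t" if "i < Suc n" for i by (rule grid_le[OF t]) (use that in simp)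
      have id: "integrable M (?d n i)" if "i < Suc n" for i
      proof (rule Bochner_Integration.integrable_bound[OF Li])
        show "AE \<omega> in M. norm (?d n i \<omega>) \<le> norm (L t \<omega>)"
          using db[of n]
        proof eventually_elim
          case (elim \<omega>)
          have "\<bar>?d n i \<omega>\<bar> \<le> (\<Sum>i<Suc n. \<bar>?d n i \<omega>\<bar>)"
            by (rule member_le_sum) (use that in auto)
          then show ?case using elim by simp
        qed
      qed measurable
      have ER: "(LINT \<omega>|M. R n \<omega>) = (\<Sum>i<Suc n. f (?g n (Suc i)) * (l * (LINT s:{?g n i<..?g n (Suc i)}|lborel. q s)))"
      proof -
        have "(LINT \<omega>|M. R n \<omega>) = (\<Sum>i<Suc n. LINT \<omega>|M. f (?g n (Suc i)) * (l * ?d n i \<omega>))"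
          unfolding R_def by (rule Bochner_Integration.integral_sum) (use id in simp)
        also have "\<dots> = (\<Sum>i<Suc n. f (?g n (Suc i)) * (l * (LINT \<omega>|M. ?d n i \<omega>)))"
          by (simp only: integral_mult_right_zero)
        also have "\<dots> = (\<Sum>i<Suc n. f (?g n (Suc i)) * (l * (LINT s:{?g n i<..?g n (Suc i)}|lborel. q s)))"
          by (rule sum.cong[OF refl]) (use q[OF g gt] in \<open>simp add: dV_def[OF order_refl t]\<close>)
        finally show ?thesis .
      qed
      have EP: "\<Phi> t = (\<Sum>i<Suc n. LINT s:{?g n i<..?g n (Suc i)}|lborel. f s * q s)"
      proof -
        have "\<Phi> t = \<Phi> (?g n (Suc n)) - \<Phi> (?g n 0)" by (simp add: \<Phi>_def set_lebesgue_integral_def)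
        also have "\<dots> = (\<Sum>i<Suc n. \<Phi> (?g n (Suc i)) - \<Phi> (?g n i))" by (rule sum_lessThan_telescope[symmetric])
        also have "\<dots> = (\<Sum>i<Suc n. LINT s:{?g n i<..?g n (Suc i)}|lborel. f s * q s)"
          unfolding \<Phi>_def by (rule sum.cong[OF refl]) (rule split[OF g gt fqi], simp)
        finally show ?thesis .
      qed
      have EA: "\<Psi> t = (\<Sum>i<Suc n. LINT s:{?g n i<..?g n (Suc i)}|lborel. \<bar>q s\<bar>)"
      proof -
        have "\<Psi> t = \<Psi> (?g n (Suc n)) - \<Psi> (?g n 0)" by (simp add: \<Psi>_def set_lebesgue_integral_def)
        also have "\<dots> = (\<Sum>i<Suc n. \<Psi> (?g n (Suc i)) - \<Psi> (?g n i))" by (rule sum_lessThan_telescope[symmetric])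
        also have "\<dots> = (\<Sum>i<Suc n. LINT s:{?g n i<..?g n (Suc i)}|lborel. \<bar>q s\<bar>)"
          unfolding \<Psi>_def by (rule sum.cong[OF refl]) (rule split[OF g gt qabs], simp)
        finally show ?thesis .
      qed
      have piece: "\<bar>f (?g n (Suc i)) * (LINT s:{?g n i<..?g n (Suc i)}|lborel. q s) - (LINT s:{?g n i<..?g n (Suc i)}|lborel. f s * q s)\<bar>
          \<le> \<delta> * (LINT s:{?g n i<..?g n (Suc i)}|lborel. \<bar>q s\<bar>)" if i: "i < Suc n" for i
      proof -
        define u v where "u = ?g n i" and "v = ?g n (Suc i)"
        have uv: "0 \<le> u" "u \<le> v" "v \<le> t" unfolding u_def v_def by (rule g gt[OF i])+
        note I = sub[OF uv(1,3), unfolded set_integrable_def] fqi[OF uv(1,3), unfolded set_integrable_def] qabs[OF uv(1,3), unfolded set_integrable_def]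
        have "f v * (LINT s:{u<..v}|lborel. q s) - (LINT s:{u<..v}|lborel. f s * q s) =
           (LINT s|lborel. f v * (indicator {u<..v} s *\<^sub>R q s) - indicator {u<..v} s *\<^sub>R (f s * q s))"
        proof -
          have "integrable lborel (\<lambda>s. f v * (indicator {u<..v} s *\<^sub>R q s))" by (rule integrable_mult_right[OF I(1)])
          from Bochner_Integration.integral_diff[OF this I(2)] show ?thesis
            unfolding set_lebesgue_integral_def by (simp only: integral_mult_right_zero)
        qed
        also have "\<bar>\<dots>\<bar> \<le> (LINT s|lborel. \<delta> * (indicator {u<..v} s *\<^sub>R \<bar>q s\<bar>))"
        proof (rule order_trans[OF integral_abs_bound integral_mono])
          show "integrable lborel (\<lambda>s. \<bar>f v * (indicator {u<..v} s *\<^sub>R q s) - indicator {u<..v} s *\<^sub>R (f s * q s)\<bar>)"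
            by (rule integrable_abs[OF Bochner_Integration.integrable_diff[OF integrable_mult_right[OF I(1)] I(2)]])
          show "integrable lborel (\<lambda>s. \<delta> * (indicator {u<..v} s *\<^sub>R \<bar>q s\<bar>))"
            by (rule integrable_mult_right[OF I(3)])
          fix s
          have A: "\<bar>f v * q s - f s * q s\<bar> \<le> \<delta> * \<bar>q s\<bar>" if "s \<in> {u<..v}"
          proof -
            have vs: "v \<in> {u..v}" "s \<in> {u..v}" using that uv(2) by auto
            have "\<bar>f v - f s\<bar> \<le> \<delta>"
              by (rule less_imp_le[OF n0[OF n, rule_format, OF i vs[unfolded u_def v_def], folded v_def]])
            then have "\<bar>f v - f s\<bar> * \<bar>q s\<bar> \<le> \<delta> * \<bar>q s\<bar>" by (rule mult_right_mono) simp
            then show ?thesis by (simp only: abs_mult[symmetric] left_diff_distrib)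
          qed
          show "\<bar>f v * (indicator {u<..v} s *\<^sub>R q s) - indicator {u<..v} s *\<^sub>R (f s * q s)\<bar> \<le> \<delta> * (indicator {u<..v} s *\<^sub>R \<bar>q s\<bar>)"
          proof (cases "s \<in> {u<..v}")
            case True
            then show ?thesis using A by (simp only: indicator_simps scaleR_one)
          next
            case False
            then show ?thesis by simp
          qed
        qed
        finally show ?thesis unfolding u_def v_def set_lebesgue_integral_def by (simp only: integral_mult_right_zero)
      qed
      have E1: "(LINT \<omega>|M. R n \<omega>) - l * \<Phi> t = l * (\<Sum>i<Suc n. f (?g n (Suc i)) * (LINT s:{?g n i<..?g n (Suc i)}|lborel. q s) - (LINT s:{?g n i<..?g n (Suc i)}|lborel. f s * q s))"
      proof -
        have "(\<Sum>i<Suc n. f (?g n (Suc i)) * (l * a i)) - l * (\<Sum>i<Suc n. b i) = l * (\<Sum>i<Suc n. f (?g n (Suc i)) * a i - b i)" for a b :: "nat \<Rightarrow> real"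
          unfolding sum_subtractf right_diff_distrib sum_distrib_left by (simp only: mult.left_commute)
        then show ?thesis unfolding ER EP .
      qed
      have "\<bar>\<Sum>i<Suc n. f (?g n (Suc i)) * (LINT s:{?g n i<..?g n (Suc i)}|lborel. q s) - (LINT s:{?g n i<..?g n (Suc i)}|lborel. f s * q s)\<bar> \<le> (\<Sum>i<Suc n. \<delta> * (LINT s:{?g n i<..?g n (Suc i)}|lborel. \<bar>q s\<bar>))"
        by (rule order_trans[OF sum_abs sum_mono]) (rule piece, simp only: lessThan_iff)
      also have "\<dots> = \<delta> * \<Psi> t" by (simp only: EA sum_distrib_left)
      finally have "\<bar>l\<bar> * \<bar>\<Sum>i<Suc n. f (?g n (Suc i)) * (LINT s:{?g n i<..?g n (Suc i)}|lborel. q s) - (LINT s:{?g n i<..?g n (Suc i)}|lborel. f s * q s)\<bar> \<le> \<bar>l\<bar> * (\<delta> * \<Psi> t)"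
        by (rule mult_left_mono) simp
      then have "\<bar>(LINT \<omega>|M. R n \<omega>) - l * \<Phi> t\<bar> \<le> \<bar>l\<bar> * (\<delta> * \<Psi> t)"
        unfolding E1 abs_mult .
      then have "\<bar>(LINT \<omega>|M. R n \<omega>) - l * \<Phi> t\<bar> < e" using de by (rule le_less_trans)
      then show ?thesis by (simp only: real_norm_def diff_0_right)
    qed
    then show "\<exists>n0. \<forall>n\<ge>n0. norm ((LINT \<omega>|M. R n \<omega>) - l * \<Phi> t - 0) < e" by blast
  qed
  \<comment> \<open>Both terms are free of \<open>n\<close>, so convergence to 0 is
    equality.\<close>
  have "(\<lambda>n. f t * (LINT \<omega>|M. sin (l * X t \<omega>)) - l * \<Phi> t) \<longlonglongrightarrow> 0"
    using tendsto_add[OF 2 3] by simp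
  then have eq: "f t * (LINT \<omega>|M. sin (l * X t \<omega>)) = l * \<Phi> t"
    unfolding LIMSEQ_const_iff by simp
  have ft: "f t > 0" by (simp add: f_def)
  have "(LINT s:{0<..t}|lborel. exp (- (l\<^sup>2 * (t - s) / 2)) * q s) = (LINT s:{0<..t}|lborel. (1 / f t) * (f s * q s))"
  proof -
    have "exp (- (l\<^sup>2 * (t - s) / 2)) = 1 / f t * f s" for s
      unfolding f_def by (simp add: exp_diff[symmetric] diff_divide_distrib right_diff_distrib)
    then show ?thesis by (simp only: mult.assoc)
  qed
  also have "\<dots> = 1 / f t * \<Phi> t" unfolding \<Phi>_def by (rule set_integral_mult_right)
  finally have "l * (LINT s:{0<..t}|lborel. exp (- (l\<^sup>2 * (t - s) / 2)) * q s) = 1 / f t * (l * \<Phi> t)" by simp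
  also have "\<dots> = (LINT \<omega>|M. sin (l * X t \<omega>))" unfolding eq[symmetric] using ft by simp
  finally show ?thesis ..
qed

end

section \<open>The law of the modulus and conditional probabilities near zero\<close>

lemma integral_inverse_sqrt:
  fixes t :: real assumes t: "0 < t"
  shows "(\<integral>\<^sup>+s. ennreal (indicator {0<..<t} s / sqrt s) \<partial>lborel) = ennreal (2 * sqrt t)"
    and "set_integrable lborel {0<..<t} (\<lambda>s. 1 / sqrt s)"
    and "(LINT s:{0<..<t}|lborel. 1 / sqrt s) = 2 * sqrt t"
proof -
  have e0: "einterval (ereal 0) (ereal t) = {0<..<t}" by (auto simp: einterval_def)
  have A: "(((\<lambda>s. 2 * sqrt s) \<circ> real_of_ereal) \<longlongrightarrow> 2 * sqrt 0) (at_right (ereal 0))"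
    unfolding ereal_tendsto_simps by (intro tendsto_intros) 
  have B: "(((\<lambda>s. 2 * sqrt s) \<circ> real_of_ereal) \<longlongrightarrow> 2 * sqrt t) (at_left (ereal t))"
    unfolding ereal_tendsto_simps by (intro tendsto_intros)
  have D: "DERIV (\<lambda>s. 2 * sqrt s) x :> 1 / sqrt x" if "ereal 0 < ereal x" "ereal x < ereal t" for x
    using that by (auto intro!: derivative_eq_intros simp: field_simps)
  have c: "isCont (\<lambda>s. 1 / sqrt s) x" if "ereal 0 < ereal x" "ereal x < ereal t" for x
    using that by (intro continuous_intros) auto
  have nn: "AE x in lborel. ereal 0 < ereal x \<longrightarrow> ereal x < ereal t \<longrightarrow> 0 \<le> 1 / sqrt x" by simp
  have lt: "ereal 0 < ereal t" using t by simp
  note F = interval_integral_FTC_nonneg[where F="\<lambda>s. 2 * sqrt s" and f="\<lambda>s. 1 / sqrt s", OF lt D c nn A B]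
  show i: "set_integrable lborel {0<..<t} (\<lambda>s. 1 / sqrt s)" using F(1) unfolding e0 .
  show v: "(LINT s:{0<..<t}|lborel. 1 / sqrt s) = 2 * sqrt t"
    using F(2) t unfolding interval_lebesgue_integral_def e0 by simp
  have "(\<integral>\<^sup>+s. ennreal (indicator {0<..<t} s * (1 / sqrt s)) \<partial>lborel) = ennreal (2 * sqrt t)"
    using i v unfolding set_integrable_def set_lebesgue_integral_def
    by (subst nn_integral_eq_integral) (auto simp: indicator_def)
  then show "(\<integral>\<^sup>+s. ennreal (indicator {0<..<t} s / sqrt s) \<partial>lborel) = ennreal (2 * sqrt t)" by simp
qed

text \<open>A centred normal density decreases in the modulus of its argument, so on the interval it
  lies between its values at \<open>e\<close> and at 0. After division by \<open>2 * e\<close> the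
  two bounds merge as \<open>e\<close> tends to 0.\<close>

lemma normal_density_interval_bounds:
  fixes e \<sigma> :: real assumes e: "e > 0" and s: "\<sigma> > 0"
  shows "2 * e * normal_density 0 \<sigma> e \<le> (LINT x:{-e<..<e}|lborel. normal_density 0 \<sigma> x)"
    and "(LINT x:{-e<..<e}|lborel. normal_density 0 \<sigma> x) \<le> 2 * e * normal_density 0 \<sigma> 0"
proof -
  have i: "integrable lborel (\<lambda>x. indicator {-e<..<e} x *\<^sub>R normal_density 0 \<sigma> x)"
    by (rule integrable_mult_indicator) (use s in simp_all)
  have ic: "integrable lborel (\<lambda>x. indicator {-e<..<e} x *\<^sub>R (c::real))" for c using e by simp
  have v: "(LINT x|lborel. indicator {-e<..<e} x *\<^sub>R c) = 2 * e * c" for c :: real using e by simp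
  have "normal_density 0 \<sigma> e \<le> normal_density 0 \<sigma> x" if "x \<in> {-e<..<e}" for x
  proof -
    have "x\<^sup>2 \<le> e\<^sup>2" using that by (intro abs_le_square_iff[THEN iffD1]) auto
    then show ?thesis unfolding normal_density_def using s
      by (intro mult_left_mono) (auto intro!: divide_right_mono)
  qed
  then have "(LINT x|lborel. indicator {-e<..<e} x *\<^sub>R normal_density 0 \<sigma> e) \<le> (LINT x|lborel. indicator {-e<..<e} x *\<^sub>R normal_density 0 \<sigma> x)"
    by (intro integral_mono ic i) (auto simp: indicator_def)
  then show "2 * e * normal_density 0 \<sigma> e \<le> (LINT x:{-e<..<e}|lborel. normal_density 0 \<sigma> x)"
    unfolding v set_lebesgue_integral_def .
  have "normal_density 0 \<sigma> x \<le> normal_density 0 \<sigma> 0" for x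
    unfolding normal_density_def by (intro mult_left_mono) auto
  then have "(LINT x|lborel. indicator {-e<..<e} x *\<^sub>R normal_density 0 \<sigma> x) \<le> (LINT x|lborel. indicator {-e<..<e} x *\<^sub>R normal_density 0 \<sigma> 0)"
    by (intro integral_mono ic i) (auto simp: indicator_def)
  then show "(LINT x:{-e<..<e}|lborel. normal_density 0 \<sigma> x) \<le> 2 * e * normal_density 0 \<sigma> 0"
    unfolding v set_lebesgue_integral_def .
qed

text \<open>An even function of a random variable is integrated against the symmetrised law, which a
  fair coin independent of the variable realises.\<close>

lemma (in prob_space) abs_normal_of_cos:
  assumes X[measurable]: "X \<in> borel_measurable M" and s: "\<sigma> > 0"
    and c: "\<And>l. (LINT \<omega>|M. cos (l * X \<omega>)) = exp (- (l\<^sup>2 * \<sigma>\<^sup>2 / 2))"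
  shows "prob {\<omega>\<in>space M. X \<omega> \<in> {-e<..<e}} = (LINT x:{-e<..<e}|lborel. normal_density 0 \<sigma> x)"
proof -
  define C where "C = measure_pmf (pmf_of_set {1, -1 :: real})"
  interpret C: prob_space C unfolding C_def by (rule measure_pmf.prob_space_axioms)
  interpret P: pair_prob_space M C ..
  have sC: "sets C = UNIV" by (simp add: C_def)
  have [measurable]: "(\<lambda>x. x) \<in> borel_measurable C" by (simp add: C_def)
  define Z where "Z = (\<lambda>(\<omega>, x). X \<omega> * x)"
  have Z[measurable]: "Z \<in> borel_measurable (M \<Otimes>\<^sub>M C)" unfolding Z_def by measurable
  have E: "(LINT z|distr (M \<Otimes>\<^sub>M C) borel Z. h z) = (LINT \<omega>|M. (h (X \<omega>) + h (- X \<omega>)) / 2)"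
    if [measurable]: "h \<in> borel_measurable borel" and hb: "\<And>x. \<bar>h x\<bar> \<le> (1::real)" for h
  proof -
    have i: "integrable (M \<Otimes>\<^sub>M C) (\<lambda>p. h (Z p))"
      by (rule P.integrable_const_bound[of _ 1]) (use hb in auto)
    have "(LINT z|distr (M \<Otimes>\<^sub>M C) borel Z. h z) = (LINT p|(M \<Otimes>\<^sub>M C). h (Z p))" by (rule integral_distr) auto
    also have "\<dots> = (LINT \<omega>|M. (LINT x|C. h (Z (\<omega>, x))))" by (rule P.integral_fst'[OF i, symmetric])
    also have "\<dots> = (LINT \<omega>|M. (h (X \<omega>) + h (- X \<omega>)) / 2)"
    proof (rule Bochner_Integration.integral_cong[OF refl])
      fix \<omega>
      have "(LINT x|C. h (Z (\<omega>, x))) = sum (\<lambda>x. h (X \<omega> * x)) {1, -1} / real (card {1, -1 :: real})"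
        unfolding C_def Z_def by (subst integral_pmf_of_set) auto
      then show "(LINT x|C. h (Z (\<omega>, x))) = (h (X \<omega>) + h (- X \<omega>)) / 2" by simp
    qed
    finally show ?thesis .
  qed
  \<comment> \<open>The cosine means are those of the normal law by hypothesis, and the sine means
    vanish because the coin symmetrises; so \<open>X\<close> times the coin is normal.\<close>
  have D: "distr (M \<Otimes>\<^sub>M C) borel Z = density lborel (\<lambda>x. ennreal (normal_density 0 \<sigma> x))"
  proof (rule real_distribution_eqI_cos_sin)
    show "real_distribution (distr (M \<Otimes>\<^sub>M C) borel Z)" by (rule P.real_distribution_distr) (rule Z)
    show "real_distribution (density lborel (\<lambda>x. ennreal (normal_density 0 \<sigma> x)))"
      unfolding real_distribution_def real_distribution_axioms_def using prob_space_normal_density[OF s] by simp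
    note n = integral_normal_cos[OF s]
    show "(LINT x|distr (M \<Otimes>\<^sub>M C) borel Z. cos (l * x)) = (LINT x|density lborel (\<lambda>x. ennreal (normal_density 0 \<sigma> x)). cos (l * x))" for l
      using E[of "\<lambda>x. cos (l * x)"] c[of l] n(3)[of l] by (simp add: integral_density)
    show "(LINT x|distr (M \<Otimes>\<^sub>M C) borel Z. sin (l * x)) = (LINT x|density lborel (\<lambda>x. ennreal (normal_density 0 \<sigma> x)). sin (l * x))" for l
      using E[of "\<lambda>x. sin (l * x)"] n(4)[of l] by (simp add: integral_density)
  qed
  define J where "J = (indicator {-e<..<e} :: real \<Rightarrow> real)"
  have J[measurable]: "J \<in> borel_measurable borel" and Jb: "\<And>x. \<bar>J x\<bar> \<le> 1" and Je: "\<And>x. J (- x) = J x"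
    unfolding J_def by (auto simp: indicator_def)
  have "(LINT x|density lborel (\<lambda>x. ennreal (normal_density 0 \<sigma> x)). J x) = (LINT \<omega>|M. (J (X \<omega>) + J (- X \<omega>)) / 2)"
    by (rule E[unfolded D, OF J Jb])
  also have "\<dots> = (LINT \<omega>|M. indicator {\<omega>\<in>space M. X \<omega> \<in> {-e<..<e}} \<omega>)"
    unfolding Je by (rule Bochner_Integration.integral_cong[OF refl]) (simp add: J_def indicator_def)
  also have "\<dots> = prob {\<omega>\<in>space M. X \<omega> \<in> {-e<..<e}}"
    by (subst Bochner_Integration.integral_indicator) (auto intro!: arg_cong[where f=prob])
  finally have "prob {\<omega>\<in>space M. X \<omega> \<in> {-e<..<e}} = (LINT x|density lborel (\<lambda>x. ennreal (normal_density 0 \<sigma> x)). J x)" by (rule sym)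
  also have "\<dots> = (LINT x:{-e<..<e}|lborel. normal_density 0 \<sigma> x)"
    unfolding set_lebesgue_integral_def by (subst integral_density) (simp_all add: J_def mult.commute)
  finally show ?thesis .
qed

context skew_paths
begin

lemma X0: "AE \<omega> in M. X 0 \<omega> = 0"
  using paths by eventually_elim (rule skew_pathD(6))

lemma cos_mean:
  assumes t: "0 < t" shows "(LINT \<omega>|M. cos (l * X t \<omega>)) = exp (- (l\<^sup>2 * t / 2))"
proof -
  have [measurable]: "X 0 \<in> borel_measurable M" by simp
  have "(LINT \<omega>|M. indicator (space M) \<omega> * cos (l * X t \<omega>)) = exp (- (l\<^sup>2 * t / 2)) * (LINT \<omega>|M. indicator (space M) \<omega> * cos (l * X 0 \<omega>))"
    using cosine_martingale[OF order_refl t, of "space M" l] sets.top[of "F 0"] by (simp add: space_F)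
  moreover have "(LINT \<omega>|M. indicator (space M) \<omega> * h \<omega>) = (LINT \<omega>|M. h \<omega>)" for h :: "'a \<Rightarrow> real"
    by (intro Bochner_Integration.integral_cong) auto
  moreover have "(LINT \<omega>|M. cos (l * X 0 \<omega>)) = (LINT \<omega>|M. 1)"
    by (rule integral_cong_AE) (use X0 in \<open>auto elim!: eventually_mono\<close>)
  ultimately show ?thesis by (simp add: prob_space)
qed

lemma near_zero_prob:
  assumes t: "0 < t"
  shows "prob {\<omega>\<in>space M. X t \<omega> \<in> {-e<..<e}} = (LINT x:{-e<..<e}|lborel. normal_density 0 (sqrt t) x)"
  by (rule abs_normal_of_cos) (use t cos_mean[OF t] in simp_all)

text \<open>A Gaussian bump is a mixture of cosines, so the martingale property of the cosines controls
  the conditional probability of being near zero.\<close>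

lemma conditional_near_zero:
  assumes r: "0 \<le> r" "r < s" and e: "e > 0" and A: "A \<in> sets (F r)"
  shows "prob (A \<inter> {\<omega>\<in>space M. X s \<omega> \<in> {-e<..<e}}) \<le> 2 * e / sqrt (s - r) * prob A"
proof -
  \<comment> \<open>Standard deviation \<open>1 / e\<close> in frequency makes the cosine transform
    of \<open>n\<close> a Gaussian bump of width \<open>e\<close>.\<close>
  define n where "n = (\<lambda>l. normal_density 0 (1 / e) l)"
  have e1: "1 / e > 0" using e by simp
  have AM[measurable]: "A \<in> events" using A sets_F_subset by auto
  have Xm[measurable]: "X s \<in> borel_measurable M" "X r \<in> borel_measurable M" using r by auto
  have [measurable]: "n \<in> borel_measurable borel" unfolding n_def by simp
  have ni: "integrable lborel n" and n0: "n l \<ge> 0" for l unfolding n_def using e1 by simp_all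
  have bump: "exp (- (x\<^sup>2 / (2 * e\<^sup>2))) = (LINT l|lborel. n l * cos (l * x))" for x
    using integral_normal_cos(3)[OF e1, of x] by (simp add: n_def power_divide mult.commute)
  interpret Q: pair_sigma_finite M lborel ..
  have jm: "(\<lambda>(\<omega>, l). n l * (indicator A \<omega> * cos (l * X s \<omega>))) \<in> borel_measurable (M \<Otimes>\<^sub>M lborel)" by measurable
  have ji: "integrable (M \<Otimes>\<^sub>M lborel) (\<lambda>(\<omega>, l). n l * (indicator A \<omega> * cos (l * X s \<omega>)))"
  proof (rule Q.Fubini_integrable[OF jm])
    have b: "\<bar>n l * (indicator A \<omega> * cos (l * X s \<omega>))\<bar> \<le> n l" for l \<omega>
      using n0[of l] by (auto simp: abs_mult indicator_def intro: mult_left_le)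
    have il: "integrable lborel (\<lambda>l. n l * (indicator A \<omega> * cos (l * X s \<omega>)))" for \<omega>
      by (rule Bochner_Integration.integrable_bound[OF ni]) (use b n0 in auto)
    show "AE \<omega> in M. integrable lborel (\<lambda>l. case (\<omega>, l) of (\<omega>, l) \<Rightarrow> n l * (indicator A \<omega> * cos (l * X s \<omega>)))"
      using il by simp
    show "integrable M (\<lambda>\<omega>. LINT l|lborel. norm (case (\<omega>, l) of (\<omega>, l) \<Rightarrow> n l * (indicator A \<omega> * cos (l * X s \<omega>))))"
    proof (rule integrable_const_bound[where B="LINT l|lborel. n l", OF AE_I2])
      fix \<omega>
      have "(LINT l|lborel. \<bar>n l * (indicator A \<omega> * cos (l * X s \<omega>))\<bar>) \<le> (LINT l|lborel. n l)"
        by (rule integral_mono[OF integrable_abs[OF il] ni b])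
      moreover have "0 \<le> (LINT l|lborel. \<bar>n l * (indicator A \<omega> * cos (l * X s \<omega>))\<bar>)"
        by (rule Bochner_Integration.integral_nonneg) simp
      ultimately show "norm (LINT l|lborel. norm (case (\<omega>, l) of (\<omega>, l) \<Rightarrow> n l * (indicator A \<omega> * cos (l * X s \<omega>)))) \<le> (LINT l|lborel. n l)"
        by (simp only: prod.case real_norm_def abs_of_nonneg)
    qed measurable
  qed
  have v: "sqrt (s - r) > 0" using r by simp
  \<comment> \<open>Bounding \<open>n\<close> by its maximum \<open>e / sqrt (2 * pi)\<close> gives
    up its decay, but the martingale factor still decays in \<open>l\<close>: it is an unnormalised
    normal density of variance \<open>1 / (s - r)\<close>. The price is the constant
    \<open>e / sqrt (s - r)\<close>.\<close>
  have gb: "n l * exp (- (l\<^sup>2 * (s - r) / 2)) \<le> e / sqrt (s - r) * normal_density 0 (1 / sqrt (s - r)) l" for l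
  proof -
    have "n l \<le> e / sqrt (2 * pi)"
    proof -
      have "n l = 1 / sqrt (2 * pi * (1 / e)\<^sup>2) * exp (- (l - 0)\<^sup>2 / (2 * (1 / e)\<^sup>2))" unfolding n_def normal_density_def ..
      also have "\<dots> \<le> 1 / sqrt (2 * pi * (1 / e)\<^sup>2) * 1" by (intro mult_left_mono) auto
      also have "\<dots> = e / sqrt (2 * pi)" using e by (simp add: real_sqrt_mult real_sqrt_divide power_divide)
      finally show ?thesis .
    qed
    then have "n l * exp (- (l\<^sup>2 * (s - r) / 2)) \<le> e / sqrt (2 * pi) * exp (- (l\<^sup>2 * (s - r) / 2))"
      by (intro mult_right_mono) auto
    also have "\<dots> = e / sqrt (s - r) * normal_density 0 (1 / sqrt (s - r)) l"
      unfolding normal_density_def using v r e by (simp add: real_sqrt_mult real_sqrt_divide power_divide)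
    finally show ?thesis .
  qed
  have iX: "integrable M (\<lambda>\<omega>. indicator A \<omega> * exp (- ((X s \<omega>)\<^sup>2 / (2 * e\<^sup>2))))"
    by (rule integrable_const_bound[where B=1, OF AE_I2]) (auto simp: indicator_def)
  have "(LINT \<omega>|M. indicator A \<omega> * exp (- ((X s \<omega>)\<^sup>2 / (2 * e\<^sup>2)))) = (LINT \<omega>|M. (LINT l|lborel. n l * (indicator A \<omega> * cos (l * X s \<omega>))))"
    unfolding bump integral_mult_right_zero[symmetric] by (simp only: mult.left_commute)
  also have "\<dots> = (LINT l|lborel. (LINT \<omega>|M. n l * (indicator A \<omega> * cos (l * X s \<omega>))))"
    using Q.Fubini_integral[of "\<lambda>\<omega> l. n l * (indicator A \<omega> * cos (l * X s \<omega>))"] ji by simp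
  also have "\<dots> = (LINT l|lborel. n l * (exp (- (l\<^sup>2 * (s - r) / 2)) * (LINT \<omega>|M. indicator A \<omega> * cos (l * X r \<omega>))))"
    unfolding integral_mult_right_zero cosine_martingale[OF r A] ..
  also have "\<dots> \<le> (LINT l|lborel. e / sqrt (s - r) * normal_density 0 (1 / sqrt (s - r)) l * prob A)"
  proof (rule integral_mono')
    show "integrable lborel (\<lambda>l. e / sqrt (s - r) * normal_density 0 (1 / sqrt (s - r)) l * prob A)" using v by simp
    fix l
    have "(LINT \<omega>|M. indicator A \<omega> * cos (l * X r \<omega>)) \<le> (LINT \<omega>|M. indicator A \<omega>)"
    proof (rule integral_mono)
      show "integrable M (\<lambda>\<omega>. indicator A \<omega> * cos (l * X r \<omega>))"
        by (rule integrable_const_bound[where B=1, OF AE_I2]) (auto simp: indicator_def)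
      show "integrable M (indicator A :: 'a \<Rightarrow> real)" by (rule integrable_const_bound[where B=1, OF AE_I2]) (auto simp: indicator_def)
    qed (auto simp: indicator_def)
    also have "\<dots> = prob A" by (subst Bochner_Integration.integral_indicator) (simp add: Int_absorb2 sets.sets_into_space)
    finally have 1: "(LINT \<omega>|M. indicator A \<omega> * cos (l * X r \<omega>)) \<le> prob A" .
    have "n l * (exp (- (l\<^sup>2 * (s - r) / 2)) * (LINT \<omega>|M. indicator A \<omega> * cos (l * X r \<omega>))) \<le> n l * exp (- (l\<^sup>2 * (s - r) / 2)) * prob A"
      unfolding mult.assoc[symmetric] using n0[of l] by (intro mult_left_mono 1) simp
    also have "\<dots> \<le> e / sqrt (s - r) * normal_density 0 (1 / sqrt (s - r)) l * prob A"
      by (intro mult_right_mono gb) simp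
    finally show "n l * (exp (- (l\<^sup>2 * (s - r) / 2)) * (LINT \<omega>|M. indicator A \<omega> * cos (l * X r \<omega>))) \<le> e / sqrt (s - r) * normal_density 0 (1 / sqrt (s - r)) l * prob A" .
    show "0 \<le> e / sqrt (s - r) * normal_density 0 (1 / sqrt (s - r)) l * prob A" using e v by simp
  qed
  also have "\<dots> = e / sqrt (s - r) * prob A"
    using integral_normal_density[of "1 / sqrt (s - r)" 0] v by simp
  finally have G: "(LINT \<omega>|M. indicator A \<omega> * exp (- ((X s \<omega>)\<^sup>2 / (2 * e\<^sup>2)))) \<le> e / sqrt (s - r) * prob A" .
  define B where "B = A \<inter> {\<omega>\<in>space M. X s \<omega> \<in> {-e<..<e}}"
  have BM: "B \<in> events" unfolding B_def by measurable
  have "prob B = (LINT \<omega>|M. indicator B \<omega>)"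
    using BM by (subst Bochner_Integration.integral_indicator) (simp add: Int_absorb2 sets.sets_into_space)
  also have "\<dots> \<le> (LINT \<omega>|M. 2 * (indicator A \<omega> * exp (- ((X s \<omega>)\<^sup>2 / (2 * e\<^sup>2)))))"
  proof (rule integral_mono)
    show "integrable M (indicator B :: 'a \<Rightarrow> real)" by (rule integrable_const_bound[where B=1, OF AE_I2]) (use BM in \<open>auto simp: indicator_def\<close>)
    show "integrable M (\<lambda>\<omega>. 2 * (indicator A \<omega> * exp (- ((X s \<omega>)\<^sup>2 / (2 * e\<^sup>2)))))" using iX by simp
    fix \<omega>
    \<comment> \<open>Inside the interval the exponent is at least \<open>- (1/2)\<close>, and
      \<open>1 + z \<le> exp z\<close> keeps the bump above \<open>1/2\<close>; this is the factor 2
      in the estimate.\<close>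
    have "1 \<le> 2 * exp (- (x\<^sup>2 / (2 * e\<^sup>2)))" if "x \<in> {-e<..<e}" for x
    proof -
      have "x\<^sup>2 \<le> e\<^sup>2" using that by (intro abs_le_square_iff[THEN iffD1]) auto
      then have "- (1/2) \<le> - (x\<^sup>2 / (2 * e\<^sup>2))" using e by (simp add: field_simps)
      moreover have "1 + - (x\<^sup>2 / (2 * e\<^sup>2)) \<le> exp (- (x\<^sup>2 / (2 * e\<^sup>2)))" by (rule exp_ge_add_one_self)
      ultimately show ?thesis by linarith
    qed
    then show "indicator B \<omega> \<le> 2 * (indicator A \<omega> * exp (- ((X s \<omega>)\<^sup>2 / (2 * e\<^sup>2))))"
      by (simp add: B_def indicator_def)
  qed
  also have "\<dots> = 2 * (LINT \<omega>|M. indicator A \<omega> * exp (- ((X s \<omega>)\<^sup>2 / (2 * e\<^sup>2))))" by simp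
  also have "\<dots> \<le> 2 * e / sqrt (s - r) * prob A" using G by simp
  finally show ?thesis unfolding B_def .
qed

end

section \<open>Occupation times and their moments\<close>

text \<open>Rounding time down to multiples of \<open>1 / Suc n\<close> patches together countably
  many of the random variables \<open>Y s\<close>, which is jointly measurable; continuity gives the
  process as the limit.\<close>

lemma continuous_process_jointly_measurable:
  fixes Y :: "real \<Rightarrow> 'a \<Rightarrow> real"
  assumes [measurable]: "\<And>s. Y s \<in> borel_measurable M" and c: "\<And>\<omega>. \<omega> \<in> space M \<Longrightarrow> continuous_on UNIV (\<lambda>s. Y s \<omega>)"
  shows "(\<lambda>p::real \<times> 'a. Y (fst p) (snd p)) \<in> borel_measurable (borel \<Otimes>\<^sub>M M)"
proof (rule borel_measurable_LIMSEQ_real)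
  fix n :: nat
  have g: "(\<lambda>p::real \<times> 'a. \<lfloor>fst p * real (Suc n)\<rfloor>) \<in> (borel \<Otimes>\<^sub>M M) \<rightarrow>\<^sub>M count_space UNIV" by measurable
  show "(\<lambda>p::real \<times> 'a. Y (real_of_int \<lfloor>fst p * real (Suc n)\<rfloor> / real (Suc n)) (snd p)) \<in> borel_measurable (borel \<Otimes>\<^sub>M M)"
    by (rule measurable_compose_countable[where f="\<lambda>i (p::real \<times> 'a). Y (real_of_int i / real (Suc n)) (snd p)", OF _ g]) measurable
next
  fix p :: "real \<times> 'a" assume "p \<in> space (borel \<Otimes>\<^sub>M M)"
  then have "snd p \<in> space M" by (auto simp: space_pair_measure)
  from continuous_on_tendsto_compose[OF c[OF this] scaled_floor_tendsto[of "fst p"]]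
  show "(\<lambda>n. Y (real_of_int \<lfloor>fst p * real (Suc n)\<rfloor> / real (Suc n)) (snd p)) \<longlonglongrightarrow> Y (fst p) (snd p)" by simp
qed

context skew_paths
begin

text \<open>The set on which all path properties hold need not be measurable, as the space is not
  assumed complete. One measurable set of full probability inside it is fixed once and for all, so
  that the processes below are regular at every sample point.\<close>

definition good :: "'a set" where
  "good = (SOME G. G \<in> sets M \<and> (AE \<omega> in M. \<omega> \<in> G) \<and> (\<forall>\<omega>\<in>G. skew_path (\<lambda>s. W s \<omega>) (\<lambda>s. X s \<omega>) (\<lambda>s. L s \<omega>)))"

lemma good: "good \<in> sets M" "AE \<omega> in M. \<omega> \<in> good" "\<And>\<omega>. \<omega> \<in> good \<Longrightarrow> skew_path (\<lambda>s. W s \<omega>) (\<lambda>s. X s \<omega>) (\<lambda>s. L s \<omega>)"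
proof -
  obtain N where N: "{\<omega>\<in>space M. \<not> skew_path (\<lambda>s. W s \<omega>) (\<lambda>s. X s \<omega>) (\<lambda>s. L s \<omega>)} \<subseteq> N" "emeasure M N = 0" "N \<in> sets M"
    by (rule AE_E[OF paths])
  have "AE \<omega> in M. \<omega> \<notin> N" by (rule AE_not_in) (use N in \<open>auto simp: null_sets_def\<close>)
  then have "AE \<omega> in M. \<omega> \<in> space M - N" using AE_space by eventually_elim simp
  then have "\<exists>G. G \<in> sets M \<and> (AE \<omega> in M. \<omega> \<in> G) \<and> (\<forall>\<omega>\<in>G. skew_path (\<lambda>s. W s \<omega>) (\<lambda>s. X s \<omega>) (\<lambda>s. L s \<omega>))"
    using N by (intro exI[of _ "space M - N"]) auto
  from someI_ex[OF this] have G: "good \<in> sets M \<and> (AE \<omega> in M. \<omega> \<in> good) \<and> (\<forall>\<omega>\<in>good. skew_path (\<lambda>s. W s \<omega>) (\<lambda>s. X s \<omega>) (\<lambda>s. L s \<omega>))"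
    unfolding good_def .
  show "good \<in> sets M" "AE \<omega> in M. \<omega> \<in> good" using G by simp_all
  show "skew_path (\<lambda>s. W s \<omega>) (\<lambda>s. X s \<omega>) (\<lambda>s. L s \<omega>)" if "\<omega> \<in> good" for \<omega> using G that by simp
qed

text \<open>Versions of \<open>X\<close> and \<open>L\<close> that behave well at every sample point
  and are frozen before time 0, as joint measurability of \<open>Y\<close> and the measure
  \<open>dK\<close> demand. \<open>good\<close> is only known to lie in \<open>M\<close>, so
  adaptedness may be lost and conditional estimates go back to \<open>X\<close>.\<close>

definition Y :: "real \<Rightarrow> 'a \<Rightarrow> real" where "Y s \<omega> = (if \<omega> \<in> good then X (max 0 s) \<omega> else 0)"
definition K :: "real \<Rightarrow> 'a \<Rightarrow> real" where "K s \<omega> = (if \<omega> \<in> good then L (max 0 s) \<omega> else 0)"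

lemma Y_measurable[measurable]: "Y s \<in> borel_measurable M"
  unfolding Y_def[abs_def] using good(1) by (intro measurable_If_set X_measurable) auto

lemma K_measurable[measurable]: "K s \<in> borel_measurable M"
  unfolding K_def[abs_def] using good(1) by (intro measurable_If_set L_measurable) auto

lemma K_path: "continuous_on {0..} (\<lambda>s. K s \<omega>)" "mono_on {0..} (\<lambda>s. K s \<omega>)" "K 0 \<omega> = 0" "0 \<le> s \<Longrightarrow> 0 \<le> K s \<omega>"
proof -
  have "continuous_on {0..} (\<lambda>s. K s \<omega>) \<and> mono_on {0..} (\<lambda>s. K s \<omega>) \<and> K 0 \<omega> = 0 \<and> (\<forall>s\<ge>0. 0 \<le> K s \<omega>)"
  proof (cases "\<omega> \<in> good")
    case True
    note sp = skew_pathD[OF good(3)[OF True]]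
    have K: "K s \<omega> = L s \<omega>" if "s \<ge> 0" for s using that True by (simp add: K_def)
    have "continuous_on {0..} (\<lambda>s. K s \<omega>)" using sp(3) by (rule continuous_on_eq) (simp add: K)
    moreover have "mono_on {0..} (\<lambda>s. K s \<omega>)" using sp(4) unfolding mono_on_def by (simp add: K)
    ultimately show ?thesis using sp(5,10) by (simp add: K)
  qed (simp add: K_def mono_on_def)
  then show "continuous_on {0..} (\<lambda>s. K s \<omega>)" "mono_on {0..} (\<lambda>s. K s \<omega>)" "K 0 \<omega> = 0" "0 \<le> s \<Longrightarrow> 0 \<le> K s \<omega>" by simp_all
qed

lemma Y_joint: "(\<lambda>p. Y (fst p) (snd p)) \<in> borel_measurable (borel \<Otimes>\<^sub>M M)"
proof (rule continuous_process_jointly_measurable[OF Y_measurable])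
  fix \<omega>
  show "continuous_on UNIV (\<lambda>s. Y s \<omega>)"
  proof (cases "\<omega> \<in> good")
    case True
    have "continuous_on UNIV (\<lambda>s. X (max 0 s) \<omega>)"
      by (rule continuous_on_compose2[OF skew_pathD(2)[OF good(3)[OF True]]]) (auto intro!: continuous_intros)
    then show ?thesis using True by (simp add: Y_def)
  qed (simp add: Y_def)
qed

lemma Y_eq: "0 \<le> s \<Longrightarrow> AE \<omega> in M. Y s \<omega> = X s \<omega>"
  using good(2) by eventually_elim (simp add: Y_def)

context
  fixes t e :: real assumes t: "0 < t" and e: "0 < e"
begin

text \<open>Values in \<open>ennreal\<close> let Tonelli apply directly; time 0, where the law of
  \<open>Y\<close> is degenerate, is left out.\<close>

definition occ :: "'a \<Rightarrow> ennreal" where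
  "occ \<omega> = (\<integral>\<^sup>+s. indicator {0<..<t} s * indicator {-e<..<e} (Y s \<omega>) \<partial>lborel)"

lemma near_measurable: "(\<lambda>p. indicator {0<..<t} (fst p) * indicator {-e<..<e} (Y (fst p) (snd p)) :: ennreal) \<in> borel_measurable (lborel \<Otimes>\<^sub>M M)"
proof -
  have [measurable]: "(\<lambda>p. Y (fst p) (snd p)) \<in> borel_measurable (lborel \<Otimes>\<^sub>M M)"
    using Y_joint by (simp cong: measurable_cong_sets)
  show ?thesis by measurable
qed

lemma near_measurable2: "(\<lambda>p. indicator {0<..<t} (snd p) * indicator {-e<..<e} (Y (snd p) (fst p)) :: ennreal) \<in> borel_measurable (M \<Otimes>\<^sub>M lborel)"
  using measurable_compose[OF measurable_pair_swap'[of M lborel] near_measurable] by (simp add: case_prod_beta')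

lemma occ_measurable[measurable]: "occ \<in> borel_measurable M"
proof -
  show ?thesis
    unfolding occ_def[abs_def]
    by (rule lborel.borel_measurable_nn_integral[of "\<lambda>\<omega> s. indicator {0<..<t} s * indicator {-e<..<e} (Y s \<omega>)"])
      (use near_measurable2 in \<open>simp add: case_prod_beta'\<close>)
qed

lemma occ_le: "occ \<omega> \<le> ennreal t"
proof -
  have "occ \<omega> \<le> (\<integral>\<^sup>+s. indicator {0<..<t} s \<partial>lborel)"
    unfolding occ_def by (rule nn_integral_mono) (simp add: indicator_def)
  then show ?thesis using t by simp
qed

lemma near_expectation: "(\<integral>\<^sup>+\<omega>. indicator {-e<..<e} (Y s \<omega>) \<partial>M) = ennreal (prob {\<omega>\<in>space M. Y s \<omega> \<in> {-e<..<e}})"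
proof -
  have "(\<integral>\<^sup>+\<omega>. indicator {-e<..<e} (Y s \<omega>) \<partial>M) = (\<integral>\<^sup>+\<omega>. indicator {\<omega>\<in>space M. Y s \<omega> \<in> {-e<..<e}} \<omega> \<partial>M)"
    by (rule nn_integral_cong) (simp add: indicator_def)
  then show ?thesis by (simp add: emeasure_eq_measure)
qed

lemma Y_prob:
  assumes "0 < s" shows "prob {\<omega>\<in>space M. Y s \<omega> \<in> {-e<..<e}} = (LINT x:{-e<..<e}|lborel. normal_density 0 (sqrt s) x)"
proof -
  have [measurable]: "X s \<in> borel_measurable M" using assms by simp
  have "prob {\<omega>\<in>space M. Y s \<omega> \<in> {-e<..<e}} = prob {\<omega>\<in>space M. X s \<omega> \<in> {-e<..<e}}"
    by (rule prob_eq_AE) (use Y_eq[of s] assms in \<open>auto elim!: eventually_mono\<close>)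
  then show ?thesis using near_zero_prob[OF assms] by simp
qed

lemma occ_mean: "(\<integral>\<^sup>+\<omega>. occ \<omega> \<partial>M) = (\<integral>\<^sup>+s. indicator {0<..<t} s * ennreal (LINT x:{-e<..<e}|lborel. normal_density 0 (sqrt s) x) \<partial>lborel)"
proof -
  interpret Q: pair_sigma_finite M "lborel :: real measure" ..
  have "(\<integral>\<^sup>+\<omega>. occ \<omega> \<partial>M) = (\<integral>\<^sup>+s. (\<integral>\<^sup>+\<omega>. indicator {0<..<t} s * indicator {-e<..<e} (Y s \<omega>) \<partial>M) \<partial>lborel)"
    unfolding occ_def
    by (rule Q.Fubini'[of "\<lambda>\<omega> s. indicator {0<..<t} s * indicator {-e<..<e} (Y s \<omega>)", symmetric])
      (use near_measurable2 in \<open>simp add: case_prod_beta'\<close>)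
  also have "\<dots> = (\<integral>\<^sup>+s. indicator {0<..<t} s * ennreal (LINT x:{-e<..<e}|lborel. normal_density 0 (sqrt s) x) \<partial>lborel)"
  proof (rule nn_integral_cong)
    fix s
    have "(\<integral>\<^sup>+\<omega>. indicator {0<..<t} s * indicator {-e<..<e} (Y s \<omega>) \<partial>M) = indicator {0<..<t} s * ennreal (prob {\<omega>\<in>space M. Y s \<omega> \<in> {-e<..<e}})"
      by (subst nn_integral_cmult) (simp_all add: near_expectation)
    then show "(\<integral>\<^sup>+\<omega>. indicator {0<..<t} s * indicator {-e<..<e} (Y s \<omega>) \<partial>M) = indicator {0<..<t} s * ennreal (LINT x:{-e<..<e}|lborel. normal_density 0 (sqrt s) x)"
      using Y_prob[of s] by (cases "s \<in> {0<..<t}") auto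
  qed
  finally show ?thesis .
qed

text \<open>The conditional estimate is used twice: at time \<open>r\<close> given
  \<open>F 0\<close>, and at time \<open>s\<close> given the event at time \<open>r\<close>. Each
  use contributes a factor \<open>2 * e\<close>, the scaling that keeps \<open>occ\<close> divided
  by \<open>2 * e\<close> bounded in mean square.\<close>

lemma pair_near:
  assumes "0 < r" "r < s"
  shows "prob {\<omega>\<in>space M. Y r \<omega> \<in> {-e<..<e} \<and> Y s \<omega> \<in> {-e<..<e}} \<le> (2 * e)\<^sup>2 * (1 / sqrt r * (1 / sqrt (s - r)))"
proof -
  have [measurable]: "X s \<in> borel_measurable M" "X r \<in> borel_measurable M" using assms by auto
  let ?A = "{\<omega>\<in>space M. X r \<omega> \<in> {-e<..<e}}" and ?B = "{\<omega>\<in>space M. X s \<omega> \<in> {-e<..<e}}"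
  have "AE \<omega> in M. Y r \<omega> = X r \<omega>" "AE \<omega> in M. Y s \<omega> = X s \<omega>" using Y_eq assms by auto
  then have "AE \<omega> in M. (Y r \<omega> \<in> {-e<..<e} \<and> Y s \<omega> \<in> {-e<..<e}) = (X r \<omega> \<in> {-e<..<e} \<and> X s \<omega> \<in> {-e<..<e})"
    by eventually_elim simp
  then have "prob {\<omega>\<in>space M. Y r \<omega> \<in> {-e<..<e} \<and> Y s \<omega> \<in> {-e<..<e}} = prob {\<omega>\<in>space M. X r \<omega> \<in> {-e<..<e} \<and> X s \<omega> \<in> {-e<..<e}}"
    by (rule prob_eq_AE) measurable
  also have "{\<omega>\<in>space M. X r \<omega> \<in> {-e<..<e} \<and> X s \<omega> \<in> {-e<..<e}} = ?A \<inter> ?B" by blast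
  \<comment> \<open>This is the reason for returning from \<open>Y\<close> to the adapted process
    \<open>X\<close>.\<close>
  also have A: "?A \<in> sets (F r)"
    using X_adapted[of r] assms by (auto intro!: measurable_sets_Collect simp: space_F[symmetric, of r])
  have "prob (?A \<inter> ?B) \<le> 2 * e / sqrt (s - r) * prob ?A"
    by (rule conditional_near_zero[OF _ _ e A]) (use assms in auto)
  also have "prob ?A \<le> 2 * e / sqrt r"
  proof -
    have "prob (space M \<inter> ?A) \<le> 2 * e / sqrt (r - 0) * prob (space M)"
      by (rule conditional_near_zero[OF _ _ e]) (use assms sets.top[of "F 0"] in \<open>auto simp: space_F\<close>)
    moreover have "space M \<inter> ?A = ?A" by auto
    ultimately show ?thesis by (simp add: prob_space)
  qed
  then have "2 * e / sqrt (s - r) * prob ?A \<le> 2 * e / sqrt (s - r) * (2 * e / sqrt r)"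
    using e assms by (intro mult_left_mono) auto
  also have "\<dots> = (2 * e)\<^sup>2 * (1 / sqrt r * (1 / sqrt (s - r)))" by (simp add: power2_eq_square)
  finally show ?thesis .
qed

text \<open>The square is a double integral over two times. Each order of the times contributes at
  most \<open>(2 * e)\<^sup>2\<close> times the square of \<open>2 * sqrt t\<close>, the integral of
  \<open>1 / sqrt s\<close> over \<open>{0<..<t}\<close>; the two orders together give
  \<open>8 * t\<close>.\<close>

lemma occ_second_moment: "(\<integral>\<^sup>+\<omega>. occ \<omega> * occ \<omega> \<partial>M) \<le> ennreal ((2 * e)\<^sup>2 * (8 * t))"
proof -
  interpret Q: pair_sigma_finite M "lborel :: real measure" ..
  interpret P: pair_sigma_finite "M \<Otimes>\<^sub>M (lborel :: real measure)" "lborel :: real measure" ..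
  let ?u = "\<lambda>\<omega> s. indicator {0<..<t} s * indicator {-e<..<e} (Y s \<omega>) :: ennreal"
  \<comment> \<open>Since \<open>c\<close> vanishes outside \<open>{0<..<t}\<close>, the factor
    \<open>c (s - r)\<close> encodes \<open>r < s\<close> and can be integrated over the whole line
    by translation.\<close>
  define c where "c s = ennreal (indicator {0<..<t} s / sqrt s)" for s :: real
  have cm[measurable]: "c \<in> borel_measurable borel" unfolding c_def[abs_def] by measurable
  have ci: "(\<integral>\<^sup>+s. c s \<partial>lborel) = ennreal (2 * sqrt t)" unfolding c_def by (rule integral_inverse_sqrt[OF t])
  have um: "(\<lambda>p. ?u (fst p) (snd p)) \<in> borel_measurable (M \<Otimes>\<^sub>M lborel)" by (rule near_measurable2)
  have us: "?u \<omega> \<in> borel_measurable borel" if "\<omega> \<in> space M" for \<omega>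
    using measurable_Pair2[OF um that] by simp
  have uo: "(\<lambda>\<omega>. ?u \<omega> s) \<in> borel_measurable M" for s by measurable
  have m2: "(\<lambda>p. ?u (fst p) s * ?u (fst p) (snd p)) \<in> borel_measurable (M \<Otimes>\<^sub>M lborel)" for s
    using um by measurable
  have m1: "(\<lambda>p. occ (fst p) * ?u (fst p) (snd p)) \<in> borel_measurable (M \<Otimes>\<^sub>M lborel)"
    using um by measurable
  have ou: "(\<integral>\<^sup>+s. ?u \<omega> s \<partial>lborel) = occ \<omega>" for \<omega> unfolding occ_def ..
  have "(\<integral>\<^sup>+\<omega>. occ \<omega> * occ \<omega> \<partial>M) = (\<integral>\<^sup>+\<omega>. (\<integral>\<^sup>+r. occ \<omega> * ?u \<omega> r \<partial>lborel) \<partial>M)"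
    by (rule nn_integral_cong) (subst nn_integral_cmult, simp_all add: us ou)
  also have "\<dots> = (\<integral>\<^sup>+r. (\<integral>\<^sup>+\<omega>. occ \<omega> * ?u \<omega> r \<partial>M) \<partial>lborel)"
    by (rule Q.Fubini'[of "\<lambda>\<omega> r. occ \<omega> * ?u \<omega> r", symmetric]) (use m1 in \<open>simp add: case_prod_beta'\<close>)
  also have "\<dots> = (\<integral>\<^sup>+r. (\<integral>\<^sup>+s. (\<integral>\<^sup>+\<omega>. ?u \<omega> r * ?u \<omega> s \<partial>M) \<partial>lborel) \<partial>lborel)"
  proof (rule nn_integral_cong)
    fix r
    have "(\<integral>\<^sup>+\<omega>. occ \<omega> * ?u \<omega> r \<partial>M) = (\<integral>\<^sup>+\<omega>. (\<integral>\<^sup>+s. ?u \<omega> r * ?u \<omega> s \<partial>lborel) \<partial>M)"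
      by (rule nn_integral_cong) (subst nn_integral_cmult, simp_all add: us ou mult.commute)
    also have "\<dots> = (\<integral>\<^sup>+s. (\<integral>\<^sup>+\<omega>. ?u \<omega> r * ?u \<omega> s \<partial>M) \<partial>lborel)"
      by (rule Q.Fubini'[of "\<lambda>\<omega> s. ?u \<omega> r * ?u \<omega> s", symmetric]) (use m2 in \<open>simp add: case_prod_beta'\<close>)
    finally show "(\<integral>\<^sup>+\<omega>. occ \<omega> * ?u \<omega> r \<partial>M) = (\<integral>\<^sup>+s. (\<integral>\<^sup>+\<omega>. ?u \<omega> r * ?u \<omega> s \<partial>M) \<partial>lborel)" .
  qed
  also have "\<dots> \<le> (\<integral>\<^sup>+r. (\<integral>\<^sup>+s. ennreal ((2 * e)\<^sup>2) * (c r * c (s - r) + c s * c (r - s)) \<partial>lborel) \<partial>lborel)"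
  proof (rule nn_integral_mono)
    fix r :: real
    show "(\<integral>\<^sup>+s. (\<integral>\<^sup>+\<omega>. ?u \<omega> r * ?u \<omega> s \<partial>M) \<partial>lborel) \<le> (\<integral>\<^sup>+s. ennreal ((2 * e)\<^sup>2) * (c r * c (s - r) + c s * c (r - s)) \<partial>lborel)"
    proof (rule nn_integral_mono_AE)
      \<comment> \<open>Only the product belonging to the actual order of \<open>r\<close> and
        \<open>s\<close> is needed as a bound; the diagonal is a null set.\<close>
      show "AE s in lborel. (\<integral>\<^sup>+\<omega>. ?u \<omega> r * ?u \<omega> s \<partial>M) \<le> ennreal ((2 * e)\<^sup>2) * (c r * c (s - r) + c s * c (r - s))"
        using AE_lborel_singleton[of r]
      proof eventually_elim
        case (elim s)
        have b: "(\<integral>\<^sup>+\<omega>. ?u \<omega> r * ?u \<omega> s \<partial>M) \<le> ennreal ((2 * e)\<^sup>2) * (c r * c (s - r))" if rs: "r < s" "r \<in> {0<..<t}" "s \<in> {0<..<t}" for r s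
        proof -
          have "(\<integral>\<^sup>+\<omega>. ?u \<omega> r * ?u \<omega> s \<partial>M) = (\<integral>\<^sup>+\<omega>. indicator {\<omega>\<in>space M. Y r \<omega> \<in> {-e<..<e} \<and> Y s \<omega> \<in> {-e<..<e}} \<omega> \<partial>M)"
            by (rule nn_integral_cong) (use rs in \<open>simp add: indicator_def\<close>)
          also have "\<dots> = ennreal (prob {\<omega>\<in>space M. Y r \<omega> \<in> {-e<..<e} \<and> Y s \<omega> \<in> {-e<..<e}})"
            by (simp add: emeasure_eq_measure)
          also have "\<dots> \<le> ennreal ((2 * e)\<^sup>2 * (1 / sqrt r * (1 / sqrt (s - r))))"
            by (rule ennreal_leI[OF pair_near]) (use rs in auto)
          also have "\<dots> = ennreal ((2 * e)\<^sup>2) * (c r * c (s - r))"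
            unfolding c_def using rs by (simp add: ennreal_mult'[symmetric] indicator_def)
          finally show ?thesis .
        qed
        show ?case
        proof (cases "r \<in> {0<..<t} \<and> s \<in> {0<..<t}")
          case True
          show ?thesis
          proof (cases "r < s")
            case True2: True
            show ?thesis by (rule order_trans[OF b[OF True2]]) (use True in \<open>auto intro!: mult_left_mono\<close>)
          next
            case False
            then have "s < r" using elim by simp
            have "(\<integral>\<^sup>+\<omega>. ?u \<omega> r * ?u \<omega> s \<partial>M) = (\<integral>\<^sup>+\<omega>. ?u \<omega> s * ?u \<omega> r \<partial>M)" by (simp only: mult.commute)
            also have "\<dots> \<le> ennreal ((2 * e)\<^sup>2) * (c s * c (r - s))" by (rule b[OF \<open>s < r\<close>]) (use True in auto)
            also have "\<dots> \<le> ennreal ((2 * e)\<^sup>2) * (c r * c (s - r) + c s * c (r - s))" by (intro mult_left_mono) auto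
            finally show ?thesis .
          qed
        next
          case False
          then have "(\<integral>\<^sup>+\<omega>. ?u \<omega> r * ?u \<omega> s \<partial>M) = 0" by (auto simp: indicator_def)
          then show ?thesis by simp
        qed
      qed
    qed
  qed
  also have "\<dots> = ennreal ((2 * e)\<^sup>2) * ((\<integral>\<^sup>+r. (\<integral>\<^sup>+s. c r * c (s - r) \<partial>lborel) \<partial>lborel) + (\<integral>\<^sup>+r. (\<integral>\<^sup>+s. c s * c (r - s) \<partial>lborel) \<partial>lborel))"
    by (simp add: nn_integral_cmult nn_integral_add del: nn_integral_cmult_indicator)
  also have "(\<integral>\<^sup>+r. (\<integral>\<^sup>+s. c s * c (r - s) \<partial>lborel) \<partial>lborel) = (\<integral>\<^sup>+s. (\<integral>\<^sup>+r. c s * c (r - s) \<partial>lborel) \<partial>lborel)"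
    by (rule lborel_pair.Fubini') measurable
  also have "(\<integral>\<^sup>+r. (\<integral>\<^sup>+s. c r * c (s - r) \<partial>lborel) \<partial>lborel) = ennreal (2 * sqrt t) * ennreal (2 * sqrt t)"
  proof -
    have "(\<integral>\<^sup>+s. c (s - r) \<partial>lborel) = (\<integral>\<^sup>+s. c s \<partial>lborel)" for r
      using nn_integral_real_affine[of c 1 "- r"] by simp
    then have "(\<integral>\<^sup>+s. c r * c (s - r) \<partial>lborel) = ennreal (2 * sqrt t) * c r" for r
      by (subst nn_integral_cmult) (simp_all add: ci mult.commute)
    then show ?thesis by (simp add: nn_integral_cmult ci)
  qed
  also have "ennreal ((2 * e)\<^sup>2) * (ennreal (2 * sqrt t) * ennreal (2 * sqrt t) + ennreal (2 * sqrt t) * ennreal (2 * sqrt t)) = ennreal ((2 * e)\<^sup>2 * (8 * t))"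
    using t by (simp add: ennreal_mult'[symmetric] ennreal_plus[symmetric] del: ennreal_plus)
  finally show ?thesis .
qed

end
end

section \<open>Integrability and mean of the local time\<close>

locale skew_local_time = skew_paths M F W X L for M :: "'a measure" and F W X L +
  assumes occupation: "AE \<omega> in M. \<forall>t\<ge>0. ((\<lambda>e. 1 / (2 * e) * (LINT s:{0..t}|lborel. indicator {-e<..<e} (X s \<omega>))) \<longlongrightarrow> L t \<omega>) (at_right 0)"
begin

context
  fixes t :: real assumes t: "0 < t"
begin

text \<open>The integral over \<open>{0<..<t}\<close> of \<open>1 / sqrt (2 * pi * s)\<close>, the
  density at 0 of a normal law of variance \<open>s\<close>. It equals
  \<open>sqrt (2 * t / pi)\<close>, the mean modulus of a Brownian motion at time
  \<open>t\<close>.\<close>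

definition mean_lt :: real where "mean_lt = 2 * sqrt t / sqrt (2 * pi)"

text \<open>The limit that defines the local time is taken along a sequence, to which dominated
  convergence applies.\<close>

definition occ_ratio :: "nat \<Rightarrow> 'a \<Rightarrow> real" where
  "occ_ratio n \<omega> = enn2real (occ t (1 / real (Suc n)) \<omega>) / (2 * (1 / real (Suc n)))"

lemma eps_pos: "0 < 1 / real (Suc n)" by simp

lemma occ_ratio_measurable[measurable]: "occ_ratio n \<in> borel_measurable M"
  unfolding occ_ratio_def[abs_def] using occ_measurable[OF t eps_pos] by measurable

lemma occ_ratio_nonneg: "0 \<le> occ_ratio n \<omega>"
  unfolding occ_ratio_def by simp

lemma occ_finite: "occ t (1 / real (Suc n)) \<omega> < \<top>"
  using occ_le[OF t eps_pos] by (rule le_less_trans) simp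

lemma occ_ratio_bound: "occ_ratio n \<omega> \<le> t / (2 * (1 / real (Suc n)))"
proof -
  have "enn2real (occ t (1 / real (Suc n)) \<omega>) \<le> t"
    by (rule enn2real_leI[OF _ occ_le[OF t eps_pos]]) (use t in simp)
  then show ?thesis unfolding occ_ratio_def by (intro divide_right_mono) auto
qed

lemma occ_ratio_integrable: "integrable M (occ_ratio n)" "integrable M (\<lambda>\<omega>. (occ_ratio n \<omega>)\<^sup>2)"
proof -
  show "integrable M (occ_ratio n)"
    by (rule integrable_const_bound[where B="t / (2 * (1 / real (Suc n)))", OF AE_I2])
      (use occ_ratio_bound occ_ratio_nonneg in \<open>simp_all only: real_norm_def abs_of_nonneg occ_ratio_measurable\<close>)
  show "integrable M (\<lambda>\<omega>. (occ_ratio n \<omega>)\<^sup>2)"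
  proof (rule integrable_const_bound[where B="(t / (2 * (1 / real (Suc n))))\<^sup>2", OF AE_I2])
    fix \<omega> show "norm ((occ_ratio n \<omega>)\<^sup>2) \<le> (t / (2 * (1 / real (Suc n))))\<^sup>2"
      using power_mono[OF occ_ratio_bound occ_ratio_nonneg, of n \<omega> 2] by (simp only: real_norm_def abs_power2)
  qed measurable
qed

lemma occ_ratio_ennreal: "ennreal (2 * (1 / real (Suc n))) * ennreal (occ_ratio n \<omega>) = occ t (1 / real (Suc n)) \<omega>"
proof -
  have "ennreal (2 * (1 / real (Suc n))) * ennreal (occ_ratio n \<omega>) = ennreal (2 * (1 / real (Suc n)) * occ_ratio n \<omega>)"
    by (rule ennreal_mult''[symmetric]) (rule occ_ratio_nonneg)
  also have "2 * (1 / real (Suc n)) * occ_ratio n \<omega> = enn2real (occ t (1 / real (Suc n)) \<omega>)"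
    unfolding occ_ratio_def by simp
  also have "ennreal \<dots> = occ t (1 / real (Suc n)) \<omega>" by (rule ennreal_enn2real[OF occ_finite])
  finally show ?thesis .
qed

lemma occ_ratio_second_moment: "(LINT \<omega>|M. (occ_ratio n \<omega>)\<^sup>2) \<le> 8 * t"
proof -
  let ?e = "1 / real (Suc n)"
  have "ennreal ((2 * ?e)\<^sup>2 * (LINT \<omega>|M. (occ_ratio n \<omega>)\<^sup>2)) = ennreal ((2 * ?e)\<^sup>2) * (\<integral>\<^sup>+\<omega>. ennreal ((occ_ratio n \<omega>)\<^sup>2) \<partial>M)"
    by (subst nn_integral_eq_integral[OF occ_ratio_integrable(2)]) (auto simp: ennreal_mult' simp del: of_nat_Suc)
  also have "\<dots> = (\<integral>\<^sup>+\<omega>. ennreal ((2 * ?e)\<^sup>2) * ennreal ((occ_ratio n \<omega>)\<^sup>2) \<partial>M)"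
    by (rule nn_integral_cmult[symmetric]) measurable
  also have "\<dots> = (\<integral>\<^sup>+\<omega>. occ t ?e \<omega> * occ t ?e \<omega> \<partial>M)"
  proof (rule nn_integral_cong)
    fix \<omega>
    have sq: "ennreal (a\<^sup>2) * ennreal (b\<^sup>2) = (ennreal a * ennreal b) * (ennreal a * ennreal b)" if "0 \<le> a" "0 \<le> b" for a b
      using that by (simp add: ennreal_mult'[symmetric] power2_eq_square mult_ac)
    show "ennreal ((2 * ?e)\<^sup>2) * ennreal ((occ_ratio n \<omega>)\<^sup>2) = occ t ?e \<omega> * occ t ?e \<omega>"
      unfolding occ_ratio_ennreal[symmetric] by (rule sq) (simp_all add: occ_ratio_nonneg)
  qed
  also have "\<dots> \<le> ennreal ((2 * ?e)\<^sup>2 * (8 * t))" by (rule occ_second_moment[OF t eps_pos])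
  finally have "(2 * ?e)\<^sup>2 * (LINT \<omega>|M. (occ_ratio n \<omega>)\<^sup>2) \<le> (2 * ?e)\<^sup>2 * (8 * t)"
    by (subst (asm) ennreal_le_iff) (use t in auto)
  then show ?thesis by (rule mult_left_le_imp_le) simp
qed

lemma occ_ratio_mean_eq: "ennreal (LINT \<omega>|M. occ_ratio n \<omega>) * ennreal (2 * (1 / real (Suc n))) = (\<integral>\<^sup>+\<omega>. occ t (1 / real (Suc n)) \<omega> \<partial>M)"
  unfolding occ_ratio_ennreal[symmetric]
  by (subst nn_integral_cmult, measurable, subst nn_integral_eq_integral[OF occ_ratio_integrable(1)])
    (simp_all add: occ_ratio_nonneg mult.commute del: of_nat_Suc)

lemma density_sqrt: "0 < s \<Longrightarrow> normal_density 0 (sqrt s) x = 1 / sqrt (2 * pi) * (1 / sqrt s) * exp (- (x\<^sup>2 / (2 * s)))"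
  unfolding normal_density_def by (simp add: real_sqrt_mult)

lemma inverse_sqrt_set: "set_integrable lborel {0<..<t} (\<lambda>s. 1 / sqrt (2 * pi) * (1 / sqrt s))"
  "(LINT s:{0<..<t}|lborel. 1 / sqrt (2 * pi) * (1 / sqrt s)) = mean_lt"
proof -
  show "set_integrable lborel {0<..<t} (\<lambda>s. 1 / sqrt (2 * pi) * (1 / sqrt s))"
    by (rule set_integrable_mult_right[OF integral_inverse_sqrt(2)[OF t]])
  have "(LINT s:{0<..<t}|lborel. 1 / sqrt (2 * pi) * (1 / sqrt s)) = 1 / sqrt (2 * pi) * (LINT s:{0<..<t}|lborel. 1 / sqrt s)"
    by (rule set_integral_mult_right)
  then show "(LINT s:{0<..<t}|lborel. 1 / sqrt (2 * pi) * (1 / sqrt s)) = mean_lt"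
    unfolding integral_inverse_sqrt(3)[OF t] mean_lt_def by simp
qed

text \<open>A lower bound for the mean of \<open>occ_ratio n\<close>: the normal densities are
  evaluated at the end of the interval of radius \<open>1 / real (Suc n)\<close>, their smallest
  value there, instead of at 0.\<close>

definition lower_mean :: "nat \<Rightarrow> real" where
  "lower_mean n = (LINT s:{0<..<t}|lborel. 1 / sqrt (2 * pi) * (1 / sqrt s) * exp (- ((1 / real (Suc n))\<^sup>2 / (2 * s))))"

lemma lower_integrand:
  "integrable lborel (\<lambda>s. indicator {0<..<t} s *\<^sub>R (1 / sqrt (2 * pi) * (1 / sqrt s) * exp (- ((1 / real (Suc n))\<^sup>2 / (2 * s)))))"
  by (rule Bochner_Integration.integrable_bound[OF inverse_sqrt_set(1)[unfolded set_integrable_def]])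
    (auto simp: indicator_def intro!: divide_right_mono)

lemma lower_mean_tendsto: "lower_mean \<longlonglongrightarrow> mean_lt"
  unfolding lower_mean_def inverse_sqrt_set(2)[symmetric] set_lebesgue_integral_def
proof (rule integral_dominated_convergence[where w="\<lambda>s. indicator {0<..<t} s *\<^sub>R (1 / sqrt (2 * pi) * (1 / sqrt s))"])
  show "integrable lborel (\<lambda>s. indicator {0<..<t} s *\<^sub>R (1 / sqrt (2 * pi) * (1 / sqrt s)))"
    using inverse_sqrt_set(1) unfolding set_integrable_def .
  show "AE s in lborel. (\<lambda>n. indicator {0<..<t} s *\<^sub>R (1 / sqrt (2 * pi) * (1 / sqrt s) * exp (- ((1 / real (Suc n))\<^sup>2 / (2 * s)))))
      \<longlonglongrightarrow> indicator {0<..<t} s *\<^sub>R (1 / sqrt (2 * pi) * (1 / sqrt s))"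
  proof (rule AE_I2)
    fix s :: real
    have "(\<lambda>n. 1 / real (Suc n)) \<longlonglongrightarrow> 0" by (rule LIMSEQ_Suc[OF lim_1_over_n])
    then have "(\<lambda>n. indicator {0<..<t} s *\<^sub>R (1 / sqrt (2 * pi) * (1 / sqrt s) * exp (- ((1 / real (Suc n))\<^sup>2 * (1 / (2 * s))))))
      \<longlonglongrightarrow> indicator {0<..<t} s *\<^sub>R (1 / sqrt (2 * pi) * (1 / sqrt s) * exp (- (0\<^sup>2 * (1 / (2 * s)))))"
      by (intro tendsto_intros)
    then show "(\<lambda>n. indicator {0<..<t} s *\<^sub>R (1 / sqrt (2 * pi) * (1 / sqrt s) * exp (- ((1 / real (Suc n))\<^sup>2 / (2 * s)))))
      \<longlonglongrightarrow> indicator {0<..<t} s *\<^sub>R (1 / sqrt (2 * pi) * (1 / sqrt s))" by simp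
  qed
qed (auto simp: indicator_def intro!: divide_right_mono)

lemma occ_ratio_mean_bounds: "lower_mean n \<le> (LINT \<omega>|M. occ_ratio n \<omega>)" "(LINT \<omega>|M. occ_ratio n \<omega>) \<le> mean_lt"
proof -
  define e where "e = 1 / real (Suc n)"
  have e: "e > 0" by (simp add: e_def)
  define q where "q s = (LINT x:{-e<..<e}|lborel. normal_density 0 (sqrt s) x)" for s
  have m: "ennreal (LINT \<omega>|M. occ_ratio n \<omega>) * ennreal (2 * e) = (\<integral>\<^sup>+s. indicator {0<..<t} s * ennreal (q s) \<partial>lborel)"
    unfolding q_def occ_mean[OF t e, symmetric] unfolding e_def by (rule occ_ratio_mean_eq)
  have E0: "0 \<le> (LINT \<omega>|M. occ_ratio n \<omega>)" by (rule Bochner_Integration.integral_nonneg) (rule occ_ratio_nonneg)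
  have set_nn: "(\<integral>\<^sup>+s. ennreal (indicator {0<..<t} s *\<^sub>R f s) * ennreal (2 * e) \<partial>lborel) = ennreal (LINT s:{0<..<t}|lborel. f s) * ennreal (2 * e)"
    if "integrable lborel (\<lambda>s. indicator {0<..<t} s *\<^sub>R f s)" "\<And>s. 0 < s \<Longrightarrow> 0 \<le> f s" for f :: "real \<Rightarrow> real"
  proof -
    have "(\<lambda>s. ennreal (indicator {0<..<t} s *\<^sub>R f s)) \<in> borel_measurable lborel" using that(1) by measurable
    then show ?thesis
      unfolding set_lebesgue_integral_def
      by (subst nn_integral_multc, simp, subst nn_integral_eq_integral[OF that(1)]) (use that(2) in \<open>auto simp: indicator_def\<close>)
  qed
  have "ennreal (LINT \<omega>|M. occ_ratio n \<omega>) * ennreal (2 * e) \<le> (\<integral>\<^sup>+s. ennreal (indicator {0<..<t} s *\<^sub>R (1 / sqrt (2 * pi) * (1 / sqrt s))) * ennreal (2 * e) \<partial>lborel)"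
    unfolding m
  proof (rule nn_integral_mono)
    fix s
    show "indicator {0<..<t} s * ennreal (q s) \<le> ennreal (indicator {0<..<t} s *\<^sub>R (1 / sqrt (2 * pi) * (1 / sqrt s))) * ennreal (2 * e)"
    proof (cases "s \<in> {0<..<t}")
      case True
      then have "q s \<le> 2 * e * (1 / sqrt (2 * pi) * (1 / sqrt s))"
        using normal_density_interval_bounds(2)[OF e, of "sqrt s"] density_sqrt[of s 0] by (simp add: q_def)
      then show ?thesis using True e by (simp add: ennreal_mult'[symmetric] ennreal_leI mult.commute)
    qed simp
  qed
  also have "\<dots> = ennreal mean_lt * ennreal (2 * e)"
    unfolding inverse_sqrt_set(2)[symmetric] by (rule set_nn) (use inverse_sqrt_set(1) in \<open>simp_all add: set_integrable_def\<close>)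
  finally have "(LINT \<omega>|M. occ_ratio n \<omega>) * (2 * e) \<le> mean_lt * (2 * e)"
    using e t by (simp add: ennreal_mult''[symmetric] mean_lt_def ennreal_le_iff)
  then show "(LINT \<omega>|M. occ_ratio n \<omega>) \<le> mean_lt" using e by simp
  have "ennreal (lower_mean n) * ennreal (2 * e) = (\<integral>\<^sup>+s. ennreal (indicator {0<..<t} s *\<^sub>R (1 / sqrt (2 * pi) * (1 / sqrt s) * exp (- (e\<^sup>2 / (2 * s))))) * ennreal (2 * e) \<partial>lborel)"
    unfolding lower_mean_def e_def[symmetric] by (rule set_nn[symmetric]) (use lower_integrand[of n] in \<open>simp_all add: e_def[symmetric] del: of_nat_Suc\<close>)
  also have "\<dots> \<le> ennreal (LINT \<omega>|M. occ_ratio n \<omega>) * ennreal (2 * e)"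
    unfolding m
  proof (rule nn_integral_mono)
    fix s
    show "ennreal (indicator {0<..<t} s *\<^sub>R (1 / sqrt (2 * pi) * (1 / sqrt s) * exp (- (e\<^sup>2 / (2 * s))))) * ennreal (2 * e) \<le> indicator {0<..<t} s * ennreal (q s)"
    proof (cases "s \<in> {0<..<t}")
      case True
      then have "2 * e * (1 / sqrt (2 * pi) * (1 / sqrt s) * exp (- (e\<^sup>2 / (2 * s)))) \<le> q s"
        using normal_density_interval_bounds(1)[OF e, of "sqrt s"] density_sqrt[of s e] by (simp add: q_def)
      then show ?thesis using True e by (simp add: ennreal_mult''[symmetric] ennreal_leI mult.commute)
    qed simp
  qed
  finally have "ennreal (lower_mean n * (2 * e)) \<le> ennreal ((LINT \<omega>|M. occ_ratio n \<omega>) * (2 * e))"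
    using e by (simp add: ennreal_mult'')
  then have "lower_mean n * (2 * e) \<le> (LINT \<omega>|M. occ_ratio n \<omega>) * (2 * e)"
    by (subst (asm) ennreal_le_iff) (use E0 e in auto)
  then show "lower_mean n \<le> (LINT \<omega>|M. occ_ratio n \<omega>)" using e by simp
qed

lemma occ_ratio_tendsto: "AE \<omega> in M. (\<lambda>n. occ_ratio n \<omega>) \<longlonglongrightarrow> L t \<omega>"
  using occupation good(2) AE_space
proof eventually_elim
  case (elim \<omega>)
  have Ys: "(\<lambda>s. Y s \<omega>) \<in> borel_measurable borel"
    using measurable_Pair1[OF Y_joint elim(3)] by simp
  have eq: "1 / (2 * e) * (LINT s:{0..t}|lborel. indicator {-e<..<e} (X s \<omega>)) = enn2real (occ t e \<omega>) / (2 * e)" if e: "0 < e" for e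
  proof -
    have "(LINT s:{0..t}|lborel. indicator {-e<..<e} (X s \<omega>)) = (LINT s|lborel. indicator {0..t} s * indicator {-e<..<e} (Y s \<omega>) :: real)"
      unfolding set_lebesgue_integral_def
      by (intro Bochner_Integration.integral_cong) (use elim(2) in \<open>auto simp: Y_def indicator_def\<close>)
    also have "\<dots> = enn2real (\<integral>\<^sup>+s. ennreal (indicator {0..t} s * indicator {-e<..<e} (Y s \<omega>)) \<partial>lborel)"
      by (rule integral_eq_nn_integral) (use Ys in \<open>simp_all\<close>)
    also have "(\<integral>\<^sup>+s. ennreal (indicator {0..t} s * indicator {-e<..<e} (Y s \<omega>)) \<partial>lborel) = occ t e \<omega>"
      unfolding occ_def[OF t e]
    proof (rule nn_integral_cong_AE)
      show "AE s in lborel. ennreal (indicator {0..t} s * indicator {-e<..<e} (Y s \<omega>)) = indicator {0<..<t} s * indicator {-e<..<e} (Y s \<omega>)"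
        using AE_lborel_singleton[of 0] AE_lborel_singleton[of t] by eventually_elim (auto simp: indicator_def)
    qed
    finally show ?thesis by simp
  qed
  have "filterlim (\<lambda>n. 1 / real (Suc n)) (at_right 0) sequentially"
    by (intro tendsto_imp_filterlim_at_right LIMSEQ_Suc[OF lim_1_over_n] always_eventually allI eps_pos)
  from filterlim_compose[OF elim(1)[rule_format, OF less_imp_le[OF t]] this]
  show "(\<lambda>n. occ_ratio n \<omega>) \<longlonglongrightarrow> L t \<omega>"
    unfolding eq[OF eps_pos] occ_ratio_def .
qed

text \<open>The second moments make the occupation averages uniformly integrable; this is carried out
  by truncation at level \<open>k\<close>.\<close>

lemma local_time_mean: "integrable M (L t)" "(LINT \<omega>|M. L t \<omega>) = mean_lt"
proof -
  have [measurable]: "L t \<in> borel_measurable M" using t by simp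
  have Lnn: "AE \<omega> in M. 0 \<le> L t \<omega>" using paths by eventually_elim (rule skew_pathD(10), use t in simp_all)
  have mb: "integrable M (\<lambda>\<omega>. min (f \<omega>) (real k))" if "f \<in> borel_measurable M" "AE \<omega> in M. 0 \<le> f \<omega>" for f :: "'a \<Rightarrow> real" and k
    by (rule integrable_const_bound[where B="real k"]) (use that in \<open>auto elim!: eventually_mono simp: abs_le_iff\<close>)
  have on: "AE \<omega> in M. 0 \<le> occ_ratio n \<omega>" for n using occ_ratio_nonneg by simp
  have lim: "(\<lambda>n. LINT \<omega>|M. min (occ_ratio n \<omega>) (real k)) \<longlonglongrightarrow> (LINT \<omega>|M. min (L t \<omega>) (real k))" for k
  proof (rule integral_dominated_convergence[where w="\<lambda>_. real k"])
    show "AE \<omega> in M. (\<lambda>n. min (occ_ratio n \<omega>) (real k)) \<longlonglongrightarrow> min (L t \<omega>) (real k)"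
      using occ_ratio_tendsto by eventually_elim (intro tendsto_min tendsto_const)
    show "AE \<omega> in M. norm (min (occ_ratio n \<omega>) (real k)) \<le> real k" for n
    proof (rule AE_I2)
      fix \<omega>
      have "\<bar>min x c\<bar> \<le> c" if "0 \<le> x" "0 \<le> c" for x c :: real using that by (auto simp: min_def)
      then show "norm (min (occ_ratio n \<omega>) (real k)) \<le> real k"
        unfolding real_norm_def using occ_ratio_nonneg[of n \<omega>] by simp
    qed
  qed measurable
  have up: "(LINT \<omega>|M. min (occ_ratio n \<omega>) (real k)) \<le> mean_lt" for n k
    by (rule order_trans[OF integral_mono[OF mb[OF occ_ratio_measurable on] occ_ratio_integrable(1)[of n]] occ_ratio_mean_bounds(2)]) simp
  \<comment> \<open>From \<open>x - x\<^sup>2 / c \<le> min x c\<close>: truncation at level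
    \<open>c\<close> loses at most the second moment divided by \<open>c\<close>, and the second
    moments are bounded by \<open>8 * t\<close> for all \<open>n\<close>.\<close>
  have low: "lower_mean n - 8 * t / real (Suc k) \<le> (LINT \<omega>|M. min (occ_ratio n \<omega>) (real (Suc k)))" for n k
  proof -
    have "lower_mean n - 8 * t / real (Suc k) \<le> (LINT \<omega>|M. occ_ratio n \<omega>) - 1 / real (Suc k) * (LINT \<omega>|M. (occ_ratio n \<omega>)\<^sup>2)"
    proof -
      have "1 / real (Suc k) * (LINT \<omega>|M. (occ_ratio n \<omega>)\<^sup>2) \<le> 1 / real (Suc k) * (8 * t)"
        by (intro mult_left_mono occ_ratio_second_moment) simp
      then show ?thesis using occ_ratio_mean_bounds(1)[of n] by simp
    qed
    also have "\<dots> = (LINT \<omega>|M. occ_ratio n \<omega> - 1 / real (Suc k) * (occ_ratio n \<omega>)\<^sup>2)"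
      by (subst Bochner_Integration.integral_diff[OF occ_ratio_integrable(1) integrable_mult_right[OF occ_ratio_integrable(2)]]) simp
    also have "\<dots> \<le> (LINT \<omega>|M. min (occ_ratio n \<omega>) (real (Suc k)))"
    proof (rule integral_mono)
      show "integrable M (\<lambda>\<omega>. occ_ratio n \<omega> - 1 / real (Suc k) * (occ_ratio n \<omega>)\<^sup>2)"
        by (rule Bochner_Integration.integrable_diff[OF occ_ratio_integrable(1) integrable_mult_right[OF occ_ratio_integrable(2)]])
      show "integrable M (\<lambda>\<omega>. min (occ_ratio n \<omega>) (real (Suc k)))" by (rule mb[OF occ_ratio_measurable on])
      fix \<omega>
      have "x - 1 / c * x\<^sup>2 \<le> min x c" if "0 \<le> x" "0 < c" for x c :: real
      proof (cases "x \<le> c")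
        case True then show ?thesis using that by simp
      next
        case False
        then have "c * x \<le> x * x" using that by (intro mult_right_mono) auto
        then have "x \<le> 1 / c * x\<^sup>2" using that by (simp add: field_simps power2_eq_square)
        then show ?thesis using False that by simp
      qed
      then show "occ_ratio n \<omega> - 1 / real (Suc k) * (occ_ratio n \<omega>)\<^sup>2 \<le> min (occ_ratio n \<omega>) (real (Suc k))"
        using occ_ratio_nonneg by simp
    qed
    finally show ?thesis .
  qed
  have up': "(LINT \<omega>|M. min (L t \<omega>) (real k)) \<le> mean_lt" for k
    by (rule tendsto_upperbound[OF lim always_eventually[OF allI[OF up]] sequentially_bot])
  have low': "mean_lt - 8 * t / real (Suc k) \<le> (LINT \<omega>|M. min (L t \<omega>) (real (Suc k)))" for k
    by (rule tendsto_le[OF sequentially_bot lim tendsto_diff[OF lower_mean_tendsto tendsto_const] always_eventually[OF allI[OF low]]])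
  \<comment> \<open>The limit in \<open>n\<close> was taken for fixed \<open>k\<close>. Now the
    truncated means are squeezed as \<open>k\<close> grows, and monotone convergence delivers
    integrability together with the value.\<close>
  have m4: "(\<lambda>k. LINT \<omega>|M. min (L t \<omega>) (real (Suc k))) \<longlonglongrightarrow> mean_lt"
  proof (rule real_tendsto_sandwich[OF always_eventually[OF allI[OF low']] always_eventually[OF allI[OF up']] _ tendsto_const])
    have "(\<lambda>k. 8 * t / real (Suc k)) \<longlonglongrightarrow> 0"
      by (rule real_tendsto_divide_at_top[OF tendsto_const filterlim_compose[OF filterlim_real_sequentially filterlim_Suc]])
    from tendsto_diff[OF tendsto_const this, of mean_lt] show "(\<lambda>k. mean_lt - 8 * t / real (Suc k)) \<longlonglongrightarrow> mean_lt" by simp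
  qed
  have m2: "AE \<omega> in M. mono (\<lambda>k. min (L t \<omega>) (real (Suc k)))" by (intro AE_I2 monoI) (simp add: min_def)
  have m3: "AE \<omega> in M. (\<lambda>k. min (L t \<omega>) (real (Suc k))) \<longlonglongrightarrow> L t \<omega>"
  proof (rule AE_I2)
    fix \<omega>
    obtain k0 :: nat where k0: "L t \<omega> \<le> real k0" using real_arch_simple by blast
    show "(\<lambda>k. min (L t \<omega>) (real (Suc k))) \<longlonglongrightarrow> L t \<omega>"
    proof (rule tendsto_eventually, rule eventually_sequentiallyI[of k0])
      fix k assume "k0 \<le> k"
      then have "real k0 \<le> real (Suc k)" by simp
      then show "min (L t \<omega>) (real (Suc k)) = L t \<omega>" using k0 by simp
    qed
  qed
  have m1: "integrable M (\<lambda>\<omega>. min (L t \<omega>) (real (Suc k)))" for k by (rule mb[OF _ Lnn]) measurable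
  have Lm: "L t \<in> borel_measurable M" by measurable
  show "integrable M (L t)" by (rule integrable_monotone_convergence[OF m1 m2 m3 m4 Lm])
  show "(LINT \<omega>|M. L t \<omega>) = mean_lt" by (rule integral_monotone_convergence[OF m1 m2 m3 m4 Lm])
qed

end
end

section \<open>The mean of the random measure of the local time\<close>

text \<open>A Dynkin argument: averaging \<open>\<kappa>\<close> over the sample point agrees with
  \<open>\<rho>\<close> on half-lines, a generator stable under intersection. Measurability in the
  sample point is given on the generator and the whole line only, so it is carried through the same
  induction; finiteness makes complements work.\<close>

lemma integrated_kernel_emeasure:
  fixes \<kappa> :: "'a \<Rightarrow> real measure" and \<rho> :: "real measure"
  assumes sk: "\<And>\<omega>. sets (\<kappa> \<omega>) = sets borel" and fk: "\<And>\<omega>. emeasure (\<kappa> \<omega>) UNIV \<noteq> \<infinity>"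
    and sr: "sets \<rho> = sets borel" and fr: "emeasure \<rho> UNIV \<noteq> \<infinity>"
    and U: "(\<lambda>\<omega>. emeasure (\<kappa> \<omega>) UNIV) \<in> borel_measurable M" "(\<integral>\<^sup>+\<omega>. emeasure (\<kappa> \<omega>) UNIV \<partial>M) = emeasure \<rho> UNIV"
    and m: "\<And>c. (\<lambda>\<omega>. emeasure (\<kappa> \<omega>) {..c}) \<in> borel_measurable M"
    and e: "\<And>c. (\<integral>\<^sup>+\<omega>. emeasure (\<kappa> \<omega>) {..c} \<partial>M) = emeasure \<rho> {..c}"
    and A: "A \<in> sets borel"
  shows "(\<lambda>\<omega>. emeasure (\<kappa> \<omega>) A) \<in> borel_measurable M \<and> (\<integral>\<^sup>+\<omega>. emeasure (\<kappa> \<omega>) A \<partial>M) = emeasure \<rho> A"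
proof -
  have bs: "sets borel = sigma_sets UNIV (range (atMost :: real \<Rightarrow> real set))"
    by (simp add: borel_eq_atMost)
  have "Int_stable (range (atMost :: real \<Rightarrow> real set))" by (auto simp: Int_stable_def)
  moreover have "range (atMost :: real \<Rightarrow> real set) \<subseteq> Pow UNIV" by simp
  moreover have "A \<in> sigma_sets UNIV (range (atMost :: real \<Rightarrow> real set))" using A bs by simp
  ultimately show ?thesis
  proof (induction rule: sigma_sets_induct_disjoint)
    case (basic B)
    then show ?case using m e by auto
  next
    case empty
    show ?case by simp
  next
    case (compl B)
    then have B: "B \<in> sets borel" using bs by simp
    have kB: "emeasure (\<kappa> \<omega>) B \<noteq> \<infinity>" for \<omega>
      unfolding infinity_ennreal_def
      by (rule neq_top_trans[OF fk[of \<omega>, unfolded infinity_ennreal_def] emeasure_mono]) (simp_all add: sk)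
    have rB: "emeasure \<rho> B \<noteq> \<infinity>"
      unfolding infinity_ennreal_def
      by (rule neq_top_trans[OF fr[unfolded infinity_ennreal_def] emeasure_mono]) (simp_all add: sr)
    have c: "emeasure (\<kappa> \<omega>) (UNIV - B) = emeasure (\<kappa> \<omega>) UNIV - emeasure (\<kappa> \<omega>) B" for \<omega>
      by (rule emeasure_Diff[OF kB]) (simp_all add: B sk)
    have r: "emeasure \<rho> (UNIV - B) = emeasure \<rho> UNIV - emeasure \<rho> B"
      by (rule emeasure_Diff[OF rB]) (simp_all add: B sr)
    note IH = compl(2)[THEN conjunct1] compl(2)[THEN conjunct2]
    note [measurable] = U(1) IH(1)
    have d: "(\<integral>\<^sup>+\<omega>. emeasure (\<kappa> \<omega>) UNIV - emeasure (\<kappa> \<omega>) B \<partial>M) = (\<integral>\<^sup>+\<omega>. emeasure (\<kappa> \<omega>) UNIV \<partial>M) - (\<integral>\<^sup>+\<omega>. emeasure (\<kappa> \<omega>) B \<partial>M)"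
    proof (rule nn_integral_diff[OF U(1) IH(1)])
      show "(\<integral>\<^sup>+\<omega>. emeasure (\<kappa> \<omega>) B \<partial>M) \<noteq> \<infinity>" unfolding IH(2) by (rule rB)
      show "AE \<omega> in M. emeasure (\<kappa> \<omega>) B \<le> emeasure (\<kappa> \<omega>) UNIV"
        by (intro AE_I2 emeasure_mono) (simp_all add: sk)
    qed
    have "(\<lambda>\<omega>. emeasure (\<kappa> \<omega>) UNIV - emeasure (\<kappa> \<omega>) B) \<in> borel_measurable M" by measurable
    then show ?case unfolding c r d U(2) IH(2) by simp
  next
    case (union B)
    then have B: "range B \<subseteq> sets borel" using bs by auto
    have k: "emeasure (\<kappa> \<omega>) (\<Union>i. B i) = (\<Sum>i. emeasure (\<kappa> \<omega>) (B i))" for \<omega>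
      by (rule suminf_emeasure[symmetric, OF _ union(1)]) (simp add: B sk)
    have r: "emeasure \<rho> (\<Union>i. B i) = (\<Sum>i. emeasure \<rho> (B i))"
      by (rule suminf_emeasure[symmetric, OF _ union(1)]) (simp add: B sr)
    note IH1 = union(3)[THEN conjunct1] and IH2 = union(3)[THEN conjunct2]
    have d: "(\<integral>\<^sup>+\<omega>. (\<Sum>i. emeasure (\<kappa> \<omega>) (B i)) \<partial>M) = (\<Sum>i. \<integral>\<^sup>+\<omega>. emeasure (\<kappa> \<omega>) (B i) \<partial>M)"
      by (rule nn_integral_suminf[OF IH1])
    have "(\<lambda>\<omega>. (\<Sum>i. emeasure (\<kappa> \<omega>) (B i))) \<in> borel_measurable M"
      by (rule borel_measurable_suminf_order[OF IH1])
    then show ?case unfolding k r d IH2 by simp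
  qed
qed

text \<open>The identity is lifted from sets to functions through simple functions and monotone
  limits, again together with measurability. It computes the mean of an integral against a random
  measure.\<close>

lemma integrated_kernel_nn_integral:
  fixes \<kappa> :: "'a \<Rightarrow> real measure" and \<rho> :: "real measure"
  assumes sk: "\<And>\<omega>. sets (\<kappa> \<omega>) = sets borel" and sr: "sets \<rho> = sets borel"
    and E: "\<And>A. A \<in> sets borel \<Longrightarrow> (\<lambda>\<omega>. emeasure (\<kappa> \<omega>) A) \<in> borel_measurable M \<and> (\<integral>\<^sup>+\<omega>. emeasure (\<kappa> \<omega>) A \<partial>M) = emeasure \<rho> A"
    and h: "h \<in> borel_measurable borel"
  shows "(\<lambda>\<omega>. \<integral>\<^sup>+s. h s \<partial>\<kappa> \<omega>) \<in> borel_measurable M \<and> (\<integral>\<^sup>+\<omega>. (\<integral>\<^sup>+s. h s \<partial>\<kappa> \<omega>) \<partial>M) = (\<integral>\<^sup>+s. h s \<partial>\<rho>)"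
proof -
  have bk: "f \<in> borel_measurable (\<kappa> \<omega>)" if "f \<in> borel_measurable borel" for f :: "real \<Rightarrow> ennreal" and \<omega>
    using that by (simp add: measurable_cong_sets[OF sk refl])
  have br: "f \<in> borel_measurable \<rho>" if "f \<in> borel_measurable borel" for f :: "real \<Rightarrow> ennreal"
    using that by (simp add: measurable_cong_sets[OF sr refl])
  show ?thesis
    using h
  proof (induction rule: borel_measurable_induct)
    case (cong f g)
    have "f = g" by (rule ext) (simp add: cong(3))
    then show ?case using cong(4) by (simp only:)
  next
    case (set A)
    have A: "A \<in> sets (\<kappa> \<omega>)" "A \<in> sets \<rho>" for \<omega> using set sk sr by simp_all
    show ?case unfolding nn_integral_indicator[OF A(1)] nn_integral_indicator[OF A(2)] by (rule E[OF set])
  next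
    case (mult f c)
    note IH = mult(4)[THEN conjunct1] mult(4)[THEN conjunct2]
    show ?case
      unfolding nn_integral_cmult[OF bk[OF mult(2)]] nn_integral_cmult[OF br[OF mult(2)]] nn_integral_cmult[OF IH(1)] IH(2)
      using IH(1) by simp
  next
    case (add f g)
    have fm: "f \<in> borel_measurable borel" and gm: "g \<in> borel_measurable borel" by fact+
    have f: "(\<lambda>\<omega>. \<integral>\<^sup>+s. f s \<partial>\<kappa> \<omega>) \<in> borel_measurable M" "(\<integral>\<^sup>+\<omega>. (\<integral>\<^sup>+s. f s \<partial>\<kappa> \<omega>) \<partial>M) = (\<integral>\<^sup>+s. f s \<partial>\<rho>)"
      and g: "(\<lambda>\<omega>. \<integral>\<^sup>+s. g s \<partial>\<kappa> \<omega>) \<in> borel_measurable M" "(\<integral>\<^sup>+\<omega>. (\<integral>\<^sup>+s. g s \<partial>\<kappa> \<omega>) \<partial>M) = (\<integral>\<^sup>+s. g s \<partial>\<rho>)"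
      using add.IH by simp_all
    have m: "(\<lambda>\<omega>. (\<integral>\<^sup>+s. f s \<partial>\<kappa> \<omega>) + (\<integral>\<^sup>+s. g s \<partial>\<kappa> \<omega>)) \<in> borel_measurable M"
      "(\<lambda>\<omega>. (\<integral>\<^sup>+s. g s \<partial>\<kappa> \<omega>) + (\<integral>\<^sup>+s. f s \<partial>\<kappa> \<omega>)) \<in> borel_measurable M"
      by (rule borel_measurable_add[OF f(1) g(1)] borel_measurable_add[OF g(1) f(1)])+
    show ?case
      unfolding nn_integral_add[OF bk[OF fm] bk[OF gm]] nn_integral_add[OF br[OF fm] br[OF gm]]
        nn_integral_add[OF bk[OF gm] bk[OF fm]] nn_integral_add[OF br[OF gm] br[OF fm]]
        nn_integral_add[OF f(1) g(1)] nn_integral_add[OF g(1) f(1)] f(2) g(2)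
      using m by simp
  next
    case (seq f)
    have inc: "incseq f" by fact
    have fm: "f i \<in> borel_measurable borel" for i by fact
    have IH: "(\<lambda>\<omega>. \<integral>\<^sup>+s. f i s \<partial>\<kappa> \<omega>) \<in> borel_measurable M"
      and IH2: "(\<integral>\<^sup>+\<omega>. (\<integral>\<^sup>+s. f i s \<partial>\<kappa> \<omega>) \<partial>M) = (\<integral>\<^sup>+s. f i s \<partial>\<rho>)" for i
      using seq.IH[of i] by simp_all
    have s: "(\<integral>\<^sup>+s. (SUP i. f i) s \<partial>N) = (SUP i. \<integral>\<^sup>+s. f i s \<partial>N)" if "\<And>i. f i \<in> borel_measurable N" for N
      unfolding SUP_apply by (rule nn_integral_monotone_convergence_SUP[OF inc that])
    have i: "incseq (\<lambda>i \<omega>. \<integral>\<^sup>+s. f i s \<partial>\<kappa> \<omega>)"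
    proof (rule incseq_SucI, rule le_funI, rule nn_integral_mono)
      show "f i s \<le> f (Suc i) s" for i s using incseq_SucD[OF inc] by (rule le_funD)
    qed
    have d: "(\<integral>\<^sup>+\<omega>. (SUP i. \<integral>\<^sup>+s. f i s \<partial>\<kappa> \<omega>) \<partial>M) = (SUP i. \<integral>\<^sup>+\<omega>. (\<integral>\<^sup>+s. f i s \<partial>\<kappa> \<omega>) \<partial>M)"
      by (rule nn_integral_monotone_convergence_SUP[OF i IH])
    have "(\<lambda>\<omega>. SUP i. \<integral>\<^sup>+s. f i s \<partial>\<kappa> \<omega>) \<in> borel_measurable M"
      by (rule borel_measurable_SUP[OF _ IH]) simp
    then show ?case
      unfolding s[OF bk[OF fm]] s[OF br[OF fm]] d IH2 by simp
  qed
qed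

context skew_local_time
begin

text \<open>The density at 0 of the normal law of variance \<open>s\<close>, hence the rate at which
  the mean of the local time grows.\<close>

definition weight :: "real \<Rightarrow> real" where "weight s = 1 / sqrt (2 * pi) * (1 / sqrt s)"

lemma weight_nn_integral: "0 \<le> m \<Longrightarrow> (\<integral>\<^sup>+s. indicator {0<..m} s * ennreal (weight s) \<partial>lborel) = ennreal (2 * sqrt m / sqrt (2 * pi))"
proof -
  assume "0 \<le> m"
  then consider "m = 0" | "0 < m" by linarith
  then show ?thesis
  proof cases
    case 2
    have "(\<integral>\<^sup>+s. indicator {0<..m} s * ennreal (weight s) \<partial>lborel) = (\<integral>\<^sup>+s. ennreal (1 / sqrt (2 * pi)) * ennreal (indicator {0<..<m} s / sqrt s) \<partial>lborel)"
    proof (rule nn_integral_cong_AE)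
      show "AE s in lborel. indicator {0<..m} s * ennreal (weight s) = ennreal (1 / sqrt (2 * pi)) * ennreal (indicator {0<..<m} s / sqrt s)"
        using AE_lborel_singleton[of m]
      proof eventually_elim
        case (elim s)
        show ?case
          using elim ennreal_mult'[of "1 / sqrt (2 * pi)" "1 / sqrt s"] by (cases "s \<in> {0<..<m}") (auto simp: weight_def indicator_def)
      qed
    qed
    also have "\<dots> = ennreal (1 / sqrt (2 * pi)) * ennreal (2 * sqrt m)"
      by (subst nn_integral_cmult) (simp_all add: integral_inverse_sqrt(1)[OF 2])
    also have "\<dots> = ennreal (1 / sqrt (2 * pi) * (2 * sqrt m))" by (rule ennreal_mult'[symmetric]) simp
    finally show ?thesis by simp
  qed simp
qed

lemma K_mean: "0 \<le> m \<Longrightarrow> (\<integral>\<^sup>+\<omega>. ennreal (K m \<omega>) \<partial>M) = ennreal (2 * sqrt m / sqrt (2 * pi))"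
proof -
  assume m: "0 \<le> m"
  show ?thesis
  proof (cases "m = 0")
    case False
    then have m: "0 < m" using m by simp
    have e: "AE \<omega> in M. L m \<omega> = K m \<omega>" using good(2) by eventually_elim (use m in \<open>simp add: K_def\<close>)
    have i: "integrable M (K m)"
      by (rule integrable_cong_AE_imp[OF local_time_mean(1)[OF m] _ e]) simp
    have "(LINT \<omega>|M. K m \<omega>) = (LINT \<omega>|M. L m \<omega>)"
      by (rule integral_cong_AE) (use e m in \<open>auto elim!: eventually_mono\<close>)
    then show ?thesis
      using nn_integral_eq_integral[OF i] K_path(4)[of m] m local_time_mean(2)[OF m] by (simp add: mean_lt_def[OF m])
  qed (simp add: K_path)
qed

text \<open>\<open>dK\<close> may have infinite total mass; restricted to \<open>{0<..T}\<close> it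
  is finite, as the extension from half-lines requires. The measure \<open>refm T\<close> below is
  the candidate for its mean.\<close>

definition kern :: "real \<Rightarrow> 'a \<Rightarrow> real measure" where
  "kern T \<omega> = density (stieltjes_measure (\<lambda>s. K s \<omega>)) (indicator {0<..T})"

definition refm :: "real \<Rightarrow> real measure" where
  "refm T = density lborel (\<lambda>s. indicator {0<..T} s * ennreal (weight s))"

lemma weight_measurable[measurable]: "weight \<in> borel_measurable borel"
  unfolding weight_def[abs_def] by measurable

lemma kern_atMost: "0 < T \<Longrightarrow> emeasure (kern T \<omega>) {..c} = ennreal (K (max 0 (min T c)) \<omega>)"
proof -
  assume T: "0 < T"
  have "emeasure (kern T \<omega>) {..c} = (\<integral>\<^sup>+s. indicator {0<..T} s * indicator {..c} s \<partial>stieltjes_measure (\<lambda>s. K s \<omega>))"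
    unfolding kern_def by (rule emeasure_density) simp_all
  also have "\<dots> = (\<integral>\<^sup>+s. indicator {0<..max 0 (min T c)} s \<partial>stieltjes_measure (\<lambda>s. K s \<omega>))"
    by (rule nn_integral_cong) (auto simp: indicator_def)
  also have "\<dots> = ennreal (K (max 0 (min T c)) \<omega> - K 0 \<omega>)"
    using emeasure_stieltjes(1)[OF K_path(1,2) order_refl, of "max 0 (min T c)" \<omega>] by simp
  finally show ?thesis by (simp add: K_path(3))
qed

lemma refm_atMost: "0 < T \<Longrightarrow> emeasure (refm T) {..c} = ennreal (2 * sqrt (max 0 (min T c)) / sqrt (2 * pi))"
proof -
  assume T: "0 < T"
  have "emeasure (refm T) {..c} = (\<integral>\<^sup>+s. indicator {0<..T} s * ennreal (weight s) * indicator {..c} s \<partial>lborel)"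
    unfolding refm_def by (rule emeasure_density) simp_all
  also have "\<dots> = (\<integral>\<^sup>+s. indicator {0<..max 0 (min T c)} s * ennreal (weight s) \<partial>lborel)"
    by (rule nn_integral_cong) (auto simp: indicator_def)
  finally show ?thesis using weight_nn_integral[of "max 0 (min T c)"] by simp
qed

lemma kern_UNIV: "emeasure (kern T \<omega>) UNIV = emeasure (kern T \<omega>) {..T}"
  unfolding kern_def by (subst (1 2) emeasure_density) (auto intro!: nn_integral_cong simp: indicator_def)

lemma refm_UNIV: "emeasure (refm T) UNIV = emeasure (refm T) {..T}"
  unfolding refm_def by (subst (1 2) emeasure_density) (auto intro!: nn_integral_cong simp: indicator_def)

text \<open>On half-lines the claim is the mean of the local time. Extending it to all Borel
  \<open>h\<close> is what admits a merely Borel \<beta>.\<close>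

lemma kern_nn_integral:
  assumes T: "0 < T" and h: "h \<in> borel_measurable borel"
  shows "(\<lambda>\<omega>. \<integral>\<^sup>+s. h s \<partial>kern T \<omega>) \<in> borel_measurable M \<and> (\<integral>\<^sup>+\<omega>. (\<integral>\<^sup>+s. h s \<partial>kern T \<omega>) \<partial>M) = (\<integral>\<^sup>+s. h s \<partial>refm T)"
proof (rule integrated_kernel_nn_integral[OF _ _ _ h])
  show sk: "sets (kern T \<omega>) = sets borel" for \<omega> by (simp add: kern_def)
  show sr: "sets (refm T) = sets borel" by (simp add: refm_def)
  show "(\<lambda>\<omega>. emeasure (kern T \<omega>) A) \<in> borel_measurable M \<and> (\<integral>\<^sup>+\<omega>. emeasure (kern T \<omega>) A \<partial>M) = emeasure (refm T) A"
    if "A \<in> sets borel" for A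
    by (rule integrated_kernel_emeasure[OF sk _ sr _ _ _ _ _ that])
      (simp_all add: kern_UNIV refm_UNIV kern_atMost[OF T] refm_atMost[OF T] K_mean)
qed

text \<open>Nonnegativity of \<open>g\<close> allows working with \<open>ennreal\<close> integrals
  throughout. The intended cases are the constant 1 and \<open>1 + b\<close>, which explains the
  upper bound 2.\<close>

lemma stieltjes_mean:
  assumes g[measurable]: "g \<in> borel_measurable borel" and gb: "\<And>s. 0 \<le> g s" "\<And>s. g s \<le> (2::real)" and uv: "0 \<le> u" "u \<le> v" "0 < v"
  shows "integrable M (\<lambda>\<omega>. LINT s:{u<..v}|stieltjes_measure (\<lambda>s. K s \<omega>). g s)"
    and "(LINT \<omega>|M. (LINT s:{u<..v}|stieltjes_measure (\<lambda>s. K s \<omega>). g s)) = (LINT s:{u<..v}|lborel. g s * weight s)"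
proof -
  define h where "h s = ennreal (indicator {u<..v} s *\<^sub>R g s)" for s
  have hm[measurable]: "h \<in> borel_measurable borel" unfolding h_def[abs_def] by measurable
  define N where "N \<omega> = (\<integral>\<^sup>+s. h s \<partial>kern v \<omega>)" for \<omega>
  have N: "N \<in> borel_measurable M" "(\<integral>\<^sup>+\<omega>. N \<omega> \<partial>M) = (\<integral>\<^sup>+s. h s \<partial>refm v)"
    using kern_nn_integral[OF uv(3) hm] unfolding N_def[abs_def] by simp_all
  have h2: "h s \<le> 2" for s
    using gb[of s] ennreal_leI[of "g s" 2] by (auto simp: h_def indicator_def)
  have fin: "(\<integral>\<^sup>+s. h s \<partial>P) < \<top>" if "emeasure P (space P) < \<top>" for P :: "real measure"
  proof -
    have "(\<integral>\<^sup>+s. h s \<partial>P) \<le> (\<integral>\<^sup>+s. 2 \<partial>P)" by (rule nn_integral_mono) (rule h2)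
    also have "\<dots> < \<top>" using that by (simp add: ennreal_mult_less_top)
    finally show ?thesis .
  qed
  have spk: "space (kern v \<omega>) = UNIV" for \<omega> by (simp add: kern_def stieltjes_measure_def)
  have spr: "space (refm v) = UNIV" by (simp add: refm_def)
  have Nf: "N \<omega> < \<top>" for \<omega>
    unfolding N_def by (rule fin) (simp only: spk kern_UNIV kern_atMost[OF uv(3)] ennreal_less_top)
  have Rf: "(\<integral>\<^sup>+s. h s \<partial>refm v) < \<top>"
    by (rule fin) (simp only: spr refm_UNIV refm_atMost[OF uv(3)] ennreal_less_top)
  have path: "(LINT s:{u<..v}|stieltjes_measure (\<lambda>s. K s \<omega>). g s) = enn2real (N \<omega>)" for \<omega>
  proof -
    have "(LINT s:{u<..v}|stieltjes_measure (\<lambda>s. K s \<omega>). g s) = enn2real (\<integral>\<^sup>+s. h s \<partial>stieltjes_measure (\<lambda>s. K s \<omega>))"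
      unfolding set_lebesgue_integral_def h_def by (rule integral_eq_nn_integral) (use gb in \<open>auto simp: indicator_def\<close>)
    also have "(\<integral>\<^sup>+s. h s \<partial>stieltjes_measure (\<lambda>s. K s \<omega>)) = (\<integral>\<^sup>+s. indicator {0<..v} s * h s \<partial>stieltjes_measure (\<lambda>s. K s \<omega>))"
      by (rule nn_integral_cong) (use uv in \<open>auto simp: h_def indicator_def\<close>)
    also have "\<dots> = N \<omega>" unfolding N_def kern_def by (rule nn_integral_density[symmetric]) simp_all
    finally show ?thesis .
  qed
  have eN: "(\<integral>\<^sup>+\<omega>. ennreal (enn2real (N \<omega>)) \<partial>M) = (\<integral>\<^sup>+s. h s \<partial>refm v)"
    unfolding N(2)[symmetric] by (rule nn_integral_cong) (rule ennreal_enn2real[OF Nf])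
  have Nm: "(\<lambda>\<omega>. enn2real (N \<omega>)) \<in> borel_measurable M" using N(1) by measurable
  show "integrable M (\<lambda>\<omega>. LINT s:{u<..v}|stieltjes_measure (\<lambda>s. K s \<omega>). g s)"
    unfolding path by (rule integrableI_nonneg[OF Nm]) (use eN Rf in simp_all)
  have "(LINT \<omega>|M. enn2real (N \<omega>)) = enn2real (\<integral>\<^sup>+s. h s \<partial>refm v)"
    unfolding eN[symmetric] by (rule integral_eq_nn_integral[OF Nm]) simp
  also have "(\<integral>\<^sup>+s. h s \<partial>refm v) = (\<integral>\<^sup>+s. indicator {0<..v} s * ennreal (weight s) * h s \<partial>lborel)"
    unfolding refm_def by (rule nn_integral_density) simp_all
  also have "\<dots> = (\<integral>\<^sup>+s. ennreal (indicator {u<..v} s *\<^sub>R (g s * weight s)) \<partial>lborel)"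
  proof (rule nn_integral_cong)
    fix s
    show "indicator {0<..v} s * ennreal (weight s) * h s = ennreal (indicator {u<..v} s *\<^sub>R (g s * weight s))"
    proof (cases "s \<in> {u<..v}")
      case True
      then have "s \<in> {0<..v}" "0 \<le> weight s" using uv by (auto simp: weight_def)
      then show ?thesis using True ennreal_mult[OF gb(1)[of s], of "weight s"] by (simp add: h_def mult.commute)
    qed (simp add: h_def)
  qed
  also have "enn2real \<dots> = (LINT s:{u<..v}|lborel. g s * weight s)"
    unfolding set_lebesgue_integral_def by (rule integral_eq_nn_integral[symmetric]) (use uv gb in \<open>auto simp: indicator_def weight_def\<close>)
  finally show "(LINT \<omega>|M. (LINT s:{u<..v}|stieltjes_measure (\<lambda>s. K s \<omega>). g s)) = (LINT s:{u<..v}|lborel. g s * weight s)"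
    unfolding path .
qed

lemma weight_set_integrable:
  assumes [measurable]: "g \<in> borel_measurable borel" and gb: "\<And>s. \<bar>g s\<bar> \<le> (2::real)" and uv: "0 \<le> u"
  shows "set_integrable lborel {u<..v} (\<lambda>s. g s * weight s)"
proof (cases "0 < v")
  case True
  have w: "integrable lborel (\<lambda>s. indicator {0<..<v} s *\<^sub>R weight s)"
    using inverse_sqrt_set(1)[OF True] unfolding set_integrable_def weight_def .
  then have "integrable lborel (\<lambda>s. 2 * (indicator {0<..<v} s *\<^sub>R weight s))" by simp
  then show ?thesis
    unfolding set_integrable_def
  proof (rule Bochner_Integration.integrable_bound)
    show "AE s in lborel. norm (indicator {u<..v} s *\<^sub>R (g s * weight s)) \<le> norm (2 * (indicator {0<..<v} s *\<^sub>R weight s))"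
      using AE_lborel_singleton[of v]
    proof eventually_elim
      case (elim s)
      show ?case using gb[of s] elim uv by (auto simp: indicator_def abs_mult intro!: mult_right_mono)
    qed
  qed measurable
next
  case False
  then have "{u<..v} = {}" using uv by auto
  then show ?thesis by (simp add: set_integrable_def)
qed

text \<open>The drift over \<open>{u<..v}\<close> has as its mean the integral of
  \<open>b s * weight s\<close>, so \<open>sine_formula\<close> applies with this density. Together
  with \<open>cos_mean\<close> it provides the two transforms that determine the law.\<close>

lemma distributed_of_representation:
  assumes b[measurable]: "b \<in> borel_measurable borel" and b1: "\<And>s. \<bar>b s\<bar> \<le> (1::real)"
    and rep: "AE \<omega> in M. \<forall>u v. 0 \<le> u \<longrightarrow> u \<le> v \<longrightarrow> V v \<omega> - V u \<omega> = (LINT s:{u<..v}|stieltjes_measure (\<lambda>s. L s \<omega>). b s)"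
    and t: "0 < t"
  shows "distributed M lborel (X t) (\<lambda>y. ennreal (skew_density b t y))"
proof (rule distributed_skew_densityI[OF prob_space_axioms _ t b b1 cos_mean[OF t]])
  show "X t \<in> borel_measurable M" using t by simp
  fix l
  have b2: "\<bar>b s\<bar> \<le> 2" "\<bar>1 + b s\<bar> \<le> 2" for s using b1[of s] by linarith+
  have Vm: "V s \<in> borel_measurable M" if "0 \<le> s" for s by (rule measurable_F_M[OF V_measurable_F[OF that order_refl]])
  have "(LINT \<omega>|M. sin (l * X t \<omega>)) = l * (LINT s:{0<..t}|lborel. exp (- (l\<^sup>2 * (t - s) / 2)) * (b s * weight s))"
  proof (rule sine_formula[OF t local_time_mean(1)[OF t]])
    show "set_integrable lborel {0<..t} (\<lambda>s. b s * weight s)"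
      by (rule weight_set_integrable[OF b b2(1) order_refl])
    fix u v :: real assume uv: "0 \<le> u" "u \<le> v" "v \<le> t"
    show "(LINT \<omega>|M. V v \<omega> - V u \<omega>) = (LINT s:{u<..v}|lborel. b s * weight s)"
    proof (cases "v = 0")
      case True
      then have "{u<..v} = {}" "u = v" using uv by auto
      then show ?thesis by (simp add: set_lebesgue_integral_def)
    next
      case False
      then have v: "0 < v" using uv by simp
      let ?I = "\<lambda>g \<omega>. LINT s:{u<..v}|stieltjes_measure (\<lambda>s. K s \<omega>). g s"
      \<comment> \<open>\<open>b\<close> changes sign, so it is written as \<open>1 + b\<close>
        minus 1, a difference of functions covered by \<open>stieltjes_mean\<close>.\<close>
      have g1: "0 \<le> 1 + b s" "1 + b s \<le> 2" for s using b1[of s] by auto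
      note m1 = stieltjes_mean[OF _ g1 uv(1,2) v] and m0 = stieltjes_mean[of "\<lambda>_. 1", OF _ _ _ uv(1,2) v]
      have eq: "AE \<omega> in M. V v \<omega> - V u \<omega> = ?I (\<lambda>s. 1 + b s) \<omega> - ?I (\<lambda>s. 1) \<omega>"
        using rep good(2)
      proof eventually_elim
        case (elim \<omega>)
        have "stieltjes_measure (\<lambda>s. L s \<omega>) = stieltjes_measure (\<lambda>s. K s \<omega>)"
          unfolding stieltjes_measure_def using elim(2) by (simp add: K_def)
        then have V: "V v \<omega> - V u \<omega> = ?I b \<omega>" using elim(1) uv by simp
        have fin: "emeasure (stieltjes_measure (\<lambda>s. K s \<omega>)) {u<..v} < \<infinity>"
          using emeasure_stieltjes(1)[OF K_path(1,2) uv(1,2)] by simp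
        have i: "set_integrable (stieltjes_measure (\<lambda>s. K s \<omega>)) {u<..v} g" if [measurable]: "g \<in> borel_measurable borel" and "\<And>s. \<bar>g s\<bar> \<le> 1" for g :: "real \<Rightarrow> real"
          unfolding set_integrable_def
          by (rule Bochner_Integration.integrable_bound[OF integrable_real_indicator[OF _ fin]])
            (use that in \<open>auto simp: indicator_def\<close>)
        have "?I (\<lambda>s. 1 + b s) \<omega> = ?I (\<lambda>s. 1) \<omega> + ?I b \<omega>"
          by (rule set_integral_add(2)) (use i[of "\<lambda>_. 1"] i[OF b b1] in simp_all)
        then show ?case using V by simp
      qed
      have "(LINT \<omega>|M. V v \<omega> - V u \<omega>) = (LINT \<omega>|M. ?I (\<lambda>s. 1 + b s) \<omega> - ?I (\<lambda>s. 1) \<omega>)"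
      proof (rule integral_cong_AE[OF _ _ eq])
        show "(\<lambda>\<omega>. V v \<omega> - V u \<omega>) \<in> borel_measurable M" using Vm uv by simp
        show "(\<lambda>\<omega>. ?I (\<lambda>s. 1 + b s) \<omega> - ?I (\<lambda>s. 1) \<omega>) \<in> borel_measurable M"
          using m1(1) m0(1) by (intro borel_measurable_diff borel_measurable_integrable) simp_all
      qed
      also have "\<dots> = (LINT s:{u<..v}|lborel. (1 + b s) * weight s) - (LINT s:{u<..v}|lborel. 1 * weight s)"
        using m1 m0 by (subst Bochner_Integration.integral_diff) simp_all
      also have "\<dots> = (LINT s:{u<..v}|lborel. (1 + b s) * weight s - 1 * weight s)"
      proof (rule set_integral_diff(2)[symmetric])
        show "set_integrable lborel {u<..v} (\<lambda>s. (1 + b s) * weight s)"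
          by (rule weight_set_integrable[OF _ b2(2) uv(1)]) measurable
        show "set_integrable lborel {u<..v} (\<lambda>s. 1 * weight s)"
          by (rule weight_set_integrable[OF _ _ uv(1)]) simp_all
      qed
      finally show ?thesis by (simp add: algebra_simps)
    qed
  qed
  also have "(LINT s:{0<..t}|lborel. exp (- (l\<^sup>2 * (t - s) / 2)) * (b s * weight s)) = (LINT s:{0<..<t}|lborel. b s * exp (- (l\<^sup>2 * (t - s) / 2)) / sqrt (2 * pi * s))"
    unfolding set_lebesgue_integral_def
  proof (rule integral_cong_AE)
    show "AE s in lborel. indicator {0<..t} s *\<^sub>R (exp (- (l\<^sup>2 * (t - s) / 2)) * (b s * weight s)) = indicator {0<..<t} s *\<^sub>R (b s * exp (- (l\<^sup>2 * (t - s) / 2)) / sqrt (2 * pi * s))"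
      using AE_lborel_singleton[of t] by eventually_elim (auto simp: indicator_def weight_def real_sqrt_mult)
  qed measurable
  finally show "(LINT \<omega>|M. sin (l * X t \<omega>)) = l * (LINT s:{0<..<t}|lborel. b s * exp (- (l\<^sup>2 * (t - s) / 2)) / sqrt (2 * pi * s))" .
qed

end

section \<open>From a weak solution to its law\<close>

text \<open>Here \<open>q\<close> is a path of the bracket. The occupation limit makes
  \<open>l\<close> nondecreasing and constant off the zeros of \<open>x\<close>, so
  \<open>dl\<close> is a genuine measure, and the equation then exhibits the drift as an integral of
  \<open>b\<close> against it.\<close>

lemma skew_path_of_solution:
  assumes cw: "continuous_on {0..} w" and cx: "continuous_on {0..} x" and cl: "continuous_on {0..} l" and cq: "continuous_on {0..} q"
    and mq: "mono_on {0..} q" and w0: "w 0 = 0" and b: "b \<in> borel_measurable borel" "\<And>s. \<bar>b s\<bar> \<le> (1::real)"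
    and lim: "\<And>t. t \<ge> 0 \<Longrightarrow> ((\<lambda>e. 1 / (2 * e) * (LINT s:{0..t}|stieltjes_measure q. indicator {-e<..<e} (x s))) \<longlongrightarrow> l t) (at_right 0)"
    and eq: "\<And>t. t \<ge> 0 \<Longrightarrow> x t = w t + (LINT s:{0..t}|stieltjes_measure l. b s)"
  shows "skew_path w x l"
    and "\<And>u v. 0 \<le> u \<Longrightarrow> u \<le> v \<Longrightarrow> (x v - w v) - (x u - w u) = (LINT s:{u<..v}|stieltjes_measure l. b s)"
proof -
  have ol1: "l 0 = 0" by (rule occupation_limit(1)[OF cq mq cx]) (rule lim, assumption)
  have ol2: "mono_on {0..} l" by (rule occupation_limit(2)[OF cq mq cx]) (rule lim, assumption)
  have ol3: "l t = l r" if h: "0 \<le> r" "r \<le> t" "\<And>s. r \<le> s \<Longrightarrow> s \<le> t \<Longrightarrow> x s \<noteq> 0" for r t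
    by (rule occupation_limit(3)[OF cq mq cx lim h(1,2)]) (simp_all add: h(3))
  note si = stieltjes_integral_increment[OF cl ol2 b]
  show inc: "(x v - w v) - (x u - w u) = (LINT s:{u<..v}|stieltjes_measure l. b s)" if "0 \<le> u" "u \<le> v" for u v
    using si(2)[OF that] eq[of u] eq[of v] that by simp
  \<comment> \<open>By continuity \<open>dl\<close> has no atom at 0, so the equation at time 0
    gives the starting value 0.\<close>
  have "emeasure (stieltjes_measure l) {0..0} = 0" using emeasure_stieltjes(2)[OF cl ol2, of 0 0] by simp
  then have "AE s in stieltjes_measure l. s \<notin> {0..0}" by (intro AE_not_in) (simp add: null_sets_def)
  then have "(LINT s:{0..0}|stieltjes_measure l. b s) = 0"
    unfolding set_lebesgue_integral_def by (intro integral_eq_zero_AE) (auto elim!: eventually_mono)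
  then have x0: "x 0 = 0" using eq[of 0] w0 by simp
  have bd: "\<bar>(x t - w t) - (x r - w r)\<bar> \<le> l t - l r" if "0 \<le> r" "r \<le> t" for r t
    unfolding inc[OF that] by (rule si(3)[OF that])
  show "skew_path w x l"
    unfolding skew_path_def
    by (intro conjI cw cx cl ol1 ol2 x0 w0 allI impI bd ol3) simp_all
qed

theorem proposition2p7:
  fixes \<beta> :: "real \<Rightarrow> real"
    and M :: "'a measure" and F :: "real \<Rightarrow> 'a measure"
    and W X :: "real \<Rightarrow> 'a \<Rightarrow> real"
  assumes "\<beta> \<in> borel_measurable (restrict_space borel {0..})"
    and "\<forall>s\<ge>0. -1 \<le> \<beta> s \<and> \<beta> s \<le> 1"
    and "weak_solution \<beta> 0 M F W X"
  shows "\<forall>t>0. distributed M lborel (X t) (\<lambda>y. ennreal (skew_density \<beta> t y))"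
proof -
  \<comment> \<open>\<beta> is Borel on \<open>{0..}\<close> only; its extension by 0 is Borel on
    the line and still bounded by 1.\<close>
  define b where "b s = indicator {0..} s *\<^sub>R \<beta> s" for s
  have b: "b \<in> borel_measurable borel"
    using assms(1) unfolding b_def[abs_def] by (subst (asm) borel_measurable_restrict_space_iff) auto
  have b1: "\<bar>b s\<bar> \<le> 1" for s using assms(2) by (auto simp: b_def indicator_def abs_le_iff)
  note ws = assms(3)[unfolded weak_solution_def]
  have fp: "filtered_prob_space M F" by (rule ws[THEN conjunct1])
  have bm: "brownian_motion M F W" by (rule ws[THEN conjunct2, THEN conjunct1])
  have cs: "continuous_semimartingale M F X" by (rule ws[THEN conjunct2, THEN conjunct2, THEN conjunct1])
  obtain L where LL: "symmetric_local_time M X L \<and>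
      (AE \<omega> in M. \<forall>t\<ge>0. X t \<omega> = 0 + W t \<omega> + (LINT s:{0..t}|stieltjes_measure (\<lambda>r. L r \<omega>). \<beta> s))"
    using ws[THEN conjunct2, THEN conjunct2, THEN conjunct2] ..
  note L = LL[THEN conjunct1, unfolded symmetric_local_time_def] and eqL = LL[THEN conjunct2]
  obtain Q where QQ: "quadratic_variation M X Q \<and>
      (AE \<omega> in M. \<forall>t\<ge>0. ((\<lambda>\<epsilon>. 1 / (2 * \<epsilon>) * (LINT s:{0..t}|stieltjes_measure (\<lambda>r. Q r \<omega>). indicator {-\<epsilon><..<\<epsilon>} (X s \<omega>))) \<longlongrightarrow> L t \<omega>) (at_right 0))"
    using L[THEN conjunct2, THEN conjunct2] ..
  note Q = QQ[THEN conjunct1] and lim = QQ[THEN conjunct2]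
  have Lm: "L t \<in> borel_measurable M" if "0 \<le> t" for t using L[THEN conjunct1] that by simp
  have cL: "AE \<omega> in M. continuous_on {0..} (\<lambda>t. L t \<omega>)"
    using L[THEN conjunct2, THEN conjunct1] unfolding continuous_process_def .
  have cQ: "AE \<omega> in M. continuous_on {0..} (\<lambda>t. Q t \<omega>)" and mQ: "AE \<omega> in M. Q 0 \<omega> = 0 \<and> mono_on {0..} (\<lambda>t. Q t \<omega>)"
    using Q unfolding quadratic_variation_def continuous_process_def by - (elim conjE; assumption)+
  have cW: "AE \<omega> in M. continuous_on {0..} (\<lambda>t. W t \<omega>)" and W0: "AE \<omega> in M. W 0 \<omega> = 0"
    using bm unfolding brownian_motion_def continuous_process_def by - (elim conjE; assumption)+
  have aX: "adapted F X" and cX: "AE \<omega> in M. continuous_on {0..} (\<lambda>t. X t \<omega>)"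
    using cs unfolding continuous_semimartingale_def continuous_process_def by - (elim conjE; assumption)+
  \<comment> \<open>All almost sure statements are intersected here, which leaves deterministic
    paths for \<open>skew_path_of_solution\<close>.\<close>
  have all: "AE \<omega> in M. skew_path (\<lambda>s. W s \<omega>) (\<lambda>s. X s \<omega>) (\<lambda>s. L s \<omega>) \<and>
    (\<forall>u v. 0 \<le> u \<longrightarrow> u \<le> v \<longrightarrow> (X v \<omega> - W v \<omega>) - (X u \<omega> - W u \<omega>) = (LINT s:{u<..v}|stieltjes_measure (\<lambda>s. L s \<omega>). b s))"
    using cW cX cL cQ mQ W0 lim eqL
  proof eventually_elim
    case (elim \<omega>)
    have eb: "X t \<omega> = W t \<omega> + (LINT s:{0..t}|stieltjes_measure (\<lambda>s. L s \<omega>). b s)" if "t \<ge> 0" for t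
    proof -
      have "(LINT s:{0..t}|stieltjes_measure (\<lambda>s. L s \<omega>). \<beta> s) = (LINT s:{0..t}|stieltjes_measure (\<lambda>s. L s \<omega>). b s)"
        unfolding set_lebesgue_integral_def by (intro Bochner_Integration.integral_cong) (auto simp: b_def indicator_def)
      then show ?thesis using elim(8) that by simp
    qed
    note S = skew_path_of_solution[OF elim(1-4) conjunct2[OF elim(5)] elim(6) b b1 elim(7)[rule_format] eb]
    show ?case by (intro conjI allI impI S) simp_all
  qed
  interpret filtered_prob_space M F by (rule fp)
  interpret brownian_filtered M F W by unfold_locales (rule bm)
  interpret skew_paths M F W X L
  proof unfold_locales
    show "X t \<in> borel_measurable (F t)" if "0 \<le> t" for t using aX that unfolding adapted_def by simp
    show "L t \<in> borel_measurable M" if "0 \<le> t" for t by (rule Lm[OF that])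
    show "AE \<omega> in M. skew_path (\<lambda>s. W s \<omega>) (\<lambda>s. X s \<omega>) (\<lambda>s. L s \<omega>)" using all by eventually_elim simp
  qed
  interpret skew_local_time M F W X L
  proof unfold_locales
    \<comment> \<open>The local time is defined through the bracket \<open>Q\<close>; now that
      \<open>quadratic_variation_eq_time\<close> applies, \<open>dQ\<close> can be replaced by
      Lebesgue measure.\<close>
    show "AE \<omega> in M. \<forall>t\<ge>0. ((\<lambda>e. 1 / (2 * e) * (LINT s:{0..t}|lborel. indicator {-e<..<e} (X s \<omega>))) \<longlongrightarrow> L t \<omega>) (at_right 0)"
      using lim quadratic_variation_eq_time[OF Q] cX
    proof eventually_elim
      case (elim \<omega>)
      have "(LINT s:{0..t}|stieltjes_measure (\<lambda>r. Q r \<omega>). indicator {-e<..<e} (X s \<omega>)) = (LINT s:{0..t}|lborel. indicator {-e<..<e} (X s \<omega>) :: real)" for t e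
      proof -
        have "continuous_on UNIV (\<lambda>s. X (max 0 s) \<omega>)"
          by (rule continuous_on_compose2[OF elim(3)]) (auto intro!: continuous_intros)
        then have [measurable]: "(\<lambda>s. X (max 0 s) \<omega>) \<in> borel_measurable borel" by (rule borel_measurable_continuous_onI)
        have c: "(LINT s:{0..t}|N. indicator {-e<..<e} (X s \<omega>)) = (LINT s:{0..t}|N. indicator {-e<..<e} (X (max 0 s) \<omega>) :: real)" for N
          unfolding set_lebesgue_integral_def by (intro Bochner_Integration.integral_cong) (auto simp: indicator_def)
        show ?thesis unfolding c by (rule stieltjes_integral_ident) (use elim(2) in \<open>auto\<close>)
      qed
      then show ?case using elim(1) by simp
    qed
  qed
  show ?thesis
  proof (intro allI impI)
    fix t :: real assume t: "0 < t"
    have "AE \<omega> in M. \<forall>u v. 0 \<le> u \<longrightarrow> u \<le> v \<longrightarrow> V v \<omega> - V u \<omega> = (LINT s:{u<..v}|stieltjes_measure (\<lambda>s. L s \<omega>). b s)"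
      using all unfolding V_def by eventually_elim (rule conjunct2)
    from distributed_of_representation[OF b b1 this t]
    have "distributed M lborel (X t) (\<lambda>y. ennreal (skew_density b t y))" .
    \<comment> \<open>The density integrates over \<open>{0<..<t}\<close>, where \<open>b\<close>
      and \<beta> agree.\<close>
    moreover have "skew_density b t = skew_density \<beta> t"
      unfolding skew_density_def[abs_def] set_lebesgue_integral_def
      by (intro ext arg_cong2[where f="(*)"] refl Bochner_Integration.integral_cong) (auto simp: b_def indicator_def)
    ultimately show "distributed M lborel (X t) (\<lambda>y. ennreal (skew_density \<beta> t y))" by (simp only:)
  qed
qed

end
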